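(* Let $x\in\mathbb{C}$ be fixed with $|x|=1$, not a root of unity and of finite type, and let $\sigma\in S_n$ be chosen uniformly at random. Let $Z_n(x)=\det(I-x\sigma)$ be the characteristic polynomial of the permutation matrix of $\sigma$ and let $\mathrm{Log}(Z_n(x))$ be defined as in the context. Then, as $n\to\infty$, the pair $$\left(\mathrm{Re}\left(\frac{\mathrm{Log}(Z_n(x))}{\sqrt{\frac{\pi^2}{12}\log n}}\right),\ \mathrm{Im}\left(\frac{\mathrm{Log}(Z_n(x))}{\sqrt{\frac{\pi^2}{12}\log n}}\right)\right)$$ converges in distribution to $(\mathcal{N}_a,\mathcal{N}_b)$, where $\mathcal{N}_a$ and $\mathcal{N}_b$ are standard normal random variables, and $\mathcal{N}_a$ and $\mathcal{N}_b$ are independent.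
   Context: A permutation $\sigma\in S_n$ is identified with the permutation matrix $(\delta_{i,\sigma(j)})_{1\le i,j\le n}$. Let $C_m^{(n)}$ be the number of cycles of length $m$ of $\sigma$. One has $Z_n(x)=\prod_{m=1}^n(1-x^m)^{C_m^{(n)}}$, and the logarithm is defined by $\mathrm{Log}(Z_n(x))=\sum_{m=1}^n C_m^{(n)}\log(1-x^m)$ with $\log$ the principal branch. Finite type: $x=e^{2\pi i t}$ ($t\in\mathbb{R}$) is of finite type if there exist constants $K,\gamma>0$ such that $\|\{mt\}\|>\frac{K}{|m|^\gamma}$ for all $m\in\mathbb{Z}\setminus\{0\}$, where $\{s\}=s-\lfloor s\rfloor$ is the fractional part and $\|s\|=\min\{s,1-s\}$ for $s\in[0,1]$. *)

theory Defs
  imports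
    "HOL-Probability.Probability"
    "HOL-Combinatorics.Orbits"
    "HOL-Combinatorics.Cycles"
    "Jordan_Normal_Form.Determinant"
begin

text \<open>Both HOL-Analysis and Jordan_Normal_Form provide matrices and determinants; the latter
  are used here because their dimension is a natural number. Accordingly, permutations of
  \<open>{..<n}\<close> are used instead of permutations of \<open>{1..n}\<close>.\<close>

definition perm_matrix :: "nat \<Rightarrow> (nat \<Rightarrow> nat) \<Rightarrow> complex Matrix.mat" where
  "perm_matrix n \<sigma> = Matrix.mat n n (\<lambda>(i, j). if i = \<sigma> j then 1 else 0)"

definition perm_charpoly :: "nat \<Rightarrow> complex \<Rightarrow> (nat \<Rightarrow> nat) \<Rightarrow> complex" where
  "perm_charpoly n x \<sigma> = Determinant.det (1\<^sub>m n - x \<cdot>\<^sub>m perm_matrix n \<sigma>)"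

definition cycle_count :: "nat \<Rightarrow> nat \<Rightarrow> (nat \<Rightarrow> nat) \<Rightarrow> nat" where
  "cycle_count n m \<sigma> = card {c \<in> orbit \<sigma> ` {..<n}. card c = m}"

text \<open>This is in general not \<open>Ln (perm_charpoly n x \<sigma>)\<close>, but it is a logarithm of
  \<open>perm_charpoly n x \<sigma>\<close>: see \<open>exp_Log_perm_charpoly\<close> below.\<close>

definition Log_perm_charpoly :: "nat \<Rightarrow> complex \<Rightarrow> (nat \<Rightarrow> nat) \<Rightarrow> complex" where
  "Log_perm_charpoly n x \<sigma> = (\<Sum>m = 1..n. of_nat (cycle_count n m \<sigma>) * Ln (1 - x ^ m))"

definition torus_norm :: "real \<Rightarrow> real" where
  "torus_norm s = min s (1 - s)"

definition finite_type :: "complex \<Rightarrow> bool" where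
  "finite_type x \<longleftrightarrow>
    (\<exists>t::real. x = exp (2 * of_real pi * \<i> * of_real t) \<and>
      (\<exists>K>0. \<exists>\<gamma>>0. \<forall>m::int. m \<noteq> 0 \<longrightarrow>
         torus_norm (frac (of_int m * t)) > K / \<bar>of_int m\<bar> powr \<gamma>))"

text \<open>HOL-Probability defines weak convergence (\<open>weak_conv_m\<close>) only for measures on the real
  line. In general, it means convergence of the expectations of bounded continuous functions.\<close>

definition converges_in_distribution ::
  "(nat \<Rightarrow> 'a measure) \<Rightarrow> (nat \<Rightarrow> 'a \<Rightarrow> 'c::topological_space) \<Rightarrow> 'b measure \<Rightarrow> ('b \<Rightarrow> 'c) \<Rightarrow> bool"
where
  "converges_in_distribution M X N Y \<longleftrightarrow>
    (\<forall>n. prob_space (M n) \<and> X n \<in> borel_measurable (M n)) \<and>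
    prob_space N \<and> Y \<in> borel_measurable N \<and>
    (\<forall>f::'c \<Rightarrow> real. continuous_on UNIV f \<longrightarrow> bounded (range f) \<longrightarrow>
      (\<lambda>n. \<integral>\<omega>. f (X n \<omega>) \<partial>M n) \<longlonglongrightarrow> (\<integral>\<omega>. f (Y \<omega>) \<partial>N))"


subsection \<open>The characteristic polynomial in terms of the cycle counts\<close>

text \<open>\<open>perm_det \<sigma> x S\<close> is the Leibniz expansion of \<open>det (I - x \<sigma>)\<close>, restricted to an invariant set \<open>S\<close>.\<close>

definition perm_det :: "('a \<Rightarrow> 'a) \<Rightarrow> complex \<Rightarrow> 'a set \<Rightarrow> complex" where
  "perm_det \<sigma> x S = (\<Sum>\<tau> | \<tau> permutes S. of_int (sign \<tau>) *
     (\<Prod>i\<in>S. (if \<tau> i = i then 1 else 0) - x * (if \<tau> i = \<sigma> i then 1 else 0)))"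

lemma perm_det_Un:
  assumes fin: "finite A" "finite B" and disj: "A \<inter> B = {}"
    and inv: "\<sigma> ` A \<subseteq> A" "\<sigma> ` B \<subseteq> B"
  shows "perm_det \<sigma> x (A \<union> B) = perm_det \<sigma> x A * perm_det \<sigma> x B"
proof -
  define h where
    "h = (\<lambda>\<tau> i. (if \<tau> i = i then 1 else 0) - x * (if \<tau> i = \<sigma> i then 1 else 0))"
  define t where "t = (\<lambda>S \<tau>. of_int (sign \<tau>) * (\<Prod>i\<in>S. h \<tau> i))"
  have t: "perm_det \<sigma> x S = (\<Sum>\<tau> | \<tau> permutes S. t S \<tau>)" for S
    by (simp add: perm_det_def t_def h_def)
  define P where "P = {\<tau>. \<tau> permutes (A \<union> B) \<and> \<tau> ` A \<subseteq> A \<and> \<tau> ` B \<subseteq> B}"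
  have "perm_det \<sigma> x (A \<union> B) = (\<Sum>\<tau>\<in>P. t (A \<union> B) \<tau>)"
    unfolding t
  proof (rule sum.mono_neutral_right)
    show "finite {\<tau>. \<tau> permutes (A \<union> B)}"
      using fin by (simp add: finite_permutations)
    show "P \<subseteq> {\<tau>. \<tau> permutes (A \<union> B)}"
      by (auto simp: P_def)
    show "\<forall>\<tau>\<in>{\<tau>. \<tau> permutes (A \<union> B)} - P. t (A \<union> B) \<tau> = 0"
    proof
      fix \<tau> assume "\<tau> \<in> {\<tau>. \<tau> permutes (A \<union> B)} - P"
      then obtain i where "i \<in> A \<union> B" "\<tau> i \<noteq> i" "\<tau> i \<noteq> \<sigma> i"
        using inv by (fastforce simp: P_def)
      then show "t (A \<union> B) \<tau> = 0"
        using fin by (auto simp: t_def h_def)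
    qed
  qed
  also have "\<dots> = (\<Sum>(\<tau>1, \<tau>2)\<in>{\<tau>. \<tau> permutes A} \<times> {\<tau>. \<tau> permutes B}. t A \<tau>1 * t B \<tau>2)"
  proof (rule sum.reindex_bij_witness[where
        i = "\<lambda>(\<tau>1, \<tau>2). \<tau>1 \<circ> \<tau>2" and j = "\<lambda>\<tau>. (perm_restrict \<tau> A, perm_restrict \<tau> B)"])
    fix \<tau> assume "\<tau> \<in> P"
    then have \<tau>: "\<tau> permutes (A \<union> B)" "\<tau> ` A \<subseteq> A" "\<tau> ` B \<subseteq> B"
      by (auto simp: P_def)
    have pr: "perm_restrict \<tau> S permutes S" if "S \<subseteq> A \<union> B" "finite S" "\<tau> ` S \<subseteq> S" for S
    proof (rule bij_imp_permutes)
      have "inj_on \<tau> S"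
        using permutes_inj[OF \<tau>(1)] by (rule inj_on_subset) auto
      then have "bij_betw \<tau> S S"
        using that endo_inj_surj by (metis bij_betw_def)
      then show "bij_betw (perm_restrict \<tau> S) S S"
        by (rule bij_betw_cong[THEN iffD1, rotated]) (simp add: perm_restrict_simps)
    qed (simp add: perm_restrict_simps)
    have prA: "perm_restrict \<tau> A permutes A" and prB: "perm_restrict \<tau> B permutes B"
      using pr \<tau> fin by auto
    have comp: "perm_restrict \<tau> A \<circ> perm_restrict \<tau> B = \<tau>"
      using perm_restrict_union[OF prA prB disj] \<tau>(1) by simp
    show "(case (perm_restrict \<tau> A, perm_restrict \<tau> B) of (\<tau>1, \<tau>2) \<Rightarrow> \<tau>1 \<circ> \<tau>2) = \<tau>"
      using comp by simp
    show "(perm_restrict \<tau> A, perm_restrict \<tau> B) \<in> {\<tau>. \<tau> permutes A} \<times> {\<tau>. \<tau> permutes B}"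
      using prA prB by simp
    have "sign \<tau> = sign (perm_restrict \<tau> A) * sign (perm_restrict \<tau> B)"
      using sign_compose[of "perm_restrict \<tau> A" "perm_restrict \<tau> B"] prA prB fin comp
      by (metis permutation_permutes)
    moreover have "(\<Prod>i\<in>A \<union> B. h \<tau> i) =
        (\<Prod>i\<in>A. h (perm_restrict \<tau> A) i) * (\<Prod>i\<in>B. h (perm_restrict \<tau> B) i)"
      using fin disj by (simp add: prod.union_disjoint h_def perm_restrict_simps)
    ultimately show "(case (perm_restrict \<tau> A, perm_restrict \<tau> B) of (\<tau>1, \<tau>2) \<Rightarrow> t A \<tau>1 * t B \<tau>2)
        = t (A \<union> B) \<tau>"
      by (simp add: t_def)
  next
    fix p assume "p \<in> {\<tau>. \<tau> permutes A} \<times> {\<tau>. \<tau> permutes B}"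
    then obtain \<tau>1 \<tau>2 where p: "p = (\<tau>1, \<tau>2)" "\<tau>1 permutes A" "\<tau>2 permutes B"
      by auto
    have on_A: "(\<tau>1 \<circ> \<tau>2) i = \<tau>1 i" if "i \<in> A" for i
      using that disj p(3) by (metis comp_apply disjoint_iff permutes_not_in)
    have on_B: "(\<tau>1 \<circ> \<tau>2) i = \<tau>2 i" if "i \<in> B" for i
    proof -
      have "\<tau>2 i \<notin> A"
        using that disj permutes_in_image[OF p(3), of i] by blast
      then show ?thesis
        using permutes_not_in[OF p(2)] by simp
    qed
    have "\<tau>1 permutes (A \<union> B)" "\<tau>2 permutes (A \<union> B)"
      using p by (auto intro: permutes_subset)
    then have "\<tau>1 \<circ> \<tau>2 permutes (A \<union> B)"
      by (rule permutes_compose[rotated])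
    then show "(case p of (\<tau>1, \<tau>2) \<Rightarrow> \<tau>1 \<circ> \<tau>2) \<in> P"
      using on_A on_B p permutes_in_image[OF p(2)] permutes_in_image[OF p(3)]
      by (auto simp: P_def simp del: comp_apply)
    have "perm_restrict (\<tau>1 \<circ> \<tau>2) A = \<tau>1" "perm_restrict (\<tau>1 \<circ> \<tau>2) B = \<tau>2"
      using on_A on_B p(2,3)
      by (auto simp: perm_restrict_def fun_eq_iff permutes_not_in simp del: comp_apply)
    then show "(perm_restrict (case p of (\<tau>1, \<tau>2) \<Rightarrow> \<tau>1 \<circ> \<tau>2) A,
        perm_restrict (case p of (\<tau>1, \<tau>2) \<Rightarrow> \<tau>1 \<circ> \<tau>2) B) = p"
      using p(1) by simp
  qed
  also have "\<dots> = perm_det \<sigma> x A * perm_det \<sigma> x B"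
    by (simp add: t sum_product sum.cartesian_product)
  finally show ?thesis .
qed

lemma sign_cycle_of_list: "cs \<noteq> [] \<Longrightarrow> distinct cs \<Longrightarrow> sign (cycle_of_list cs) = (- 1) ^ (length cs - 1)"
proof (induction cs rule: cycle_of_list.induct)
  case (1 i j cs)
  have "sign (cycle_of_list (i # j # cs)) = sign (Transposition.transpose i j) * sign (cycle_of_list (j # cs))"
    by (simp only: cycle_of_list.simps)
       (intro sign_compose permutation_swap_id permutation_of_cycle)
  then show ?case
    using 1 by (simp add: sign_swap_id del: cycle_of_list.simps)
qed auto

lemma perm_det_cycle:
  fixes \<sigma> :: "'a \<Rightarrow> 'a"
  assumes \<sigma>: "permutation \<sigma>"
  shows "perm_det \<sigma> x (orbit \<sigma> a) = 1 - x ^ card (orbit \<sigma> a)"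
proof -
  define C where "C = orbit \<sigma> a"
  define c where "c = cycle_of_list (support \<sigma> a)"
  have C: "C = set (support \<sigma> a)"
    unfolding C_def support_set[OF \<sigma>] orbit_altdef_permutation[OF \<sigma>] by auto
  then have fin: "finite C"
    by simp
  have a: "a \<in> C"
    unfolding C_def by (rule permutation_self_in_orbit[OF \<sigma>])
  have c_perm: "c permutes C"
    unfolding c_def C by (rule cycle_permutes)
  have c_eq: "c i = \<sigma> i" if "i \<in> C" for i
    using cycle_restrict[OF \<sigma>, of i a] that by (simp add: C c_def)
  have ne: "support \<sigma> a \<noteq> []"
    using a C by (metis empty_iff empty_set)
  have card: "card C = length (support \<sigma> a)"
    unfolding C by (rule distinct_card[OF cycle_of_permutation[OF \<sigma>]])
  have card_pos: "card C > 0"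
    using a fin by (auto simp: card_gt_0_iff)
  have sgn: "sign c = (- 1) ^ (card C - 1)"
    using sign_cycle_of_list[OF ne cycle_of_permutation[OF \<sigma>]] card by (simp add: c_def)
  define h where
    "h = (\<lambda>\<tau> i. (if \<tau> i = i then 1 else 0) - x * (if \<tau> i = \<sigma> i then 1 else 0))"
  define t where "t = (\<lambda>\<tau>. of_int (sign \<tau>) * (\<Prod>i\<in>C. h \<tau> i))"
  have "perm_det \<sigma> x C = (\<Sum>\<tau> | \<tau> permutes C. t \<tau>)"
    by (simp add: perm_det_def t_def h_def)
  also have "\<dots> = (\<Sum>\<tau>\<in>{id, c}. t \<tau>)"
  proof (rule sum.mono_neutral_right)
    show "finite {\<tau>. \<tau> permutes C}"
      using fin by (simp add: finite_permutations)
    show "{id, c} \<subseteq> {\<tau>. \<tau> permutes C}"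
      using c_perm by (auto simp: permutes_id)
    show "\<forall>\<tau>\<in>{\<tau>. \<tau> permutes C} - {id, c}. t \<tau> = 0"
    proof (rule ballI, rule ccontr)
      fix \<tau> assume \<tau>: "\<tau> \<in> {\<tau>. \<tau> permutes C} - {id, c}" and "t \<tau> \<noteq> 0"
      then have dich: "\<tau> i = i \<or> \<tau> i = \<sigma> i" if "i \<in> C" for i
        using that fin by (fastforce simp: t_def h_def)
      from \<tau> have \<tau>_perm: "\<tau> permutes C" and "\<tau> \<noteq> id" "\<tau> \<noteq> c"
        by auto
      from \<open>\<tau> \<noteq> id\<close> obtain b where b: "\<tau> b \<noteq> b"
        by (auto simp: fun_eq_iff)
      then have "b \<in> C"
        using \<tau>_perm by (meson permutes_not_in)
      then have C_b: "C = orbit \<sigma> b"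
        unfolding C_def using orbit_cyclic_eq3[OF cyclic_on_orbit'[OF \<sigma>, of a], of b] by simp
      have moved: "\<tau> i = \<sigma> i \<and> \<sigma> i \<noteq> i" if "i \<in> C" for i
      proof -
        have "(\<tau> i = \<sigma> i \<and> \<sigma> i \<noteq> i) \<and> i \<in> C" if "\<exists>n. i = (\<sigma> ^^ n) b" for i
        proof -
          from that obtain n where "i = (\<sigma> ^^ n) b" by blast
          then show ?thesis
          proof (induction n arbitrary: i)
            case 0
            then show ?case using b dich[of b] \<open>b \<in> C\<close> by auto
          next
            case (Suc n)
            define j where "j = (\<sigma> ^^ n) b"
            have j: "\<tau> j = \<sigma> j" "\<sigma> j \<noteq> j" "j \<in> C"
              using Suc.IH[of j] by (auto simp: j_def)
            have i: "i = \<sigma> j" using Suc.prems by (simp add: j_def)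
            have iC: "i \<in> C" using j(3) c_eq[OF j(3)] permutes_in_image[OF c_perm] i by metis
            have "\<tau> i \<noteq> i"
              using j permutes_inj[OF \<tau>_perm] i by (metis injD)
            then show ?case
              using dich[OF iC] iC by auto
          qed
        qed
        then show ?thesis
          using that orbit_altdef_permutation[OF \<sigma>, of b] C_b by auto
      qed
      have "\<tau> = c"
      proof
        fix i show "\<tau> i = c i"
          by (cases "i \<in> C") (use moved c_eq permutes_not_in[OF \<tau>_perm] permutes_not_in[OF c_perm] in auto)
      qed
      then show False
        using \<open>\<tau> \<noteq> c\<close> by contradiction
    qed
  qed
  also have "\<dots> = 1 - x ^ card C"
  proof (cases "card C = 1")
    case True
    then have "C = {a}"
      using a by (auto simp: card_1_singleton_iff)
    then have "\<sigma> a = a"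
      by (simp add: C_def orbit_eq_singleton_iff)
    moreover have "c = id"
      using c_perm \<open>C = {a}\<close> by (simp add: permutes_sing)
    ultimately show ?thesis
      using \<open>C = {a}\<close> by (simp add: t_def h_def)
  next
    case False
    have no_fix: "\<sigma> i \<noteq> i" if "i \<in> C" for i
      using eq_on_cyclic_on_iff1[OF cyclic_on_orbit'[OF \<sigma>, of a], of i] that False
      by (metis C_def)
    then have "c \<noteq> id"
      using a c_eq by (metis id_apply)
    have "t id = 1"
      using no_fix[symmetric] by (auto simp: t_def h_def intro!: prod.neutral)
    moreover have "t c = of_int (sign c) * (- x) ^ card C"
    proof -
      have "(\<Prod>i\<in>C. h c i) = (\<Prod>i\<in>C. - x)"
        using no_fix c_eq by (intro prod.cong) (auto simp: h_def)
      then show ?thesis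
        by (simp add: t_def)
    qed
    moreover have "of_int (sign c) * (- x) ^ card C = - (x ^ card C)"
    proof -
      obtain k where "card C = Suc k"
        using card_pos by (auto simp: gr0_conv_Suc)
      then show ?thesis
        by (cases "even k") (simp_all add: sgn)
    qed
    ultimately show ?thesis
      using \<open>c \<noteq> id\<close> by simp
  qed
  finally show ?thesis
    by (simp add: C_def)
qed

lemma perm_det_eq_prod_orbits:
  assumes \<sigma>: "permutation \<sigma>" and "finite S" and "\<And>i. i \<in> S \<Longrightarrow> orbit \<sigma> i \<subseteq> S"
  shows "perm_det \<sigma> x S = (\<Prod>c\<in>orbit \<sigma> ` S. 1 - x ^ card c)"
  using assms(2,3)
proof (induction "card S" arbitrary: S rule: less_induct)
  case less
  show ?case
  proof (cases "S = {}")
    case True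
    then show ?thesis by (simp add: perm_det_def)
  next
    case False
    then obtain a where a: "a \<in> S" by blast
    define C T where "C = orbit \<sigma> a" and "T = S - C"
    have self: "i \<in> orbit \<sigma> i" for i
      by (rule permutation_self_in_orbit[OF \<sigma>])
    have orb_C: "orbit \<sigma> i = C" if "i \<in> C" for i
      using orbit_cyclic_eq3[OF cyclic_on_orbit'[OF \<sigma>, of a], of i] that by (simp add: C_def)
    have orb_eq: "orbit \<sigma> j = orbit \<sigma> i" if "j \<in> orbit \<sigma> i" for i j
      using orbit_cyclic_eq3[OF cyclic_on_orbit'[OF \<sigma>, of i], of j] that by simp
    have "C \<subseteq> S"
      using less.prems(2)[OF a] by (simp add: C_def)
    have fin: "finite C" "finite T"
      using less.prems(1) \<open>C \<subseteq> S\<close> by (auto simp: T_def intro: finite_subset)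
    have S: "S = C \<union> T" and disj: "C \<inter> T = {}"
      using \<open>C \<subseteq> S\<close> by (auto simp: T_def)
    have T: "orbit \<sigma> i \<subseteq> T" if "i \<in> T" for i
    proof
      fix j assume j: "j \<in> orbit \<sigma> i"
      have "j \<notin> C"
      proof
        assume "j \<in> C"
        then have "orbit \<sigma> i = C" using orb_C orb_eq[OF j] by simp
        then show False using self[of i] that by (auto simp: T_def)
      qed
      then show "j \<in> T"
        using j less.prems(2)[of i] that by (auto simp: T_def)
    qed
    have "card T < card S"
      using a self[of a] less.prems(1) by (intro psubset_card_mono) (auto simp: T_def C_def)
    then have IH: "perm_det \<sigma> x T = (\<Prod>c\<in>orbit \<sigma> ` T. 1 - x ^ card c)"
      using less.hyps fin(2) T by blast
    have "perm_det \<sigma> x S = perm_det \<sigma> x C * perm_det \<sigma> x T"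
      unfolding S using T
      by (intro perm_det_Un fin disj) (auto simp: C_def intro: orbit.intros)
    also have "perm_det \<sigma> x C = 1 - x ^ card C"
      unfolding C_def by (rule perm_det_cycle[OF \<sigma>])
    finally have "perm_det \<sigma> x S = (1 - x ^ card C) * (\<Prod>c\<in>orbit \<sigma> ` T. 1 - x ^ card c)"
      by (simp only: IH)
    moreover have "orbit \<sigma> ` C = {C}"
      using orb_C self[of a] by (auto simp: C_def[symmetric] intro: rev_image_eqI)
    then have "orbit \<sigma> ` S = insert C (orbit \<sigma> ` T)"
      by (simp add: S image_Un)
    moreover have "C \<notin> orbit \<sigma> ` T"
      using T self[of a] disj by (auto simp: C_def)
    ultimately show ?thesis
      using fin(2) by simp
  qed
qed

theorem perm_charpoly_eq_prod:
  assumes \<sigma>: "\<sigma> permutes {..<n}"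
  shows "perm_charpoly n x \<sigma> = (\<Prod>m = 1..n. (1 - x ^ m) ^ cycle_count n m \<sigma>)"
proof -
  have perm: "permutation \<sigma>"
    using \<sigma> by (auto simp: permutation_permutes)
  have "1\<^sub>m n - x \<cdot>\<^sub>m perm_matrix n \<sigma> \<in> carrier_mat n n"
    by (auto simp: perm_matrix_def)
  then have "perm_charpoly n x \<sigma> = (\<Sum>\<tau> | \<tau> permutes {0..<n}. signof \<tau> *
      (\<Prod>j<n. (1\<^sub>m n - x \<cdot>\<^sub>m perm_matrix n \<sigma>) $$ (\<tau> j, j)))"
    unfolding perm_charpoly_def by (rule det_col)
  also have "\<dots> = perm_det \<sigma> x {..<n}"
    unfolding perm_det_def atLeast0LessThan
  proof (intro sum.cong refl arg_cong2[of _ _ _ _ "(*)"] prod.cong)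
    fix \<tau> j assume "\<tau> \<in> {\<tau>. \<tau> permutes {..<n}}" "j \<in> {..<n}"
    then have "\<tau> j < n" "j < n"
      using permutes_in_image[of \<tau> "{..<n}" j] by auto
    then show "(1\<^sub>m n - x \<cdot>\<^sub>m perm_matrix n \<sigma>) $$ (\<tau> j, j) =
        (if \<tau> j = j then 1 else 0) - x * (if \<tau> j = \<sigma> j then 1 else 0)"
      by (simp add: perm_matrix_def)
  qed
  also have "\<dots> = (\<Prod>c\<in>orbit \<sigma> ` {..<n}. 1 - x ^ card c)"
    using permutes_orbit_subset[OF \<sigma>] by (intro perm_det_eq_prod_orbits perm) auto
  also have "\<dots> = (\<Prod>m = 1..n. \<Prod>c\<in>{c \<in> orbit \<sigma> ` {..<n}. card c = m}. 1 - x ^ card c)"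
  proof (rule prod.group[symmetric])
    show "card ` (orbit \<sigma> ` {..<n}) \<subseteq> {1..n}"
    proof (clarify)
      fix i assume "i < n"
      then have "orbit \<sigma> i \<subseteq> {..<n}"
        using permutes_orbit_subset[OF \<sigma>] by simp
      then have "card (orbit \<sigma> i) \<le> n" "finite (orbit \<sigma> i)"
        using card_mono[of "{..<n}"] by (auto intro: finite_subset)
      then show "card (orbit \<sigma> i) \<in> {1..n}"
        using orbit_nonempty[of \<sigma> i] by (simp add: Suc_le_eq card_gt_0_iff)
    qed
  qed auto
  also have "\<dots> = (\<Prod>m = 1..n. (1 - x ^ m) ^ cycle_count n m \<sigma>)"
    by (intro prod.cong refl) (simp add: cycle_count_def)
  finally show ?thesis .
qed

corollary exp_Log_perm_charpoly:
  assumes "\<sigma> permutes {..<n}" and "\<forall>k::nat. k \<ge> 1 \<longrightarrow> x ^ k \<noteq> 1"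
  shows "exp (Log_perm_charpoly n x \<sigma>) = perm_charpoly n x \<sigma>"
proof -
  have "exp (Log_perm_charpoly n x \<sigma>) = (\<Prod>m = 1..n. exp (Ln (1 - x ^ m)) ^ cycle_count n m \<sigma>)"
    unfolding Log_perm_charpoly_def by (simp add: exp_sum exp_of_nat_mult)
  also have "\<dots> = (\<Prod>m = 1..n. (1 - x ^ m) ^ cycle_count n m \<sigma>)"
    using assms(2) by (intro prod.cong refl) (auto intro!: arg_cong2[of _ _ _ _ "(^)"] exp_Ln)
  finally show ?thesis
    using perm_charpoly_eq_prod[OF assms(1)] by simp
qed

end

theory Submission
  imports Defs "HOL-Complex_Analysis.Complex_Analysis" "HOL-Real_Asymp.Real_Asymp"
begin

text \<open>The expectation of \<open>\<Prod>m. \<theta> m ^ C m\<close> over the permutations of \<open>n\<close> points is \<open>h n\<close>, where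
  \<open>n * h n = (\<Sum>k<n. \<theta> (n - k) * h k)\<close>. If \<open>cmod (\<theta> m) \<le> 1\<close>, then \<open>h n\<close> differs from
  \<open>exp (\<Sum>m = 1..n. (\<theta> m - 1) / m)\<close>, its value for independent Poisson variables of means \<open>1 / m\<close>,
  by at most twice the mean of \<open>cmod (\<theta> m - 1)\<close>. For \<open>\<theta> m = cis (\<tau> * a m)\<close>, where \<open>a m\<close> is a linear
  form of \<open>z m = Ln (1 - x ^ m)\<close> and \<open>\<tau>\<close> is of order \<open>1 / sqrt (ln n)\<close>, the exponent
  is controlled by the sums of \<open>z m\<close>, \<open>(z m)\<^sup>2\<close>, \<open>(cmod (z m))\<^sup>2\<close> and \<open>(cmod (z m)) ^ 4\<close>. Expanding the
  logarithm reduces all of these to \<open>\<Sum>k. cmod (\<Sum>m = 1..M. x ^ (k * m)) / k\<close>, which the finite type of \<open>x\<close>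
  makes smaller than \<open>M\<close> by a power of \<open>M\<close>. Finally, convergence of the characteristic functions
  implies convergence in distribution in the plane by the Stone--Weierstrass theorem on the torus.\<close>

subsection \<open>Cycle weights of permutations\<close>

text \<open>On the unit circle \<open>Ln (1 - w)\<close> is the series with coefficients - 1 / k.
  Its square has positive frequencies only, hence mean 0, while its squared modulus has mean Sum 1 /
  k^2 = pi^2 / 6. The square of s Re z + t Im z is half of (s^2 + t^2) |z|^2 plus the real part of a
  multiple of z^2, so its mean is (s^2 + t^2) pi^2 / 12. That is the origin of the normalisation,
  and the missing cross term is the independence of the limits. The obstacle is that the logarithm
  is unbounded near w = 1: equidistribution of the \<open>x ^ m\<close> alone does not give these
  means. Finite type keeps \<open>x ^ m\<close> at a polynomial distance from 1, so for m \<le> M a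
  partial sum of length polynomial in M suffices; its coefficients cost powers of ln M, which the
  power saving in the exponential sums absorbs. The fourth moment is there because the Poisson
  comparison and the Taylor remainder involve first and third absolute moments; the fourth is the
  mean square of the squared series and so within reach of the same orthogonality argument.\<close>

text \<open>The guard \<open>k \<le> n\<close> is always true; it is there for the termination prover.\<close>

fun cycle_weight :: "(nat \<Rightarrow> complex) \<Rightarrow> nat \<Rightarrow> complex" where
  "cycle_weight \<theta> 0 = 1"
| "cycle_weight \<theta> (Suc n) = (\<Sum>k\<le>n. \<theta> (Suc n - k) * (if k \<le> n then cycle_weight \<theta> k else 0)) / of_nat (Suc n)"

declare cycle_weight.simps [simp del]

text \<open>With H the generating function of the weights and T(w) the sum of \<theta> m w^m over m
  \<ge> 1, this is the equation w H' = T H, solved by the exponential of Sum \<theta> m w^m / m. At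
  \<open>n = 0\<close> both sides vanish.\<close>

lemma cycle_weight_rec: "of_nat n * cycle_weight \<theta> n = (\<Sum>k<n. \<theta> (n - k) * cycle_weight \<theta> k)"
  by (cases n) (simp_all add: cycle_weight.simps lessThan_Suc_atMost del: of_nat_Suc)

lemma orbit_comp_disjoint:
  assumes c: "c permutes C" and \<tau>: "\<tau> permutes D" and disj: "C \<inter> D = {}"
  shows "i \<in> C \<Longrightarrow> orbit (c \<circ> \<tau>) i = orbit c i" "i \<in> D \<Longrightarrow> orbit (c \<circ> \<tau>) i = orbit \<tau> i"
proof -
  have onC: "(c \<circ> \<tau>) j = c j" if "j \<in> C" for j
    using that disj \<tau> by (metis comp_apply disjoint_iff permutes_not_in)
  have onD: "(c \<circ> \<tau>) j = \<tau> j" if "j \<in> D" for j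
    using that disj permutes_not_in[OF c] permutes_in_image[OF \<tau>, of j] by auto
  show "orbit (c \<circ> \<tau>) i = orbit c i" if "i \<in> C"
    using that onC c by (intro orbit_cong0[of _ C]) (auto simp: permutes_in_image simp del: comp_apply)
  show "orbit (c \<circ> \<tau>) i = orbit \<tau> i" if "i \<in> D"
    using that onD \<tau> by (intro orbit_cong0[of _ D]) (auto simp: permutes_in_image simp del: comp_apply)
qed

definition cyclic_perms :: "'a \<Rightarrow> 'a set \<Rightarrow> ('a \<Rightarrow> 'a) set" where
  "cyclic_perms a C = {c. c permutes C \<and> orbit c a = C}"

lemma finite_cyclic_perms: "finite C \<Longrightarrow> finite (cyclic_perms a C)"
  by (rule finite_subset[OF _ finite_permutations[of C]]) (auto simp: cyclic_perms_def)

text \<open>Taken over an arbitrary set rather than \<open>{..<n}\<close>, so that inductions can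
  pass to the complement of a cycle. The product runs over the set of orbits, so each cycle
  contributes once whatever its length.\<close>

definition orbit_weight :: "(nat \<Rightarrow> complex) \<Rightarrow> 'a set \<Rightarrow> ('a \<Rightarrow> 'a) \<Rightarrow> complex" where
  "orbit_weight \<theta> S \<sigma> = (\<Prod>c\<in>orbit \<sigma> ` S. \<theta> (card c))"

text \<open>A permutation of \<open>S\<close> amounts to the orbit \<open>C\<close> of
  \<open>a\<close>, a cyclic permutation of \<open>C\<close> and any permutation of
  \<open>S - C\<close>, glued by composition. The orbit \<open>C\<close> contributes the factor
  \<open>\<theta> (card C)\<close>, and all other orbits lie in \<open>S - C\<close>.\<close>

lemma sum_orbit_weight_split:
  fixes S :: "'a set"
  assumes fin: "finite S" and a: "a \<in> S"
  shows "(\<Sum>\<sigma> | \<sigma> permutes S. orbit_weight \<theta> S \<sigma>) =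
    (\<Sum>C | a \<in> C \<and> C \<subseteq> S. of_nat (card (cyclic_perms a C)) * \<theta> (card C) *
       (\<Sum>\<tau> | \<tau> permutes (S - C). orbit_weight \<theta> (S - C) \<tau>))"
proof -
  define I where "I = (SIGMA C : {C. a \<in> C \<and> C \<subseteq> S}. cyclic_perms a C \<times> {\<tau>. \<tau> permutes (S - C)})"
  have "(\<Sum>\<sigma> | \<sigma> permutes S. orbit_weight \<theta> S \<sigma>) =
     (\<Sum>(C, c, \<tau>)\<in>I. \<theta> (card C) * orbit_weight \<theta> (S - C) \<tau>)"
  proof (rule sum.reindex_bij_witness[where i = "\<lambda>(C, c, \<tau>). c \<circ> \<tau>" and
        j = "\<lambda>\<sigma>. (orbit \<sigma> a, perm_restrict \<sigma> (orbit \<sigma> a), perm_restrict \<sigma> (S - orbit \<sigma> a))"])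
    fix \<sigma> assume "\<sigma> \<in> {\<sigma>. \<sigma> permutes S}"
    then have \<sigma>: "\<sigma> permutes S" by simp
    have perm: "permutation \<sigma>" using \<sigma> fin by (auto simp: permutation_permutes)
    define C where "C = orbit \<sigma> a"
    have CS: "C \<subseteq> S" using permutes_orbit_subset[OF \<sigma> a] by (simp add: C_def)
    have aC: "a \<in> C" unfolding C_def by (rule permutation_self_in_orbit[OF perm])
    have im: "\<sigma> ` C \<subseteq> C" by (auto simp: C_def intro: orbit.intros)
    have imC: "\<sigma> ` C = C"
      using im CS fin permutes_inj_on[OF \<sigma>, of C] by (metis endo_inj_surj finite_subset)
    have pr: "perm_restrict \<sigma> T permutes T" if "T \<subseteq> S" "\<sigma> ` T = T" for T
    proof (rule bij_imp_permutes)
      have "bij_betw \<sigma> T T" using that permutes_inj_on[OF \<sigma>, of T] by (simp add: bij_betw_def)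
      then show "bij_betw (perm_restrict \<sigma> T) T T"
        by (rule bij_betw_cong[THEN iffD1, rotated]) (simp add: perm_restrict_simps)
    qed (simp add: perm_restrict_simps)
    have imD: "\<sigma> ` (S - C) = S - C"
      using image_set_diff[OF permutes_inj[OF \<sigma>], of S C] imC permutes_image[OF \<sigma>] by simp
    have p1: "perm_restrict \<sigma> C permutes C" and p2: "perm_restrict \<sigma> (S - C) permutes (S - C)"
      using pr imC imD CS by auto
    have comp: "perm_restrict \<sigma> C \<circ> perm_restrict \<sigma> (S - C) = \<sigma>"
      using perm_restrict_union[OF p1 p2] \<sigma> CS by (simp add: Un_absorb1)
    show "(case (orbit \<sigma> a, perm_restrict \<sigma> (orbit \<sigma> a), perm_restrict \<sigma> (S - orbit \<sigma> a)) of
        (C, c, \<tau>) \<Rightarrow> c \<circ> \<tau>) = \<sigma>"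
      using comp by (simp add: C_def)
    have fC: "finite C" "finite (S - C)" using CS fin finite_subset by auto
    note orb = orbit_comp_disjoint[OF p1 p2, unfolded comp]
    have "orbit (perm_restrict \<sigma> C) a = C" using orb(1)[of a] aC by (simp add: C_def)
    then show "(orbit \<sigma> a, perm_restrict \<sigma> (orbit \<sigma> a), perm_restrict \<sigma> (S - orbit \<sigma> a)) \<in> I"
      using aC CS p1 p2 by (simp add: I_def C_def[symmetric] cyclic_perms_def)
    have oC: "orbit \<sigma> i = C" if "i \<in> C" for i
      using orbit_cyclic_eq3[OF cyclic_on_orbit'[OF perm, of a], of i] that by (simp add: C_def)
    have "orbit \<sigma> ` S = orbit \<sigma> ` C \<union> orbit \<sigma> ` (S - C)" using CS by auto
    also have "orbit \<sigma> ` C = {C}" using oC aC by auto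
    also have "orbit \<sigma> ` (S - C) = orbit (perm_restrict \<sigma> (S - C)) ` (S - C)"
      using orb(2) by (intro image_cong) auto
    finally have eq: "orbit \<sigma> ` S = insert C (orbit (perm_restrict \<sigma> (S - C)) ` (S - C))" by simp
    have "C \<notin> orbit (perm_restrict \<sigma> (S - C)) ` (S - C)"
      using permutes_orbit_subset[OF p2] aC by fastforce
    then show "(case (orbit \<sigma> a, perm_restrict \<sigma> (orbit \<sigma> a), perm_restrict \<sigma> (S - orbit \<sigma> a)) of
        (C, c, \<tau>) \<Rightarrow> \<theta> (card C) * orbit_weight \<theta> (S - C) \<tau>) = orbit_weight \<theta> S \<sigma>"
      using fC eq by (simp add: orbit_weight_def C_def[symmetric])
  next
    fix p assume "p \<in> I"
    then obtain C c \<tau> where p: "p = (C, c, \<tau>)" "a \<in> C" "C \<subseteq> S" "c permutes C" "orbit c a = C"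
       "\<tau> permutes (S - C)"
      by (auto simp: I_def cyclic_perms_def)
    note orb = orbit_comp_disjoint[OF p(4) p(6)]
    have o: "orbit (c \<circ> \<tau>) a = C" using orb(1) p by auto
    have "c permutes S" "\<tau> permutes S"
      using p by (auto intro: permutes_subset)
    then show "(case p of (C, c, \<tau>) \<Rightarrow> c \<circ> \<tau>) \<in> {\<sigma>. \<sigma> permutes S}"
      using p(1) permutes_compose by auto
    have onC: "(c \<circ> \<tau>) j = c j" if "j \<in> C" for j
      using that p(6) by (simp add: permutes_not_in)
    have onD: "(c \<circ> \<tau>) j = \<tau> j" if "j \<in> S - C" for j
      using that permutes_not_in[OF p(4)] permutes_in_image[OF p(6), of j] by auto
    have "perm_restrict (c \<circ> \<tau>) C = c" "perm_restrict (c \<circ> \<tau>) (S - C) = \<tau>"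
      using onC onD p(4,6)
      by (auto simp: perm_restrict_def fun_eq_iff permutes_not_in simp del: comp_apply)
    then show "(orbit (case p of (C, c, \<tau>) \<Rightarrow> c \<circ> \<tau>) a,
          perm_restrict (case p of (C, c, \<tau>) \<Rightarrow> c \<circ> \<tau>) (orbit (case p of (C, c, \<tau>) \<Rightarrow> c \<circ> \<tau>) a),
          perm_restrict (case p of (C, c, \<tau>) \<Rightarrow> c \<circ> \<tau>) (S - orbit (case p of (C, c, \<tau>) \<Rightarrow> c \<circ> \<tau>) a)) = p"
      using p(1) o by simp
  qed
  also have "\<dots> = (\<Sum>C | a \<in> C \<and> C \<subseteq> S. \<Sum>(c, \<tau>)\<in>cyclic_perms a C \<times> {\<tau>. \<tau> permutes (S - C)}.
      \<theta> (card C) * orbit_weight \<theta> (S - C) \<tau>)"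
    unfolding I_def
    by (rule sum.Sigma[symmetric]) (use fin in \<open>auto intro!: finite_cyclic_perms finite_permutations intro: finite_subset\<close>)
  also have "\<dots> = (\<Sum>C | a \<in> C \<and> C \<subseteq> S. of_nat (card (cyclic_perms a C)) * \<theta> (card C) *
       (\<Sum>\<tau> | \<tau> permutes (S - C). orbit_weight \<theta> (S - C) \<tau>))"
    by (intro sum.cong refl)
       (simp add: sum.cartesian_product[symmetric] sum_distrib_left mult.assoc)
  finally show ?thesis .
qed

text \<open>The index \<open>k\<close> counts the elements of \<open>C\<close> other than
  \<open>a\<close>, hence the shift to \<open>Suc k\<close>.\<close>

lemma sum_subsets_containing:
  fixes f :: "nat \<Rightarrow> complex"
  assumes fin: "finite S" and a: "a \<in> S"
  shows "(\<Sum>C | a \<in> C \<and> C \<subseteq> S. f (card C)) = (\<Sum>k<card S. of_nat ((card S - 1) choose k) * f (Suc k))"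
proof -
  have "(\<Sum>C | a \<in> C \<and> C \<subseteq> S. f (card C)) = (\<Sum>D\<in>Pow (S - {a}). f (Suc (card D)))"
  proof (rule sum.reindex_bij_witness[where i = "insert a" and j = "\<lambda>C. C - {a}"])
    fix C assume "C \<in> {C. a \<in> C \<and> C \<subseteq> S}"
    then show "f (Suc (card (C - {a}))) = f (card C)"
      using fin by (metis card.remove finite_subset mem_Collect_eq)
  qed (use a in auto)
  also have "\<dots> = (\<Sum>k<card S. \<Sum>D\<in>{D \<in> Pow (S - {a}). card D = k}. f (Suc (card D)))"
  proof (rule sum.group[symmetric])
    show "card ` Pow (S - {a}) \<subseteq> {..<card S}"
      using fin a by (auto intro!: psubset_card_mono)
  qed (use fin in auto)
  also have "\<dots> = (\<Sum>k<card S. of_nat ((card S - 1) choose k) * f (Suc k))"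
  proof (intro sum.cong refl)
    fix k
    have "card {D \<in> Pow (S - {a}). card D = k} = (card S - 1) choose k"
      using n_subsets[of "S - {a}" k] fin a by simp
    then show "(\<Sum>D\<in>{D \<in> Pow (S - {a}). card D = k}. f (Suc (card D))) =
        of_nat ((card S - 1) choose k) * f (Suc k)"
      by simp
  qed
  finally show ?thesis .
qed

text \<open>No cycles are counted here: with all weights equal to 1, splitting off the cycle of \<open>a\<close> is a recurrence
  that determines the numbers of cyclic permutations.\<close>

lemma card_cyclic_perms:
  assumes "finite C" "a \<in> C"
  shows "card (cyclic_perms a C) = fact (card C - 1)"
  using assms
proof (induction "card C" arbitrary: C rule: less_induct)
  case (less C)
  define g :: "nat \<Rightarrow> complex" where
    "g m = of_nat (fact (m - 1)) * of_nat (fact (card C - m))" for m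
  have pos: "card C > 0" using less.prems by (auto simp: card_gt_0_iff)
  then obtain n where n: "card C = Suc n" by (cases "card C") auto
  have "(of_nat (fact (card C)) :: complex) = (\<Sum>\<sigma> | \<sigma> permutes C. orbit_weight (\<lambda>_. 1) C \<sigma>)"
    using less.prems by (simp add: orbit_weight_def card_permutations)
  also have "\<dots> = (\<Sum>D | a \<in> D \<and> D \<subseteq> C. of_nat (card (cyclic_perms a D)) * of_nat (fact (card C - card D)))"
    unfolding sum_orbit_weight_split[OF less.prems]
    by (intro sum.cong refl)
       (use less.prems in \<open>auto simp: orbit_weight_def card_permutations card_Diff_subset finite_subset\<close>)
  also have "\<dots> = of_nat (card (cyclic_perms a C)) +
      (\<Sum>D\<in>{D. a \<in> D \<and> D \<subseteq> C} - {C}. of_nat (card (cyclic_perms a D)) * of_nat (fact (card C - card D)))"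
    using less.prems by (subst sum.remove[of _ C]) auto
  also have "(\<Sum>D\<in>{D. a \<in> D \<and> D \<subseteq> C} - {C}. of_nat (card (cyclic_perms a D)) * of_nat (fact (card C - card D))) =
      (\<Sum>D\<in>{D. a \<in> D \<and> D \<subseteq> C} - {C}. g (card D))"
  proof (intro sum.cong refl)
    fix D assume D: "D \<in> {D. a \<in> D \<and> D \<subseteq> C} - {C}"
    then have "card D < card C" using less.prems by (intro psubset_card_mono) auto
    then show "of_nat (card (cyclic_perms a D)) * of_nat (fact (card C - card D)) = g (card D)"
      using less.hyps[of D] D less.prems by (auto simp: g_def finite_subset)
  qed
  \<comment> \<open>The term of \<open>C\<close> itself is added with its expected value
    \<open>g (card C)\<close>. The full sum turns out to be \<open>fact (card C)\<close>, so the
    count for \<open>C\<close> has to equal the value that was added.\<close>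
  also have "\<dots> = (\<Sum>D | a \<in> D \<and> D \<subseteq> C. g (card D)) - g (card C)"
    using less.prems by (subst (2) sum.remove[of _ C]) auto
  also have "(\<Sum>D | a \<in> D \<and> D \<subseteq> C. g (card D)) = (\<Sum>k<card C. of_nat ((card C - 1) choose k) * g (Suc k))"
    by (rule sum_subsets_containing[OF less.prems])
  also have "\<dots> = (\<Sum>k<card C. of_nat (fact n))"
  proof (intro sum.cong refl)
    fix k assume "k \<in> {..<card C}"
    then have "k \<le> n" using n by simp
    have "of_nat (fact n :: nat) = (of_nat (fact k * fact (n - k) * (n choose k)) :: complex)"
      using binomial_fact_lemma[OF \<open>k \<le> n\<close>] by simp
    then show "of_nat ((card C - 1) choose k) * g (Suc k) = (of_nat (fact n) :: complex)"
      by (simp add: g_def n)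
  qed
  also have "\<dots> = of_nat (fact (card C))"
    by (simp add: n algebra_simps)
  finally have "(of_nat (card (cyclic_perms a C)) :: complex) = g (card C)"
    by simp
  then have "(of_nat (card (cyclic_perms a C)) :: complex) = of_nat (fact (card C - 1))"
    by (simp add: g_def)
  then show ?case
    by (rule of_nat_eq_iff[THEN iffD1])
qed

text \<open>For \<open>card S = Suc n\<close>, the cycle of a given point has length
  \<open>Suc k\<close> in \<open>(n choose k) * fact k * fact (n - k) = fact n\<close> permutations,
  so its length is uniformly distributed. After division by \<open>fact (card S)\<close> the
  splitting is therefore the recurrence of \<open>cycle_weight\<close>.\<close>

theorem sum_orbit_weight:
  assumes "finite S"
  shows "(\<Sum>\<sigma> | \<sigma> permutes S. orbit_weight \<theta> S \<sigma>) = of_nat (fact (card S)) * cycle_weight \<theta> (card S)"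
  using assms
proof (induction "card S" arbitrary: S rule: less_induct)
  case (less S)
  show ?case
  proof (cases "S = {}")
    case True
    then show ?thesis by (simp add: orbit_weight_def cycle_weight.simps)
  next
    case False
    then obtain a where a: "a \<in> S" by blast
    obtain n where n: "card S = Suc n"
      using a less.prems by (cases "card S") auto
    define g where "g m = of_nat (fact (m - 1)) * \<theta> m * (of_nat (fact (card S - m)) * cycle_weight \<theta> (card S - m))" for m
    have "(\<Sum>\<sigma> | \<sigma> permutes S. orbit_weight \<theta> S \<sigma>) = (\<Sum>C | a \<in> C \<and> C \<subseteq> S. g (card C))"
      unfolding sum_orbit_weight_split[OF less.prems a]
    proof (intro sum.cong refl)
      fix C assume C: "C \<in> {C. a \<in> C \<and> C \<subseteq> S}"
      have "finite C" using C less.prems finite_subset by auto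
      have lt: "card (S - C) < card S"
        using C a less.prems by (intro psubset_card_mono) auto
      have "card (S - C) = card S - card C"
        using C \<open>finite C\<close> by (simp add: card_Diff_subset)
      then show "of_nat (card (cyclic_perms a C)) * \<theta> (card C) *
          (\<Sum>\<tau> | \<tau> permutes (S - C). orbit_weight \<theta> (S - C) \<tau>) = g (card C)"
        using less.hyps[OF lt] less.prems card_cyclic_perms[OF \<open>finite C\<close>, of a] C
        by (simp add: g_def)
    qed
    also have "\<dots> = (\<Sum>k<card S. of_nat ((card S - 1) choose k) * g (Suc k))"
      by (rule sum_subsets_containing[OF less.prems a])
    also have "\<dots> = (\<Sum>k<card S. of_nat (fact n) * (\<theta> (Suc k) * cycle_weight \<theta> (n - k)))"
    proof (intro sum.cong refl)
      fix k assume "k \<in> {..<card S}"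
      then have "k \<le> n" using n by simp
      have "of_nat (fact n :: nat) = (of_nat (fact k * fact (n - k) * (n choose k)) :: complex)"
        using binomial_fact_lemma[OF \<open>k \<le> n\<close>] by simp
      then show "of_nat ((card S - 1) choose k) * g (Suc k) = of_nat (fact n) * (\<theta> (Suc k) * cycle_weight \<theta> (n - k))"
        by (simp add: g_def n)
    qed
    also have "\<dots> = of_nat (fact n) * (\<Sum>k<Suc n. \<theta> (Suc k) * cycle_weight \<theta> (n - k))"
      by (simp only: n sum_distrib_left)
    also have "(\<Sum>k<Suc n. \<theta> (Suc k) * cycle_weight \<theta> (n - k)) = (\<Sum>k<Suc n. \<theta> (Suc n - k) * cycle_weight \<theta> k)"
      by (subst sum.nat_diff_reindex[symmetric]) (auto intro!: sum.cong simp: Suc_diff_le)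
    also have "\<dots> = of_nat (Suc n) * cycle_weight \<theta> (Suc n)"
      by (rule cycle_weight_rec[symmetric])
    finally show ?thesis
      by (simp add: n algebra_simps)
  qed
qed

subsection \<open>Comparison with independent Poisson variables\<close>

lemma cycle_weight_unique:
  assumes "f 0 = 1" and rec: "\<And>n. of_nat n * f n = (\<Sum>k<n. \<theta> (n - k) * f k)"
  shows "f n = cycle_weight \<theta> n"
proof (induction n rule: less_induct)
  case (less n)
  show ?case
  proof (cases "n = 0")
    case False
    have "of_nat n * f n = of_nat n * cycle_weight \<theta> n"
      unfolding rec cycle_weight_rec by (intro sum.cong) (simp_all add: less)
    then show ?thesis using False by simp
  qed (use assms in \<open>simp add: cycle_weight.simps\<close>)
qed

text \<open>Lets the weights beyond \<open>n\<close> be replaced by 1, as in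
  \<open>cycle_weight_approx\<close>.\<close>

lemma cycle_weight_cong:
  assumes "\<And>m. 1 \<le> m \<Longrightarrow> m \<le> n \<Longrightarrow> \<theta> m = \<theta>' m"
  shows "cycle_weight \<theta> n = cycle_weight \<theta>' n"
  using assms
proof (induction n rule: less_induct)
  case (less n)
  show ?case
  proof (cases "n = 0")
    case False
    have "of_nat n * cycle_weight \<theta> n = of_nat n * cycle_weight \<theta>' n"
      unfolding cycle_weight_rec using less by (intro sum.cong arg_cong2[of _ _ _ _ "(*)"]) auto
    then show ?thesis using False by simp
  qed (simp add: cycle_weight.simps)
qed

lemma norm_cycle_weight_le:
  assumes "\<And>m. norm (\<theta> m) \<le> 1"
  shows "norm (cycle_weight \<theta> n) \<le> 1"
proof (induction n rule: less_induct)
  case (less n)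
  show ?case
  proof (cases "n = 0")
    case False
    have "real n * norm (cycle_weight \<theta> n) = norm (of_nat n * cycle_weight \<theta> n)"
      by (simp add: norm_mult)
    also have "\<dots> \<le> (\<Sum>k<n. norm (\<theta> (n - k) * cycle_weight \<theta> k))"
      unfolding cycle_weight_rec by (rule norm_sum)
    also have "\<dots> \<le> (\<Sum>k<n. 1)"
      using less assms by (intro sum_mono) (auto simp: norm_mult intro: mult_le_one)
    finally show ?thesis using False by simp
  qed (simp add: cycle_weight.simps)
qed

text \<open>The generating function of the weights is f(w) / (1 - w), where f(w) is the exponential
  of Sum (\<theta> m - 1) w^m / m. This sum is finite, so f is entire. Division by 1 - w replaces
  Taylor coefficients by their partial sums; hence the weights converge to f(1).\<close>

lemma cycle_weight_tendsto:
  assumes "\<And>m. m > n \<Longrightarrow> \<theta> m = 1"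
  shows "cycle_weight \<theta> \<longlonglongrightarrow> exp (\<Sum>m = 1..n. (\<theta> m - 1) / of_nat m)"
proof -
  define f where "f w = exp (\<Sum>m = 1..n. (\<theta> m - 1) / of_nat m * w ^ m)" for w :: complex
  define f' where "f' w = f w * (\<Sum>m = 1..n. (\<theta> m - 1) * w ^ (m - 1))" for w :: complex
  define F where "F = fps_expansion f 0"
  define E where "E = (\<Sum>m = 1..n. fps_const (\<theta> m - 1) * fps_X ^ (m - 1))"
  \<comment> \<open>\<open>U\<close> is 1 / (1 - w). The recurrence is the equation X K' = K T,
    which \<open>K = F * U\<close> satisfies by the product rule. Coefficient 0 of \<open>T\<close>
    is set to 0 because cycle lengths start at 1.\<close>
  define U where "U = Abs_fps (\<lambda>_. 1 :: complex)"
  define T where "T = Abs_fps (\<lambda>m. if m = 0 then 0 else \<theta> m)"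
  have holo: "f holomorphic_on A" for A
    unfolding f_def by (intro holomorphic_intros)
  have F: "f has_fps_expansion F"
    unfolding F_def by (rule has_fps_expansion_fps_expansion[OF open_UNIV]) (auto intro: holo)
  have der: "(f has_field_derivative f' w) (at w)" for w
    unfolding f_def f'_def
    by (rule derivative_eq_intros refl)+ (auto intro!: sum.cong simp: field_simps)
  have "f' has_fps_expansion fps_deriv F"
    using has_fps_expansion_deriv[OF F] DERIV_imp_deriv[OF der] by (metis ext)
  moreover have "f' has_fps_expansion F * E"
    unfolding f'_def E_def by (intro fps_expansion_intros F)
  ultimately have F': "fps_deriv F = F * E"
    by (rule fps_expansion_unique_complex)
  have U': "fps_deriv U = U * U"
    by (rule fps_ext) (simp add: U_def fps_mult_nth)
  have "fps_X * E + fps_X * U = T"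
  proof (rule fps_ext)
    fix k
    have "fps_X * E = (\<Sum>m = 1..n. fps_const (\<theta> m - 1) * fps_X ^ m)"
      unfolding E_def sum_distrib_left
    proof (intro sum.cong refl)
      fix m assume "m \<in> {1..n}"
      then have "fps_X ^ m = (fps_X * fps_X ^ (m - 1) :: complex fps)"
        by (cases m) auto
      then show "fps_X * (fps_const (\<theta> m - 1) * fps_X ^ (m - 1)) = fps_const (\<theta> m - 1) * fps_X ^ m"
        by (simp add: algebra_simps)
    qed
    then have "(fps_X * E) $ k = (\<Sum>m = 1..n. (\<theta> m - 1) * (if k = m then 1 else 0))"
      by (simp add: fps_sum_nth)
    also have "\<dots> = (\<Sum>m = 1..n. if k = m then \<theta> m - 1 else 0)"
      by (intro sum.cong) auto
    finally have E: "(fps_X * E) $ k = (\<Sum>m = 1..n. if k = m then \<theta> m - 1 else 0)" .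
    show "(fps_X * E + fps_X * U) $ k = T $ k"
      unfolding fps_add_nth E using assms[of k] by (auto simp: T_def U_def fps_X_mult_nth not_le)
  qed
  define K where "K = F * U"
  have "fps_X * fps_deriv K = K * (fps_X * E + fps_X * U)"
    by (simp add: K_def F' U' algebra_simps)
  then have XK: "fps_X * fps_deriv K = K * T"
    by (simp add: \<open>fps_X * E + fps_X * U = T\<close>)
  have "K $ k = cycle_weight \<theta> k" for k
  proof (rule cycle_weight_unique)
    have "F $ 0 = f 0"
      using has_fps_expansion_imp_0_eq_fps_nth_0[OF F] by simp
    also have "\<dots> = 1" by (simp add: f_def)
    finally show "K $ 0 = 1" by (simp add: K_def U_def)
    fix j
    have "of_nat j * K $ j = (fps_X * fps_deriv K) $ j"
      by (cases j) auto
    also have "\<dots> = (\<Sum>k\<le>j. K $ k * T $ (j - k))"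
      unfolding XK by (simp add: fps_mult_nth atLeast0AtMost)
    also have "\<dots> = (\<Sum>k<j. \<theta> (j - k) * K $ k)"
      by (simp add: lessThan_Suc_atMost[symmetric] T_def mult.commute)
    finally show "of_nat j * K $ j = (\<Sum>k<j. \<theta> (j - k) * K $ k)" .
  qed
  then have "cycle_weight \<theta> = (\<lambda>k. \<Sum>i\<le>k. F $ i)"
    by (auto simp: fun_eq_iff K_def U_def fps_mult_nth atLeast0AtMost)
  moreover have "(\<lambda>k. F $ k * 1 ^ k) sums f 1"
    by (rule has_fps_expansion_imp_sums_complex[OF F, of \<infinity>]) (auto intro: holo)
  ultimately show ?thesis
    by (simp add: sums_def_le f_def)
qed

text \<open>With \<open>h\<close> for the weights, their means \<open>r j = (\<Sum>k<j. h k) / j\<close> change by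
  \<open>(h j - r j) / (j + 1)\<close>, and \<open>h j - r j\<close> is small; once
  \<open>\<theta>\<close> is replaced by \<open>1\<close> beyond \<open>n\<close>, these changes are summable. This is the analytic form
  of the comparison of the cycle counts with independent Poisson variables in the Feller coupling.\<close>

theorem cycle_weight_approx:
  assumes le1: "\<And>m. norm (\<theta> m) \<le> 1" and n: "n > 0"
  shows "norm (cycle_weight \<theta> n - exp (\<Sum>m = 1..n. (\<theta> m - 1) / of_nat m))
    \<le> 2 * (\<Sum>m = 1..n. norm (\<theta> m - 1)) / n"
proof -
  define \<eta> where "\<eta> m = (if m \<le> n then \<theta> m else 1)" for m
  define e where "e = (\<Sum>m = 1..n. norm (\<theta> m - 1))"
  define h where "h = cycle_weight \<eta>"
  define r where "r j = (\<Sum>k<j. h k) / of_nat j" for j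
  define L where "L = exp (\<Sum>m = 1..n. (\<theta> m - 1) / of_nat m)"
  have h1: "norm (h k) \<le> 1" for k
    unfolding h_def using le1 by (intro norm_cycle_weight_le) (simp add: \<eta>_def)
  have hr: "norm (h j - r j) \<le> e / j" if "j > 0" for j
  proof -
    \<comment> \<open>Both terms are sums over the same \<open>h k\<close>: one by the recurrence
      for \<open>h j\<close>, the other by the definition of \<open>r j\<close>.\<close>
    have "of_nat j * (h j - r j) = (\<Sum>k<j. (\<eta> (j - k) - 1) * h k)"
      using that by (simp add: r_def right_diff_distrib h_def cycle_weight_rec sum_subtractf left_diff_distrib)
    then have "real j * norm (h j - r j) = norm (\<Sum>k<j. (\<eta> (j - k) - 1) * h k)"
      by (metis norm_mult norm_of_nat)
    also have "\<dots> \<le> (\<Sum>k<j. norm (\<eta> (j - k) - 1))"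
      using h1 by (intro sum_norm_le) (auto simp: norm_mult intro: mult_left_le)
    also have "\<dots> = (\<Sum>m = 1..j. norm (\<eta> m - 1))"
      by (rule sum.reindex_bij_witness[where i = "\<lambda>m. j - m" and j = "\<lambda>k. j - k"]) auto
    also have "\<dots> = (\<Sum>m \<in> {1..j} \<inter> {..n}. norm (\<eta> m - 1))"
      by (rule sum.mono_neutral_right) (auto simp: \<eta>_def)
    also have "\<dots> \<le> (\<Sum>m = 1..n. norm (\<eta> m - 1))"
      by (rule sum_mono2) auto
    also have "\<dots> = e" by (simp add: e_def \<eta>_def)
    finally show ?thesis using that by (simp add: field_simps)
  qed
  have rr: "r (Suc j) - r j = (h j - r j) / of_nat (Suc j)" if "j > 0" for j
    using that of_nat_neq_0[of j, where 'a = complex] by (simp add: r_def field_simps del: of_nat_Suc) (simp add: algebra_simps)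
  \<comment> \<open>Each step changes the mean by at most \<open>e / (j * (j + 1))\<close>, which
    telescopes. Beyond \<open>n\<close> the total change is thus at most \<open>e / n\<close>,
    however far one goes.\<close>
  have "norm (r (n + k) - r n) \<le> e * (1 / n - 1 / (n + k))" for k
  proof (induction k)
    case (Suc k)
    have "norm (r (n + Suc k) - r n) \<le> norm (r (Suc (n + k)) - r (n + k)) + norm (r (n + k) - r n)"
      using norm_triangle_ineq[of "r (Suc (n + k)) - r (n + k)" "r (n + k) - r n"] by simp
    also have "norm (r (Suc (n + k)) - r (n + k)) = norm (h (n + k) - r (n + k)) / Suc (n + k)"
      using n by (subst rr) (auto simp: norm_divide simp del: of_nat_Suc)
    also have "\<dots> \<le> e / (n + k) / Suc (n + k)"
      using hr[of "n + k"] n by (intro divide_right_mono) auto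
    also have "\<dots> = e * (1 / (n + k) - 1 / (n + Suc k))"
      using n by (simp add: field_simps)
    also note Suc.IH
    finally show ?case by (simp add: algebra_simps)
  qed simp
  moreover have "e \<ge> 0" by (simp add: e_def sum_nonneg)
  then have "e * (1 / n - 1 / (n + k)) \<le> e * (1 / n)" for k
    by (intro mult_left_mono) auto
  ultimately have rk: "norm (r (n + k) - r n) \<le> e / n" for k
    using order_trans[of "norm (r (n + k) - r n)"] by (metis mult.right_neutral times_divide_eq_right)
  have "h \<longlonglongrightarrow> exp (\<Sum>m = 1..n. (\<eta> m - 1) / of_nat m)"
    unfolding h_def by (rule cycle_weight_tendsto) (simp add: \<eta>_def)
  then have hL: "h \<longlonglongrightarrow> L" by (simp add: \<eta>_def L_def)
  have "(\<lambda>j. e / real j) \<longlonglongrightarrow> 0"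
    by (rule tendsto_divide_0[OF tendsto_const]) (simp add: filterlim_at_top_imp_at_infinity filterlim_real_sequentially)
  then have "(\<lambda>j. h j - r j) \<longlonglongrightarrow> 0"
    by (rule Lim_null_comparison[rotated]) (use hr in \<open>auto intro!: eventually_sequentiallyI[of 1]\<close>)
  from tendsto_diff[OF hL this] have "r \<longlonglongrightarrow> L" by simp
  then have "(\<lambda>k. r (k + n)) \<longlonglongrightarrow> L" by (rule LIMSEQ_ignore_initial_segment)
  then have "(\<lambda>k. norm (r (k + n) - r n)) \<longlonglongrightarrow> norm (L - r n)"
    by (intro tendsto_intros)
  then have "norm (L - r n) \<le> e / n"
    using rk by (intro LIMSEQ_le_const2) (auto simp: add.commute)
  \<comment> \<open>This accounts for the factor 2 in the statement: \<open>e / n\<close> from the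
    mean to the limit and \<open>e / n\<close> from \<open>h n\<close> to the mean.\<close>
  moreover have "norm (h n - r n) \<le> e / n" using hr n by simp
  moreover have "norm (h n - L) \<le> norm (h n - r n) + norm (L - r n)" by norm
  ultimately have "norm (h n - L) \<le> e / n + e / n" by linarith
  moreover have "h n = cycle_weight \<theta> n"
    unfolding h_def by (rule cycle_weight_cong) (simp add: \<eta>_def)
  ultimately show ?thesis by (simp add: L_def e_def)
qed

subsection \<open>Characteristic functions in the plane\<close>

lemma (in prob_space) integrable_bounded_comp:
  fixes h :: "'c::topological_space \<Rightarrow> 'd::{banach, second_countable_topology}"
  assumes "X \<in> borel_measurable M" "h \<in> borel_measurable borel" "bounded (range h)"
  shows "integrable M (\<lambda>\<omega>. h (X \<omega>))"
proof -
  obtain B where B: "\<And>v. norm (h v) \<le> B"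
    using assms(3) by (auto simp: bounded_iff)
  show ?thesis
    using measurable_compose[OF assms(1,2)] by (intro integrable_const_bound[of _ B]) (auto simp: B)
qed

text \<open>The error is dominated by a function \<open>w\<close> instead of a constant; its
  expectations only have to converge to a small limit. This serves twice: with a tail cutoff, where
  the approximation is bad far from the origin, and with a constant for uniform
  approximation.\<close>

lemma integral_tendsto_by_approx:
  fixes X :: "nat \<Rightarrow> 'a \<Rightarrow> 'c::topological_space" and h :: "'c \<Rightarrow> real"
  assumes M: "\<And>n. prob_space (M n)" "\<And>n. X n \<in> borel_measurable (M n)"
    and N: "prob_space N" "Y \<in> borel_measurable N"
    and h: "h \<in> borel_measurable borel" "bounded (range h)"
    and approx: "\<And>e. e > 0 \<Longrightarrow> \<exists>g w. g \<in> borel_measurable borel \<and> bounded (range g) \<and>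
      w \<in> borel_measurable borel \<and> bounded (range w) \<and> (\<forall>v. \<bar>h v - g v\<bar> \<le> w v) \<and>
      ((\<lambda>n. \<integral>\<omega>. g (X n \<omega>) \<partial>M n) \<longlonglongrightarrow> (\<integral>\<omega>. g (Y \<omega>) \<partial>N)) \<and>
      ((\<lambda>n. \<integral>\<omega>. w (X n \<omega>) \<partial>M n) \<longlonglongrightarrow> (\<integral>\<omega>. w (Y \<omega>) \<partial>N)) \<and> (\<integral>\<omega>. w (Y \<omega>) \<partial>N) < e"
  shows "(\<lambda>n. \<integral>\<omega>. h (X n \<omega>) \<partial>M n) \<longlonglongrightarrow> (\<integral>\<omega>. h (Y \<omega>) \<partial>N)"
proof (rule LIMSEQ_I)
  fix r :: real assume "r > 0"
  then obtain g w where gw: "g \<in> borel_measurable borel" "bounded (range g)"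
      "w \<in> borel_measurable borel" "bounded (range w)" "\<And>v. \<bar>h v - g v\<bar> \<le> w v"
      "(\<lambda>n. \<integral>\<omega>. g (X n \<omega>) \<partial>M n) \<longlonglongrightarrow> (\<integral>\<omega>. g (Y \<omega>) \<partial>N)"
      "(\<lambda>n. \<integral>\<omega>. w (X n \<omega>) \<partial>M n) \<longlonglongrightarrow> (\<integral>\<omega>. w (Y \<omega>) \<partial>N)" "(\<integral>\<omega>. w (Y \<omega>) \<partial>N) < r / 4"
    using approx[of "r / 4"] by auto
  have diff: "\<bar>(\<integral>\<omega>. h (Z \<omega>) \<partial>K) - (\<integral>\<omega>. g (Z \<omega>) \<partial>K)\<bar> \<le> (\<integral>\<omega>. w (Z \<omega>) \<partial>K)"
    if K: "prob_space K" "Z \<in> borel_measurable K" for K :: "'k measure" and Z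
  proof -
    interpret prob_space K by fact
    note int = integrable_bounded_comp[OF K(2)]
    have "\<bar>(\<integral>\<omega>. h (Z \<omega>) \<partial>K) - (\<integral>\<omega>. g (Z \<omega>) \<partial>K)\<bar> = \<bar>\<integral>\<omega>. h (Z \<omega>) - g (Z \<omega>) \<partial>K\<bar>"
      using int[OF h] int[OF gw(1,2)] by simp
    also have "\<dots> \<le> (\<integral>\<omega>. \<bar>h (Z \<omega>) - g (Z \<omega>)\<bar> \<partial>K)"
      by (rule integral_abs_bound)
    also have "\<dots> \<le> (\<integral>\<omega>. w (Z \<omega>) \<partial>K)"
      using int[OF h] int[OF gw(1,2)] int[OF gw(3,4)] gw(5) by (intro integral_mono) auto
    finally show ?thesis .
  qed
  have "eventually (\<lambda>n. \<bar>(\<integral>\<omega>. g (X n \<omega>) \<partial>M n) - (\<integral>\<omega>. g (Y \<omega>) \<partial>N)\<bar> < r / 4) sequentially"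
    using tendstoD[OF gw(6), of "r / 4"] \<open>r > 0\<close> by (simp add: dist_real_def)
  moreover have "eventually (\<lambda>n. (\<integral>\<omega>. w (X n \<omega>) \<partial>M n) < r / 4) sequentially"
    by (rule order_tendstoD(2)[OF gw(7,8)])
  ultimately have "eventually (\<lambda>n. norm ((\<integral>\<omega>. h (X n \<omega>) \<partial>M n) - (\<integral>\<omega>. h (Y \<omega>) \<partial>N)) < r) sequentially"
  proof eventually_elim
    case (elim n)
    then show ?case
      using diff[OF M, of n] diff[OF N] gw(8) by (simp add: abs_if split: if_splits)
  qed
  then show "\<exists>no. \<forall>n\<ge>no. norm ((\<integral>\<omega>. h (X n \<omega>) \<partial>M n) - (\<integral>\<omega>. h (Y \<omega>) \<partial>N)) < r"
    by (simp add: eventually_sequentially)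
qed

text \<open>Levy's continuity theorem on the line. Applied to the two marginals, it supplies the
  tightness in the plane.\<close>

lemma char_tendsto_imp_integral_tendsto:
  fixes U :: "nat \<Rightarrow> 'a \<Rightarrow> real" and V :: "'b \<Rightarrow> real" and g :: "real \<Rightarrow> real"
  assumes M: "\<And>n. prob_space (M n)" "\<And>n. U n \<in> borel_measurable (M n)"
    and N: "prob_space N" "V \<in> borel_measurable N"
    and char: "\<And>t. (\<lambda>n. \<integral>\<omega>. cis (t * U n \<omega>) \<partial>M n) \<longlonglongrightarrow> (\<integral>\<omega>. cis (t * V \<omega>) \<partial>N)"
    and g: "continuous_on UNIV g" "bounded (range g)"
  shows "(\<lambda>n. \<integral>\<omega>. g (U n \<omega>) \<partial>M n) \<longlonglongrightarrow> (\<integral>\<omega>. g (V \<omega>) \<partial>N)"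
proof -
  have rd: "real_distribution (distr (M n) borel (U n))" for n
    using prob_space.real_distribution_distr[OF M] .
  have rdN: "real_distribution (distr N borel V)"
    using prob_space.real_distribution_distr[OF N] .
  have "weak_conv_m (\<lambda>n. distr (M n) borel (U n)) (distr N borel V)"
  proof (rule levy_continuity[OF rd rdN])
    fix t
    show "(\<lambda>n. Characteristic_Functions.char (distr (M n) borel (U n)) t) \<longlonglongrightarrow> Characteristic_Functions.char (distr N borel V) t"
      using char[of t] M(2) N(2) by (simp add: char_def integral_distr cis_conv_exp)
  qed
  moreover obtain B where "\<And>x. norm (g x) \<le> B" using g(2) by (auto simp: bounded_iff)
  moreover have "isCont g x" for x using g(1) by (simp add: continuous_on_eq_continuous_at)
  ultimately have "(\<lambda>n. integral\<^sup>L (distr (M n) borel (U n)) g) \<longlonglongrightarrow> integral\<^sup>L (distr N borel V) g"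
    by (intro weak_conv_imp_integral_bdd_continuous_conv[OF rd rdN])
  moreover have "g \<in> borel_measurable borel" using g(1) by (rule borel_measurable_continuous_onI)
  ultimately show ?thesis using M(2) N(2) by (simp add: integral_distr)
qed

section \<open>Trigonometric polynomials in two real variables\<close>

text \<open>Arbitrary real frequencies are allowed. Generation by single exponentials and addition
  makes linearity arguments plain inductions; closure under products follows because frequencies
  add.\<close>

inductive trig_fun :: "(real \<times> real \<Rightarrow> complex) \<Rightarrow> bool" where
  trig_fun_cis: "trig_fun (\<lambda>v. c * cis (s * fst v + t * snd v))"
| trig_fun_add: "trig_fun f \<Longrightarrow> trig_fun g \<Longrightarrow> trig_fun (\<lambda>v. f v + g v)"

lemma trig_fun_const: "trig_fun (\<lambda>v. c)"
  using trig_fun_cis[of c 0 0] by simp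

lemma trig_fun_mult:
  assumes "trig_fun f" "trig_fun g"
  shows "trig_fun (\<lambda>v. f v * g v)"
  using assms(1)
proof (induction rule: trig_fun.induct)
  case (trig_fun_cis c s t)
  show ?case
    using assms(2)
  proof (induction rule: trig_fun.induct)
    case (trig_fun_cis d s' t')
    have "(\<lambda>v. c * cis (s * fst v + t * snd v) * (d * cis (s' * fst v + t' * snd v))) =
        (\<lambda>v. c * d * cis ((s + s') * fst v + (t + t') * snd v))"
      by (simp add: fun_eq_iff cis_mult[symmetric] ring_distribs add.assoc add.left_commute)
    then show ?case
      by (simp only: trig_fun.trig_fun_cis)
  next
    case (trig_fun_add f g)
    then show ?case using trig_fun.trig_fun_add by (simp add: distrib_left)
  qed
next
  case (trig_fun_add f g)
  then show ?case using trig_fun.trig_fun_add by (simp add: distrib_right)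
qed

lemma trig_fun_continuous: "trig_fun f \<Longrightarrow> continuous_on A f"
  by (induction rule: trig_fun.induct) (auto intro!: continuous_intros)

lemma trig_fun_bounded:
  assumes "trig_fun f"
  shows "bounded (range f)"
  using assms
proof (induction rule: trig_fun.induct)
  case (trig_fun_cis c s t)
  show ?case by (rule boundedI[of _ "norm c"]) (auto simp: norm_mult)
next
  case (trig_fun_add f g)
  then show ?case using bounded_plus_comp by blast
qed

lemma trig_fun_integral_tendsto:
  assumes M: "\<And>n. prob_space (M n)" "\<And>n. X n \<in> borel_measurable (M n)"
    and N: "prob_space N" "Y \<in> borel_measurable N"
    and char: "\<And>s t. (\<lambda>n. \<integral>\<omega>. cis (s * fst (X n \<omega>) + t * snd (X n \<omega>)) \<partial>M n)
      \<longlonglongrightarrow> (\<integral>\<omega>. cis (s * fst (Y \<omega>) + t * snd (Y \<omega>)) \<partial>N)"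
    and "trig_fun f"
  shows "(\<lambda>n. \<integral>\<omega>. f (X n \<omega>) \<partial>M n) \<longlonglongrightarrow> (\<integral>\<omega>. f (Y \<omega>) \<partial>N)"
  using assms(6)
proof (induction rule: trig_fun.induct)
  case (trig_fun_cis c s t)
  show ?case
    using tendsto_mult_left[OF char, of c s t] by simp
next
  case (trig_fun_add f g)
  have int: "integrable K (\<lambda>\<omega>. f (Z \<omega>))" "integrable K (\<lambda>\<omega>. g (Z \<omega>))"
    if "prob_space K" "Z \<in> borel_measurable K" for K :: "'k measure" and Z
    using trig_fun_add(1,2)
    by (auto intro!: prob_space.integrable_bounded_comp[OF that] trig_fun_bounded
        borel_measurable_continuous_onI trig_fun_continuous)
  show ?case
    using tendsto_add[OF trig_fun_add.IH] int[OF M] int[OF N] by simp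
qed

text \<open>The real Stone--Weierstrass theorem is applied to those continuous real functions on the
  torus whose pullback along \<open>L\<close> is a trigonometric polynomial. They form an algebra,
  and the four real coordinates of a point of the torus are among them, so points are
  separated.\<close>

lemma trig_fun_dense:
  fixes F :: "complex \<times> complex \<Rightarrow> real"
  assumes F: "continuous_on (sphere 0 1 \<times> sphere 0 1) F" and "e > 0"
  shows "\<exists>g. trig_fun (\<lambda>v. of_real (g v)) \<and> (\<forall>v. \<bar>F (cis (a * fst v), cis (a * snd v)) - g v\<bar> < e)"
proof -
  define S where "S = sphere (0::complex) 1 \<times> sphere (0::complex) 1"
  define L where "L v = (cis (a * fst v), cis (a * snd v))" for v :: "real \<times> real"
  define P where "P G \<longleftrightarrow> continuous_on S G \<and> trig_fun (\<lambda>v. of_real (G (L v)))" for G :: "complex \<times> complex \<Rightarrow> real"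
  have LS: "L v \<in> S" for v by (simp add: L_def S_def)
  have Re: "of_real (Re (cis x)) = 1/2 * cis x + 1/2 * cis (- x)"
   and Im: "of_real (Im (cis x)) = - \<i>/2 * cis x + \<i>/2 * cis (- x)" for x
    by (auto simp: complex_eq_iff)
  have sep: "P (\<lambda>w. Re (fst w))" "P (\<lambda>w. Im (fst w))" "P (\<lambda>w. Re (snd w))" "P (\<lambda>w. Im (snd w))"
    unfolding P_def L_def fst_conv snd_conv Re Im
    using trig_fun_add[OF trig_fun_cis[of "1/2" a 0] trig_fun_cis[of "1/2" "- a" 0]]
      trig_fun_add[OF trig_fun_cis[of "- \<i>/2" a 0] trig_fun_cis[of "\<i>/2" "- a" 0]]
      trig_fun_add[OF trig_fun_cis[of "1/2" 0 a] trig_fun_cis[of "1/2" 0 "- a"]]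
      trig_fun_add[OF trig_fun_cis[of "- \<i>/2" 0 a] trig_fun_cis[of "\<i>/2" 0 "- a"]]
    by (simp_all add: continuous_intros)
  have "\<exists>g. P g \<and> (\<forall>x\<in>S. \<bar>F x - g x\<bar> < e)"
  proof (rule Stone_Weierstrass_HOL)
    show "compact S" by (simp add: S_def compact_Times)
    show "P (\<lambda>x. c)" for c by (simp add: P_def trig_fun_const)
    show "continuous_on S f" if "P f" for f using that by (simp add: P_def)
    show "P (\<lambda>x. f x + g x)" if "P f \<and> P g" for f g
      using that by (auto simp: P_def intro!: continuous_intros trig_fun_add)
    show "P (\<lambda>x. f x * g x)" if "P f \<and> P g" for f g
      using that by (auto simp: P_def intro!: continuous_intros trig_fun_mult)
    show "\<exists>f. P f \<and> f x \<noteq> f y" if "x \<in> S \<and> y \<in> S \<and> x \<noteq> y" for x y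
    proof (rule ccontr)
      assume "\<not> ?thesis"
      then have "\<And>f. P f \<Longrightarrow> f x = f y" by blast
      from this[OF sep(1)] this[OF sep(2)] this[OF sep(3)] this[OF sep(4)] have "x = y"
        by (simp add: prod_eq_iff complex_eq_iff)
      with that show False by simp
    qed
  qed (use assms in \<open>auto simp: S_def\<close>)
  then obtain g where g: "P g" "\<forall>x\<in>S. \<bar>F x - g x\<bar> < e" by blast
  then show ?thesis
    using LS by (intro exI[of _ "\<lambda>v. g (L v)"]) (auto simp: P_def L_def)
qed

section \<open>Truncation and Levy's theorem in the plane\<close>

text \<open>On the half period around 0 this is the complement of the torus factor
  \<open>max 0 (cos (a * x))\<close>. From \<open>\<bar>a * x\<bar> = pi / 2\<close> on it is 1; not
  being periodic, it also equals 1 at points that wrap around the circle.\<close>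

definition tail_cutoff :: "real \<Rightarrow> real \<Rightarrow> real" where
  "tail_cutoff a x = 1 - cos (min \<bar>a * x\<bar> (pi / 2))"

lemma tail_cutoff_bounds: "0 \<le> tail_cutoff a x" "tail_cutoff a x \<le> 1"
proof -
  have "- (pi / 2) \<le> min \<bar>a * x\<bar> (pi / 2)"
    using pi_gt_zero by linarith
  then have "0 \<le> cos (min \<bar>a * x\<bar> (pi / 2))"
    by (rule cos_ge_zero) simp
  then show "0 \<le> tail_cutoff a x" "tail_cutoff a x \<le> 1"
    by (auto simp: tail_cutoff_def)
qed

lemma tail_cutoff_bounded: "bounded (range (tail_cutoff a))"
  by (rule boundedI[of _ 1]) (auto simp: abs_of_nonneg tail_cutoff_bounds)

lemma tail_cutoff_continuous: "continuous_on A (tail_cutoff a)"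
  unfolding tail_cutoff_def by (intro continuous_intros)

lemma integral_tail_cutoff_small:
  assumes N: "prob_space N" "V \<in> borel_measurable N"
  shows "(\<lambda>k. \<integral>\<omega>. tail_cutoff (1 / Suc k) (V \<omega>) \<partial>N) \<longlonglongrightarrow> 0"
proof -
  interpret prob_space N by fact
  have "(\<lambda>k. \<integral>\<omega>. tail_cutoff (1 / Suc k) (V \<omega>) \<partial>N) \<longlonglongrightarrow> (\<integral>\<omega>. 0 \<partial>N)"
  proof (rule integral_dominated_convergence[where w = "\<lambda>_. 1"])
    show "(\<lambda>\<omega>. tail_cutoff (1 / Suc k) (V \<omega>)) \<in> borel_measurable N" for k
      using measurable_compose[OF N(2) borel_measurable_continuous_onI[OF tail_cutoff_continuous]] .
    show "AE \<omega> in N. (\<lambda>k. tail_cutoff (1 / Suc k) (V \<omega>)) \<longlonglongrightarrow> 0"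
    proof (rule AE_I2)
      fix \<omega>
      have "(\<lambda>k. 1 / real (Suc k)) \<longlonglongrightarrow> 0" by (rule LIMSEQ_Suc[OF lim_1_over_n])
      then have "(\<lambda>k. 1 - cos (min \<bar>1 / real (Suc k) * V \<omega>\<bar> (pi / 2))) \<longlonglongrightarrow> 1 - cos (min \<bar>0 * V \<omega>\<bar> (pi / 2))"
        by (intro tendsto_intros)
      then show "(\<lambda>k. tail_cutoff (1 / Suc k) (V \<omega>)) \<longlonglongrightarrow> 0" by (simp add: tail_cutoff_def)
    qed
  qed (auto simp: abs_of_nonneg tail_cutoff_bounds simp del: of_nat_Suc)
  then show ?thesis by simp
qed

text \<open>A bounded continuous \<open>f\<close> is replaced by a function of \<open>(cis (a x), cis (a y))\<close> that is continuous
  on the torus, since \<open>arcsin \<circ> Im\<close> recovers the angle on the half circle where \<open>Re\<close> is positive.\<close>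

lemma torus_approx:
  fixes f :: "real \<times> real \<Rightarrow> real"
  assumes B: "\<And>v. \<bar>f v\<bar> \<le> B" and "a > 0"
    and D: "D = (\<lambda>w. f (arcsin (Im (fst w)) / a, arcsin (Im (snd w)) / a) * max 0 (Re (fst w)) * max 0 (Re (snd w)))"
  shows "\<bar>f v - D (cis (a * fst v), cis (a * snd v))\<bar> \<le>
    2 * B * (tail_cutoff a (fst v) + tail_cutoff a (snd v))"
proof -
  obtain x y where v: "v = (x, y)" by (cases v)
  have "B \<ge> 0" using B[of v] by simp
  define p where "p = max 0 (cos (a * x))"
  define q where "q = max 0 (cos (a * y))"
  have pq: "0 \<le> p" "p \<le> 1" "0 \<le> q" "q \<le> 1" by (auto simp: p_def q_def)
  have far: "tail_cutoff a x = 1" if "\<bar>a * x\<bar> > pi / 2" for x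
    using that by (simp add: tail_cutoff_def min_def)
  have near: "arcsin (sin (a * x)) / a = x" "tail_cutoff a x = 1 - max 0 (cos (a * x))" if "\<bar>a * x\<bar> \<le> pi / 2" for x
    using that \<open>a > 0\<close> cos_ge_zero[of "a * x"] by (auto simp: arcsin_sin tail_cutoff_def abs_le_iff min_def)
  define G where "G = f (arcsin (sin (a * x)) / a, arcsin (sin (a * y)) / a)"
  have eq: "D (cis (a * fst v), cis (a * snd v)) = G * p * q"
    by (simp add: D v G_def p_def q_def)
  have G: "\<bar>G\<bar> \<le> B" by (simp add: G_def B)
  have "\<bar>f v - G * p * q\<bar> \<le> 2 * B * (tail_cutoff a x + tail_cutoff a y)"
  proof (cases "\<bar>a * x\<bar> \<le> pi / 2 \<and> \<bar>a * y\<bar> \<le> pi / 2")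
    case True
    \<comment> \<open>Without wrapping, \<open>G\<close> is the true value, and only the factors
      \<open>p\<close> and \<open>q\<close> cause an error.\<close>
    then have "G = f v" by (simp add: G_def v near)
    then have "\<bar>f v - G * p * q\<bar> = \<bar>f v\<bar> * (1 - p * q)"
      using pq mult_le_one[of p q] by (simp add: abs_mult[symmetric] right_diff_distrib[symmetric] mult.assoc abs_mult)
         (metis abs_mult abs_of_nonneg diff_ge_0_iff_ge mult.right_neutral right_diff_distrib)
    also have "\<dots> \<le> B * ((1 - p) + (1 - q))"
    proof (rule mult_mono)
      have "(1 - p) * (1 - q) \<ge> 0" using pq by simp
      then show "1 - p * q \<le> (1 - p) + (1 - q)" by (simp add: algebra_simps)
    qed (use B[of v] pq mult_le_one[of p q] in auto)
    also have "\<dots> \<le> 2 * (B * ((1 - p) + (1 - q)))"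
      using \<open>B \<ge> 0\<close> pq by (simp add: mult_nonneg_nonneg)
    also have "\<dots> = 2 * B * (tail_cutoff a x + tail_cutoff a y)"
      using True by (simp add: near p_def q_def)
    finally show ?thesis .
  next
    case False
    \<comment> \<open>Some coordinate is beyond the half period, where \<open>G\<close> may be the
      value of \<open>f\<close> at a wrong point. The cutoff of that coordinate is 1, so the trivial
      bound \<open>2 * B\<close> suffices.\<close>
    have "\<bar>G * p * q\<bar> \<le> B * 1 * 1"
      unfolding abs_mult using G pq \<open>B \<ge> 0\<close> by (intro mult_mono) auto
    then have "\<bar>f v - G * p * q\<bar> \<le> 2 * B * 1"
      using B[of v] by (simp add: abs_le_iff) 
    also have "\<dots> \<le> 2 * B * (tail_cutoff a x + tail_cutoff a y)"
      using False far[of x] far[of y] tail_cutoff_bounds(1)[of a x] tail_cutoff_bounds(1)[of a y] \<open>B \<ge> 0\<close>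
      by (intro mult_left_mono) auto
    finally show ?thesis .
  qed
  then show ?thesis unfolding eq by (simp add: v)
qed

text \<open>Characteristic functions give convergence for trigonometric polynomials, hence for
  continuous functions on the torus. The passage from \<open>f\<close> to the torus costs a tail
  term, whose expectation converges because it only involves the marginals.\<close>

theorem converges_in_distribution_char_pair:
  fixes X :: "nat \<Rightarrow> 'a \<Rightarrow> real \<times> real"
  assumes M: "\<And>n. prob_space (M n)" "\<And>n. X n \<in> borel_measurable (M n)"
    and N: "prob_space N" "Y \<in> borel_measurable N"
    and char: "\<And>s t. (\<lambda>n. \<integral>\<omega>. cis (s * fst (X n \<omega>) + t * snd (X n \<omega>)) \<partial>M n)
      \<longlonglongrightarrow> (\<integral>\<omega>. cis (s * fst (Y \<omega>) + t * snd (Y \<omega>)) \<partial>N)"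
  shows "converges_in_distribution M X N Y"
  unfolding converges_in_distribution_def
proof (intro conjI allI impI M N)
  fix f :: "real \<times> real \<Rightarrow> real"
  assume f: "continuous_on UNIV f" "bounded (range f)"
  then obtain B where "B > 0" and B: "\<And>v. \<bar>f v\<bar> \<le> B"
    by (auto simp: bounded_pos)
  have meas [measurable]: "(\<lambda>\<omega>. fst (X n \<omega>)) \<in> borel_measurable (M n)" "(\<lambda>\<omega>. snd (X n \<omega>)) \<in> borel_measurable (M n)"
    "(\<lambda>\<omega>. fst (Y \<omega>)) \<in> borel_measurable N" "(\<lambda>\<omega>. snd (Y \<omega>)) \<in> borel_measurable N" for n
  proof -
    have fs: "fst \<in> borel_measurable (borel :: (real \<times> real) measure)" "snd \<in> borel_measurable (borel :: (real \<times> real) measure)"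
      by (auto intro!: borel_measurable_continuous_onI continuous_intros)
    show "(\<lambda>\<omega>. fst (X n \<omega>)) \<in> borel_measurable (M n)" "(\<lambda>\<omega>. snd (X n \<omega>)) \<in> borel_measurable (M n)"
        "(\<lambda>\<omega>. fst (Y \<omega>)) \<in> borel_measurable N" "(\<lambda>\<omega>. snd (Y \<omega>)) \<in> borel_measurable N"
      by (rule measurable_compose[OF M(2) fs(1)] measurable_compose[OF M(2) fs(2)]
          measurable_compose[OF N(2) fs(1)] measurable_compose[OF N(2) fs(2)])+
  qed
  show "(\<lambda>n. \<integral>\<omega>. f (X n \<omega>) \<partial>M n) \<longlonglongrightarrow> (\<integral>\<omega>. f (Y \<omega>) \<partial>N)"
  proof (rule integral_tendsto_by_approx[OF M N])
    show "f \<in> borel_measurable borel" "bounded (range f)"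
      using f by (auto intro: borel_measurable_continuous_onI)
    fix e :: real assume "e > 0"
    have "(\<lambda>k. (\<integral>\<omega>. tail_cutoff (1 / Suc k) (fst (Y \<omega>)) \<partial>N) + (\<integral>\<omega>. tail_cutoff (1 / Suc k) (snd (Y \<omega>)) \<partial>N))
        \<longlonglongrightarrow> 0 + 0"
      by (intro tendsto_add integral_tail_cutoff_small N) measurable
    then have "eventually (\<lambda>k. (\<integral>\<omega>. tail_cutoff (1 / Suc k) (fst (Y \<omega>)) \<partial>N) +
        (\<integral>\<omega>. tail_cutoff (1 / Suc k) (snd (Y \<omega>)) \<partial>N) < e / (2 * B)) sequentially"
      using \<open>e > 0\<close> \<open>B > 0\<close> by (intro order_tendstoD(2)) auto
    then obtain k where k: "(\<integral>\<omega>. tail_cutoff (1 / Suc k) (fst (Y \<omega>)) \<partial>N) +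
        (\<integral>\<omega>. tail_cutoff (1 / Suc k) (snd (Y \<omega>)) \<partial>N) < e / (2 * B)"
      using eventually_happens'[OF sequentially_bot] by blast
    \<comment> \<open>The scale comes first: \<open>a\<close> is fixed so that the tail term is
      small under the limit law, and only then is a trigonometric polynomial chosen for the
      resulting torus function.\<close>
    define a where "a = 1 / real (Suc k)"
    have "a > 0" by (simp add: a_def)
    define D where "D w = f (arcsin (Im (fst w)) / a, arcsin (Im (snd w)) / a) * max 0 (Re (fst w)) * max 0 (Re (snd w))"
      for w :: "complex \<times> complex"
    define g where "g v = D (cis (a * fst v), cis (a * snd v))" for v
    define w where "w v = 2 * B * (tail_cutoff a (fst v) + tail_cutoff a (snd v))" for v :: "real \<times> real"
    have rng: "-1 \<le> Im z \<and> Im z \<le> 1" if "cmod z = 1" for z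
      using abs_Im_le_cmod[of z] that by (simp add: abs_le_iff)
    have Dcont: "continuous_on (sphere 0 1 \<times> sphere 0 1) D"
      unfolding D_def using rng \<open>a > 0\<close>
      by (intro continuous_intros continuous_on_compose2[OF f(1)]) (auto simp: split_beta)
    have gcont: "continuous_on UNIV g"
      unfolding g_def by (rule continuous_on_compose2[OF Dcont]) (auto intro!: continuous_intros)
    have gbd: "bounded (range g)"
    proof (rule boundedI[of _ B])
      fix r assume "r \<in> range g"
      then obtain v where "r = g v" by auto
      moreover have "\<bar>g v\<bar> \<le> B * 1 * 1"
        unfolding g_def D_def abs_mult using B \<open>B > 0\<close> by (intro mult_mono) auto
      ultimately show "norm r \<le> B" by simp
    qed
    have wcont: "continuous_on UNIV w"
      unfolding w_def by (intro continuous_intros continuous_on_compose2[OF tail_cutoff_continuous[of UNIV]]) auto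
    have wbd: "bounded (range w)"
    proof (rule boundedI[of _ "2 * B * 2"])
      fix r assume "r \<in> range w"
      then obtain v where v: "r = w v" by auto
      have "\<bar>tail_cutoff a (fst v) + tail_cutoff a (snd v)\<bar> \<le> 2"
        using tail_cutoff_bounds[of a "fst v"] tail_cutoff_bounds[of a "snd v"] by simp
      then show "norm r \<le> 2 * B * 2"
        using \<open>B > 0\<close> by (simp add: v w_def abs_mult)
    qed
    have gconv: "(\<lambda>n. \<integral>\<omega>. g (X n \<omega>) \<partial>M n) \<longlonglongrightarrow> (\<integral>\<omega>. g (Y \<omega>) \<partial>N)"
    proof (rule integral_tendsto_by_approx[OF M N])
      show "g \<in> borel_measurable borel" "bounded (range g)"
        using gcont gbd by (auto intro: borel_measurable_continuous_onI)
      fix \<epsilon> :: real assume "\<epsilon> > 0"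
      then obtain p where p: "trig_fun (\<lambda>v. of_real (p v))" "\<And>v. \<bar>g v - p v\<bar> < \<epsilon> / 2"
        using trig_fun_dense[OF Dcont, of "\<epsilon> / 2" a] by (auto simp: g_def)
      have "continuous_on UNIV (\<lambda>v. Re (of_real (p v)))"
        by (intro continuous_intros trig_fun_continuous p)
      then have pcont: "continuous_on UNIV p" by simp
      have pbd: "bounded (range p)"
        using trig_fun_bounded[OF p(1)] by (simp add: bounded_iff)
      have "(\<lambda>n. \<integral>\<omega>. complex_of_real (p (X n \<omega>)) \<partial>M n) \<longlonglongrightarrow> (\<integral>\<omega>. complex_of_real (p (Y \<omega>)) \<partial>N)"
        using trig_fun_integral_tendsto[OF M N char p(1)] .
      then have "(\<lambda>n. \<integral>\<omega>. p (X n \<omega>) \<partial>M n) \<longlonglongrightarrow> (\<integral>\<omega>. p (Y \<omega>) \<partial>N)"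
        by (simp add: tendsto_of_real_iff)
      then show "\<exists>g' w. g' \<in> borel_measurable borel \<and> bounded (range g') \<and>
          w \<in> borel_measurable borel \<and> bounded (range w) \<and> (\<forall>v. \<bar>g v - g' v\<bar> \<le> w v) \<and>
          ((\<lambda>n. \<integral>\<omega>. g' (X n \<omega>) \<partial>M n) \<longlonglongrightarrow> (\<integral>\<omega>. g' (Y \<omega>) \<partial>N)) \<and>
          ((\<lambda>n. \<integral>\<omega>. w (X n \<omega>) \<partial>M n) \<longlonglongrightarrow> (\<integral>\<omega>. w (Y \<omega>) \<partial>N)) \<and> (\<integral>\<omega>. w (Y \<omega>) \<partial>N) < \<epsilon>"
        using pcont pbd p(2) \<open>\<epsilon> > 0\<close> M N
        by - (rule exI[of _ p], rule exI[of _ "\<lambda>_. \<epsilon> / 2"],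
            auto intro: borel_measurable_continuous_onI less_imp_le simp: prob_space.prob_space)
    qed
    \<comment> \<open>Frequencies with one zero component give the characteristic functions of the
      marginals.\<close>
    have marg: "(\<lambda>n. \<integral>\<omega>. tail_cutoff a (fst (X n \<omega>)) \<partial>M n) \<longlonglongrightarrow> (\<integral>\<omega>. tail_cutoff a (fst (Y \<omega>)) \<partial>N)"
         "(\<lambda>n. \<integral>\<omega>. tail_cutoff a (snd (X n \<omega>)) \<partial>M n) \<longlonglongrightarrow> (\<integral>\<omega>. tail_cutoff a (snd (Y \<omega>)) \<partial>N)"
      using char[of _ 0] char[of 0]
      by (intro char_tendsto_imp_integral_tendsto[OF M(1) _ N(1) _ _ tail_cutoff_continuous tail_cutoff_bounded];
          simp)+
    have wint: "(\<integral>\<omega>. w (Z \<omega>) \<partial>K) = 2 * B * ((\<integral>\<omega>. tail_cutoff a (fst (Z \<omega>)) \<partial>K) + (\<integral>\<omega>. tail_cutoff a (snd (Z \<omega>)) \<partial>K))"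
      if "prob_space K" "(\<lambda>\<omega>. fst (Z \<omega>)) \<in> borel_measurable K" "(\<lambda>\<omega>. snd (Z \<omega>)) \<in> borel_measurable K"
      for K :: "'k measure" and Z
    proof -
      have "integrable K (\<lambda>\<omega>. tail_cutoff a (fst (Z \<omega>)))" "integrable K (\<lambda>\<omega>. tail_cutoff a (snd (Z \<omega>)))"
        by (rule prob_space.integrable_bounded_comp[OF that(1) that(2)] prob_space.integrable_bounded_comp[OF that(1) that(3)];
            intro borel_measurable_continuous_onI tail_cutoff_continuous tail_cutoff_bounded)+
      then show ?thesis by (simp add: w_def)
    qed
    show "\<exists>g w. g \<in> borel_measurable borel \<and> bounded (range g) \<and>
        w \<in> borel_measurable borel \<and> bounded (range w) \<and> (\<forall>v. \<bar>f v - g v\<bar> \<le> w v) \<and>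
        ((\<lambda>n. \<integral>\<omega>. g (X n \<omega>) \<partial>M n) \<longlonglongrightarrow> (\<integral>\<omega>. g (Y \<omega>) \<partial>N)) \<and>
        ((\<lambda>n. \<integral>\<omega>. w (X n \<omega>) \<partial>M n) \<longlonglongrightarrow> (\<integral>\<omega>. w (Y \<omega>) \<partial>N)) \<and> (\<integral>\<omega>. w (Y \<omega>) \<partial>N) < e"
    proof (rule exI[of _ g], rule exI[of _ w], intro conjI allI gbd wbd gconv)
      show "\<bar>f v - g v\<bar> \<le> w v" for v
        unfolding g_def w_def by (rule torus_approx[OF B \<open>a > 0\<close>]) (simp add: fun_eq_iff D_def)
      show "(\<lambda>n. \<integral>\<omega>. w (X n \<omega>) \<partial>M n) \<longlonglongrightarrow> (\<integral>\<omega>. w (Y \<omega>) \<partial>N)"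
        unfolding wint[OF M(1) meas(1,2)] wint[OF N(1) meas(3,4)] by (intro tendsto_intros marg)
      show "(\<integral>\<omega>. w (Y \<omega>) \<partial>N) < e"
        using k \<open>B > 0\<close> by (subst wint[OF N(1) meas(3,4)]) (auto simp: a_def field_simps simp del: of_nat_Suc)
    qed (use gcont wcont in \<open>auto intro: borel_measurable_continuous_onI\<close>)
  qed
qed

subsection \<open>Exponential sums\<close>

lemma harm_le_ln: "n \<ge> 1 \<Longrightarrow> harm n \<le> 1 + ln (real n)"
  using decseqD[OF decseq_harm_diff_ln, of 0 "n - 1"] by (simp add: harm_expand)

text \<open>The sum telescopes after multiplication by 1 - y; the product form covers y = 1 as
  well.\<close>

lemma norm_geometric_sum_le:
  fixes y :: complex
  assumes "cmod y = 1"
  shows "cmod (\<Sum>k = a..<a + L. y ^ k) * cmod (1 - y) \<le> 2"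
proof -
  have "(\<Sum>k = a..<a + L. y ^ k) * (1 - y) = y ^ a - y ^ (a + L)"
  proof (induction L)
    case (Suc L)
    have "(\<Sum>k = a..<a + Suc L. y ^ k) * (1 - y) = (\<Sum>k = a..<a + L. y ^ k) * (1 - y) + y ^ (a + L) * (1 - y)"
      by (simp add: distrib_right)
    also have "\<dots> = y ^ a - y ^ (a + Suc L)"
      unfolding Suc.IH by (simp add: right_diff_distrib)
    finally show ?case .
  qed simp
  then have "cmod (\<Sum>k = a..<a + L. y ^ k) * cmod (1 - y) = cmod (y ^ a - y ^ (a + L))"
    by (metis norm_mult)
  also have "\<dots> \<le> cmod (y ^ a) + cmod (y ^ (a + L))"
    by (rule norm_triangle_ineq4)
  finally show ?thesis by (simp add: norm_power assms)
qed

definition exp_sum :: "complex \<Rightarrow> nat \<Rightarrow> nat \<Rightarrow> complex" where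
  "exp_sum x k M = (\<Sum>m = 1..M. x ^ (k * m))"

text \<open>The weights come from the logarithm series: sums over \<open>m\<close> of polynomials in
  \<open>x ^ m\<close> with coefficients of order 1 / k and no constant term are bounded by a
  multiple of this quantity.\<close>

definition weighted_exp_sum :: "complex \<Rightarrow> nat \<Rightarrow> nat \<Rightarrow> real" where
  "weighted_exp_sum x M N = (\<Sum>k = 1..N. cmod (exp_sum x k M) / k)"

text \<open>Finite type in terms of chords, with a natural number as exponent, so that
  \<open>B ^ (g + 1)\<close> below can serve as the length of a window. The lower bound is positive,
  which excludes roots of unity.\<close>

locale diophantine =
  fixes x :: complex and c :: real and g :: nat
  assumes norm_x [simp]: "cmod x = 1" and c_pos: "c > 0" and g_pos: "g \<ge> 1"
    and lower: "\<And>k. k \<ge> 1 \<Longrightarrow> cmod (1 - x ^ k) \<ge> c / real k ^ g"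
begin

lemma power_neq_1: "k \<ge> 1 \<Longrightarrow> x ^ k \<noteq> 1"
proof -
  assume "k \<ge> 1"
  then have "c / real k ^ g > 0" using c_pos by simp
  then show ?thesis using lower[OF \<open>k \<ge> 1\<close>] by auto
qed

lemma norm_exp_sum_le: "cmod (exp_sum x k M) \<le> M"
  unfolding exp_sum_def by (rule order_trans[OF norm_sum]) (simp add: norm_power)

text \<open>A general \<open>y\<close> is allowed because frequencies in the squared sums may be
  negative: \<open>y\<close> is then the conjugate of \<open>x ^ k\<close>.\<close>

lemma norm_geometric_le:
  assumes "k \<ge> 1" and y: "cmod y = 1" "cmod (1 - y) = cmod (1 - x ^ k)"
  shows "cmod (\<Sum>i = a..<a + L. y ^ i) \<le> 2 / c * real k ^ g"
proof -
  have "cmod (\<Sum>i = a..<a + L. y ^ i) * (c / real k ^ g) \<le> cmod (\<Sum>i = a..<a + L. y ^ i) * cmod (1 - y)"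
    using lower[OF assms(1)] y(2) by (intro mult_left_mono) auto
  also have "\<dots> \<le> 2" by (rule norm_geometric_sum_le[OF y(1)])
  finally show ?thesis using c_pos assms(1) by (simp add: field_simps)
qed

lemma norm_exp_sum_le': "k \<ge> 1 \<Longrightarrow> cmod (exp_sum x k M) \<le> 2 / c * real k ^ g"
  using norm_geometric_le[of k "x ^ k" 1 M]
  by (simp add: exp_sum_def power_mult norm_power atLeastLessThanSuc_atLeastAtMost)

lemma exp_sum_add: "exp_sum x k (a + b) = exp_sum x k a + x ^ (k * a) * exp_sum x k b"
proof -
  have "exp_sum x k (a + b) = exp_sum x k a + (\<Sum>m = Suc a..a + b. x ^ (k * m))"
    unfolding exp_sum_def using sum.ub_add_nat[of 1 a _ b] by simp
  also have "(\<Sum>m = Suc a..a + b. x ^ (k * m)) = (\<Sum>m = 1..b. x ^ (k * (a + m)))"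
    by (rule sum.reindex_bij_witness[where i = "\<lambda>m. a + m" and j = "\<lambda>m. m - a"]) auto
  finally show ?thesis
    by (simp add: exp_sum_def sum_distrib_left power_add distrib_left)
qed

text \<open>The range of \<open>m\<close> is cut into blocks of length \<open>B\<close>. By
  \<open>exp_sum_add\<close> each block is a rotation of the first one; the remainder has fewer than
  \<open>B\<close> terms of modulus 1.\<close>

lemma norm_exp_sum_blocks:
  assumes "B \<ge> 1"
  shows "cmod (exp_sum x k M) \<le> real M / B * cmod (exp_sum x k B) + B"
proof -
  have add: "cmod (exp_sum x k (a + b)) \<le> cmod (exp_sum x k a) + cmod (exp_sum x k b)" for a b
    unfolding exp_sum_add by (rule order_trans[OF norm_triangle_ineq]) (simp add: norm_mult norm_power)
  have q: "cmod (exp_sum x k (q * B)) \<le> q * cmod (exp_sum x k B)" for q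
  proof (induction q)
    case (Suc q)
    then show ?case using add[of B "q * B"] by (simp add: distrib_right)
  qed (simp add: exp_sum_def)
  have "cmod (exp_sum x k M) \<le> cmod (exp_sum x k (M div B * B)) + cmod (exp_sum x k (M mod B))"
    using add[of "M div B * B" "M mod B"] by simp
  also have "\<dots> \<le> real (M div B) * cmod (exp_sum x k B) + M mod B"
    using q norm_exp_sum_le by (intro add_mono) auto
  also have "\<dots> \<le> real M / B * cmod (exp_sum x k B) + B"
    using assms by (intro add_mono mult_right_mono of_nat_div_le_of_nat) (auto intro: less_imp_le)
  finally show ?thesis .
qed

text \<open>After squaring, the pairs \<open>m \<noteq> m'\<close> contribute
  geometric sums in the frequency, which the Diophantine condition bounds.\<close>

lemma sum_norm_exp_sum_squared:
  "(\<Sum>k = a..<a + L. (cmod (exp_sum x k B))\<^sup>2) \<le> real B * L + real B ^ 2 * (2 / c * real B ^ g)"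
proof -
  define y where "y m m' = x ^ m * cnj (x ^ m')" for m m'
  have sq: "of_real ((cmod (exp_sum x k B))\<^sup>2) = (\<Sum>m = 1..B. \<Sum>m' = 1..B. y m m' ^ k)" for k
    unfolding complex_norm_square exp_sum_def y_def
    by (simp add: sum_product power_mult_distrib mult.commute[of k] flip: power_mult)
  have xcn: "x ^ m * cnj (x ^ m) = 1" for m
    by (metis complex_norm_square norm_x norm_power of_real_1 power_one)
  have off: "cmod (\<Sum>k = a..<a + L. y m m' ^ k) \<le> 2 / c * real B ^ g"
    if "m \<in> {1..B}" "m' \<in> {1..B}" "m \<noteq> m'" for m m'
  proof -
    define d where "d = (if m > m' then m - m' else m' - m)"
    have d: "d \<ge> 1" "d \<le> B" using that by (auto simp: d_def)
    have y1: "1 - y m m' = cnj (x ^ m') * (x ^ m' - x ^ m)"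
      using xcn[of m'] by (simp add: y_def algebra_simps)
    have "cmod (1 - y m m') = cmod (x ^ m' - x ^ m)"
      unfolding y1 by (simp add: norm_mult norm_power)
    also have "\<dots> = cmod (1 - x ^ d)"
    proof (cases "m > m'")
      case True
      then have "x ^ m' - x ^ m = x ^ m' * (1 - x ^ d)"
        by (simp add: d_def algebra_simps flip: power_add)
      then show ?thesis by (simp add: norm_mult norm_power)
    next
      case False
      then have "x ^ m - x ^ m' = x ^ m * (1 - x ^ d)"
        using that by (simp add: d_def algebra_simps flip: power_add)
      then have "cmod (x ^ m - x ^ m') = cmod (1 - x ^ d)" by (simp add: norm_mult norm_power)
      then show ?thesis by (simp add: norm_minus_commute)
    qed
    finally have "cmod (\<Sum>k = a..<a + L. y m m' ^ k) \<le> 2 / c * real d ^ g"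
      using d by (intro norm_geometric_le) (auto simp: y_def norm_mult norm_power)
    also have "\<dots> \<le> 2 / c * real B ^ g"
      using d c_pos by (intro mult_left_mono power_mono) auto
    finally show ?thesis .
  qed
  define S where "S = (\<Sum>k = a..<a + L. (cmod (exp_sum x k B))\<^sup>2)"
  have "S \<ge> 0" unfolding S_def by (intro sum_nonneg) auto
  have "of_real S =
      (\<Sum>k = a..<a + L. \<Sum>m = 1..B. \<Sum>m' = 1..B. y m m' ^ k)"
    unfolding S_def of_real_sum sq ..
  also have "\<dots> = (\<Sum>m = 1..B. \<Sum>k = a..<a + L. \<Sum>m' = 1..B. y m m' ^ k)"
    by (rule sum.swap)
  also have "\<dots> = (\<Sum>m = 1..B. \<Sum>m' = 1..B. \<Sum>k = a..<a + L. y m m' ^ k)"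
    by (intro sum.cong refl sum.swap)
  finally have "cmod (of_real S) = cmod (\<Sum>m = 1..B. \<Sum>m' = 1..B. \<Sum>k = a..<a + L. y m m' ^ k)"
    by (rule arg_cong)
  then have "S = cmod (\<Sum>m = 1..B. \<Sum>m' = 1..B. \<Sum>k = a..<a + L. y m m' ^ k)"
    using \<open>S \<ge> 0\<close> by (simp only: norm_of_real abs_of_nonneg)
  also have "\<dots> \<le> (\<Sum>m = 1..B. \<Sum>m' = 1..B. (if m = m' then real L else 0) + 2 / c * real B ^ g)"
  proof (intro sum_norm_le)
    fix m m' assume m: "m \<in> {1..B}" "m' \<in> {1..B}"
    show "cmod (\<Sum>k = a..<a + L. y m m' ^ k) \<le> (if m = m' then real L else 0) + 2 / c * real B ^ g"
    proof (cases "m = m'")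
      case True
      have "y m m' ^ k = 1" for k using xcn[of m] True by (simp add: y_def)
      then show ?thesis using True c_pos by simp
    qed (use off[OF m] in simp)
  qed
  also have "\<dots> = real B * L + real B ^ 2 * (2 / c * real B ^ g)"
    by (simp add: sum.distrib power2_eq_square distrib_left)
  finally show ?thesis unfolding S_def .
qed

text \<open>Cauchy--Schwarz over a window of \<open>L\<close> frequencies. The choice of
  \<open>L\<close> balances the diagonal \<open>B * L\<close> with the off-diagonal
  \<open>B ^ (g + 2)\<close>, so \<open>exp_sum x k B\<close> has size of order
  \<open>sqrt B\<close> on average, and cutting into blocks turns this into a saving of
  \<open>sqrt B\<close> over the trivial bound \<open>M\<close>.\<close>

lemma sum_norm_exp_sum_window:
  fixes B L :: nat
  assumes "B \<ge> 1" and L: "L = B ^ (g + 1)"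
  shows "(\<Sum>k = a..<a + L. cmod (exp_sum x k M)) \<le> L * (M * sqrt (1 + 2 / c) / sqrt B + B)"
proof -
  define S where "S = (\<Sum>k = a..<a + L. cmod (exp_sum x k B))"
  have "S\<^sup>2 \<le> (\<Sum>k = a..<a + L. (cmod (exp_sum x k B))\<^sup>2) * L"
    unfolding S_def using sum_squared_le_sum_of_squares[of "\<lambda>k. cmod (exp_sum x k B)" "{a..<a + L}"] by simp
  also have "\<dots> \<le> (real B * L + real B ^ 2 * (2 / c * real B ^ g)) * L"
    by (intro mult_right_mono sum_norm_exp_sum_squared) auto
  also have "\<dots> = (L * (sqrt B * sqrt (1 + 2 / c)))\<^sup>2"
  proof -
    have LL: "real L = real B * real B ^ g" by (simp add: L)
    have eq: "real B ^ 2 * (2 / c * real B ^ g) = real B * L * (2 / c)"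
      unfolding LL by (simp add: power2_eq_square)
    have "(real B * L + real B ^ 2 * (2 / c * real B ^ g)) * L = (real L)\<^sup>2 * (real B * (1 + 2 / c))"
      unfolding eq
      by (simp add: power2_eq_square algebra_simps)
    also have "\<dots> = (L * (sqrt B * sqrt (1 + 2 / c)))\<^sup>2"
      using c_pos by (simp add: power_mult_distrib)
    finally show ?thesis .
  qed
  finally have "S \<le> L * (sqrt B * sqrt (1 + 2 / c))"
    by (rule power2_le_imp_le) (use c_pos in auto)
  then have S: "real M / B * S \<le> real M / B * (L * (sqrt B * sqrt (1 + 2 / c)))"
    by (intro mult_left_mono) auto
  have "(\<Sum>k = a..<a + L. cmod (exp_sum x k M)) \<le> (\<Sum>k = a..<a + L. real M / B * cmod (exp_sum x k B) + B)"
    by (intro sum_mono norm_exp_sum_blocks assms)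
  also have "\<dots> = real M / B * S + real L * B"
    by (simp add: sum.distrib S_def sum_distrib_left)
  also have "\<dots> \<le> real M / B * (L * (sqrt B * sqrt (1 + 2 / c))) + real L * B"
    using S by simp
  also have "\<dots> = L * (M * sqrt (1 + 2 / c) / sqrt B + B)"
  proof -
    have "sqrt B / B = 1 / sqrt B" using assms(1) by (simp add: field_simps)
    then have "real M / B * (L * (sqrt B * sqrt (1 + 2 / c))) = L * (M * sqrt (1 + 2 / c) / sqrt B)"
      using assms(1) by (simp add: field_simps)
    then show ?thesis by (simp add: algebra_simps)
  qed
  finally show ?thesis .
qed

text \<open>In the window that starts at \<open>j * L\<close> with \<open>j \<ge> 1\<close> the
  weight is at most \<open>1 / (j * L)\<close>, and summation over \<open>j\<close> gives the
  harmonic number. In the first window the weight varies too much; there the frequencies are small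
  enough for the Diophantine bound itself.\<close>

lemma weighted_exp_sum_le_blocks:
  fixes B L :: nat
  assumes "B \<ge> 1" "N \<ge> 1" and L: "L = B ^ (g + 1)"
  shows "weighted_exp_sum x M N \<le> 2 / c * real L ^ g + harm N * (M * sqrt (1 + 2 / c) / sqrt B + B)"
proof -
  define f where "f k = cmod (exp_sum x k M) / k" for k
  define W where "W = M * sqrt (1 + 2 / c) / sqrt B + B"
  have f0: "f k \<ge> 0" for k by (simp add: f_def)
  have L1: "L \<ge> 1" using assms by simp
  have "weighted_exp_sum x M N = sum f {1..N}" by (simp add: weighted_exp_sum_def f_def)
  \<comment> \<open>More windows than necessary: the extra terms are nonnegative, and the harmonic
    sum over \<open>N\<close> windows is still logarithmic. The term at 0 is a division by 0, hence
    0.\<close>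
  also have "\<dots> \<le> sum f {..<Suc N * L}"
  proof (rule sum_mono2)
    show "{1..N} \<subseteq> {..<Suc N * L}"
    proof
      fix k assume "k \<in> {1..N}"
      moreover have "Suc N * 1 \<le> Suc N * L" using L1 by (intro mult_le_mono) auto
      ultimately show "k \<in> {..<Suc N * L}" by simp
    qed
  qed (use f0 in auto)
  also have "\<dots> = (\<Sum>j<Suc N. sum f {j * L..<j * L + L})"
    by (rule sum.nat_group[symmetric])
  also have "\<dots> = sum f {0..<L} + (\<Sum>j = 1..N. sum f {j * L..<j * L + L})"
    by (simp only: lessThan_Suc_atMost sum.atMost_shift) 
       (simp add: sum.atLeast1_atMost_eq)
  also have "\<dots> \<le> 2 / c * real L ^ g + (\<Sum>j = 1..N. inverse (real j) * W)"
  proof (intro add_mono sum_mono)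
    have "sum f {0..<L} \<le> (\<Sum>k = 0..<L. 2 / c * real L ^ (g - 1))"
    proof (rule sum_mono)
      fix k assume k: "k \<in> {0..<L}"
      show "f k \<le> 2 / c * real L ^ (g - 1)"
      proof (cases "k = 0")
        case False
        have "f k \<le> 2 / c * real k ^ g / k"
          unfolding f_def using False by (intro divide_right_mono norm_exp_sum_le') auto
        also have "\<dots> = 2 / c * real k ^ (g - 1)"
          using g_pos False by (cases g) auto
        also have "\<dots> \<le> 2 / c * real L ^ (g - 1)"
          using k c_pos by (intro mult_left_mono power_mono) auto
        finally show ?thesis .
      qed (use c_pos in \<open>simp add: f_def\<close>)
    qed
    also have "\<dots> = 2 / c * real L ^ g"
      using g_pos by (cases g) auto
    finally show "sum f {0..<L} \<le> 2 / c * real L ^ g" .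
  next
    fix j assume j: "j \<in> {1..N}"
    have "sum f {j * L..<j * L + L} \<le> (\<Sum>k = j * L..<j * L + L. cmod (exp_sum x k M) / (real j * L))"
    proof (rule sum_mono)
      fix k assume k: "k \<in> {j * L..<j * L + L}"
      then have "real (j * L) \<le> real k" by (simp only: of_nat_le_iff) simp
      moreover have "real j * L > 0" using j L1 by simp
      ultimately show "f k \<le> cmod (exp_sum x k M) / (real j * L)"
        unfolding f_def by (intro divide_left_mono) auto
    qed
    also have "\<dots> = (\<Sum>k = j * L..<j * L + L. cmod (exp_sum x k M)) / (real j * L)"
      by (simp add: sum_divide_distrib)
    also have "\<dots> \<le> (L * W) / (real j * L)"
      unfolding W_def by (intro divide_right_mono sum_norm_exp_sum_window assms) auto
    also have "\<dots> = inverse (real j) * W"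
      using j L1 by (simp add: field_simps)
    finally show "sum f {j * L..<j * L + L} \<le> inverse (real j) * W" .
  qed
  also have "\<dots> = 2 / c * real L ^ g + harm N * W"
    by (simp add: harm_def sum_distrib_right)
  finally show ?thesis by (simp add: W_def)
qed

text \<open>With \<open>B\<close> about \<open>M powr (2 * \<delta>)\<close>, the saving
  \<open>sqrt B\<close> is about \<open>M powr \<delta>\<close>, and the cost
  \<open>L ^ g = B ^ (g * (g + 1))\<close> of the first window becomes
  \<open>M powr (1 / 2)\<close>. The latter fixes the constant 4.\<close>

definition \<delta> :: real where "\<delta> = 1 / (4 * real (g * (g + 1)))"

lemma \<delta>_bounds: "0 < \<delta>" "\<delta> \<le> 1 / 8"
proof -
  have "2 \<le> real (g * (g + 1))"
    using g_pos by (metis One_nat_def Suc_1 add_le_mono le_refl mult_le_mono nat_mult_1 of_nat_le_iff of_nat_numeral plus_1_eq_Suc add.commute)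
  then show "0 < \<delta>" "\<delta> \<le> 1 / 8"
    by (auto simp: \<delta>_def field_simps)
qed

lemma weighted_exp_sum_bound:
  "\<exists>C>0. \<forall>M\<ge>1. \<forall>N\<ge>1. weighted_exp_sum x M N \<le> C * real M powr (1 - \<delta>) * (1 + ln (real N))"
proof (intro exI[of _ "2 / c + 2 * sqrt (1 + 2 / c) + 1"] conjI allI impI)
  show "2 / c + 2 * sqrt (1 + 2 / c) + 1 > 0" using c_pos by (simp add: add_pos_pos)
  fix M N :: nat assume M: "M \<ge> 1" and N: "N \<ge> 1"
  define b where "b = real M powr (2 * \<delta>)"
  define B where "B = nat \<lfloor>b\<rfloor>"
  define R where "R = real M powr (1 - \<delta>)"
  have b1: "b \<ge> 1" using M \<delta>_bounds by (simp add: b_def ge_one_powr_ge_zero)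
  have B1: "B \<ge> 1" using b1 by (simp add: B_def Suc_le_eq)
  have "real B = of_int \<lfloor>b\<rfloor>" using b1 by (simp add: B_def)
  then have Bb: "real B \<le> b" "b \<le> 2 * real B"
    using real_of_int_floor_add_one_gt[of b] of_int_floor_le[of b] B1 by linarith+
  have mono: "real M powr u \<le> real M powr v" if "u \<le> v" for u v
    using M that by (intro powr_mono) auto
  define p where "p = (g + 1) * g"
  have p: "p > 0" "\<delta> = 1 / (4 * real p)" using g_pos by (simp_all add: p_def \<delta>_def)
  have half: "2 * \<delta> * real p = 1 / 2" using p by simp
  have "real (B ^ (g + 1)) ^ g = real B ^ p" unfolding p_def power_mult of_nat_power ..
  also have "\<dots> \<le> b ^ p" using Bb(1) by (intro power_mono) auto
  also have "\<dots> = b powr real p"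
    using b1 by (subst powr_realpow) auto
  also have "\<dots> = real M powr (1 / 2)"
    unfolding b_def powr_powr half ..
  also have "real M powr (1 / 2) \<le> R"
    unfolding R_def using \<delta>_bounds by (intro mono) simp
  finally have 1: "real (B ^ (g + 1)) ^ g \<le> R" .
  have 2: "real B \<le> R"
    using Bb(1) mono[of "2 * \<delta>" "1 - \<delta>"] \<delta>_bounds by (simp add: b_def R_def)
  have 3: "M / sqrt B \<le> 2 * R"
  proof -
    have "real M powr \<delta> = sqrt b"
      using M by (simp add: b_def powr_half_sqrt[symmetric] powr_powr)
    also have "\<dots> \<le> sqrt (4 * B)" using Bb by (intro real_sqrt_le_mono) linarith
    also have "\<dots> = 2 * sqrt B" by (simp add: real_sqrt_mult)
    finally have "real M / sqrt B \<le> real M / (real M powr \<delta> / 2)"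
      using B1 M by (intro divide_left_mono) auto
    also have "\<dots> = 2 * R" using M by (simp add: R_def powr_diff)
    finally show ?thesis .
  qed
  define s where "s = sqrt (1 + 2 / c)"
  define t where "t = 1 + ln (real N)"
  have st: "s \<ge> 0" "t \<ge> 1" "R \<ge> 0" using c_pos N by (simp_all add: s_def t_def R_def)
  have "weighted_exp_sum x M N \<le> 2 / c * real (B ^ (g + 1)) ^ g + harm N * (M * s / sqrt B + B)"
    unfolding s_def by (rule weighted_exp_sum_le_blocks[OF B1 N refl])
  also have "\<dots> \<le> 2 / c * R + t * (2 * R * s + R)"
  proof (rule add_mono)
    show "2 / c * real (B ^ (g + 1)) ^ g \<le> 2 / c * R"
      using 1 c_pos by (intro mult_left_mono) auto
    have "M / sqrt B * s \<le> 2 * R * s"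
      using 3 st by (intro mult_right_mono) auto
    then have "M * s / sqrt B + B \<le> 2 * R * s + R" using 2 by simp
    then show "harm N * (M * s / sqrt B + B) \<le> t * (2 * R * s + R)"
      using harm_le_ln[OF N] st by (intro mult_mono) (auto simp: t_def)
  qed
  also have "\<dots> \<le> (2 / c + 2 * s + 1) * R * t"
  proof -
    have "2 / c * R * 1 \<le> 2 / c * R * t"
      using st c_pos by (intro mult_left_mono) auto
    then show ?thesis by (simp add: algebra_simps)
  qed
  finally show "weighted_exp_sum x M N \<le>
      (2 / c + 2 * sqrt (1 + 2 / c) + 1) * real M powr (1 - \<delta>) * (1 + ln (real N))"
    by (simp only: R_def s_def t_def)
qed

end

subsection \<open>Sums of logarithms\<close>

text \<open>A partial sum of the series of \<open>- Ln (1 - w)\<close>; this sign is why it is added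
  to the logarithm in the estimates.\<close>

definition log_partial :: "nat \<Rightarrow> complex \<Rightarrow> complex" where
  "log_partial N w = (\<Sum>k = 1..N. w ^ k / of_nat k)"

lemma norm_log_partial_le:
  assumes "cmod w = 1"
  shows "cmod (log_partial N w) \<le> harm N"
  unfolding log_partial_def harm_def
  by (rule sum_norm_le) (simp add: norm_divide norm_power assms inverse_eq_divide)

text \<open>On the circle the series does not converge absolutely, so the remainder is followed
  along the radius to \<open>w\<close>. Its derivative has modulus r^N / |1 - r w|, and |1 - r w|
  stays above half of |1 - w|; integration of r^N yields the factor 1 / (N + 1).\<close>

lemma Ln_one_minus_approx:
  assumes w: "cmod w = 1" "w \<noteq> 1"
  shows "cmod (Ln (1 - w) + log_partial N w) \<le> 2 / (real (Suc N) * cmod (1 - w))"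
proof -
  define F where "F u = Ln (1 - u * w) + log_partial N (u * w)" for u
  define F' where "F' u = - w * (u * w) ^ N / (1 - u * w)" for u
  define \<phi> where "\<phi> r = 2 / (real (Suc N) * cmod (1 - w)) * r ^ Suc N" for r
  define \<phi>' where "\<phi>' r = 2 / (real (Suc N) * cmod (1 - w)) * (real (Suc N) * r ^ N)" for r
  have d0: "cmod (1 - w) > 0" using w by simp
  have "Re w < 1"
  proof (rule ccontr)
    assume "\<not> Re w < 1"
    then have "Re w = 1" using abs_Re_le_cmod[of w] w by simp
    moreover have "(Re w)\<^sup>2 + (Im w)\<^sup>2 = 1" using w(1) by (simp add: cmod_def)
    ultimately show False using w(2) by (simp add: complex_eq_iff)
  qed
  \<comment> \<open>With positive real part, \<open>1 - of_real r * w\<close> avoids the branch cut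
    of \<open>Ln\<close>, up to and including \<open>r = 1\<close>.\<close>
  have pos: "Re (1 - of_real r * w) > 0" if r: "0 \<le> r" "r \<le> 1" for r
  proof (cases "r = 1")
    case False
    have "r * Re w \<le> r * 1" using r \<open>Re w < 1\<close> by (intro mult_left_mono) auto
    then show ?thesis using False r by simp
  qed (use \<open>Re w < 1\<close> in simp)
  have der: "(F has_field_derivative F' (of_real r)) (at (of_real r))" if r: "0 \<le> r" "r \<le> 1" for r
  proof -
    have nz: "1 - of_real r * w \<notin> \<real>\<^sub>\<le>\<^sub>0"
      using pos[OF r] by (auto simp: complex_nonpos_Reals_iff)
    then have nz2: "1 - of_real r * w \<noteq> 0" by auto
    have "(\<Sum>k = 1..N. w * (of_real r * w) ^ (k - 1)) = w * (\<Sum>k<N. (of_real r * w) ^ k)"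
      by (simp add: sum_distrib_left sum.atLeast1_atMost_eq)
    also have "\<dots> = w * (1 - (of_real r * w) ^ N) / (1 - of_real r * w)"
      using nz2 by (subst sum_gp_strict) auto
    finally have eq: "(\<Sum>k = 1..N. w * (of_real r * w) ^ (k - 1)) = w * (1 - (of_real r * w) ^ N) / (1 - of_real r * w)" .
    have "- w / (1 - of_real r * w) + (\<Sum>k = 1..N. w * (of_real r * w) ^ (k - 1)) = F' (of_real r)"
      unfolding eq F'_def by (simp add: right_diff_distrib diff_divide_distrib)
    moreover have "(F has_field_derivative - w / (1 - of_real r * w) +
        (\<Sum>k = 1..N. w * (of_real r * w) ^ (k - 1))) (at (of_real r))"
      unfolding F_def log_partial_def
      by (rule derivative_eq_intros refl nz)+ (use nz2 in \<open>auto simp: field_simps intro!: sum.cong\<close>)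
    ultimately show ?thesis by simp
  qed
  have vder: "((\<lambda>r. F (of_real r)) has_vector_derivative F' (of_real r)) (at r within A)" if "0 \<le> r" "r \<le> 1" for r A
    using has_vector_derivative_real_field[OF der[OF that]] .
  have "norm (F (of_real 1) - F (of_real 0)) \<le> \<phi> 1 - \<phi> 0"
  proof (rule differentiable_bound_general[where f' = "\<lambda>r. F' (of_real r)" and \<phi>' = \<phi>'])
    show "continuous_on {0..1} (\<lambda>r. F (of_real r))"
      by (rule continuous_on_vector_derivative, rule vder) auto
    show "continuous_on {0..1} \<phi>"
      unfolding \<phi>_def using d0 by (intro continuous_intros) auto
    show "(\<phi> has_vector_derivative \<phi>' r) (at r)" if "0 < r" "r < 1" for r
    proof -
      have "(\<phi> has_real_derivative \<phi>' r) (at r)"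
        unfolding \<phi>_def \<phi>'_def using DERIV_pow[of "Suc N" r UNIV]
        by (intro DERIV_cmult) (simp del: of_nat_Suc power_Suc)
      then show ?thesis
        by (simp add: has_real_derivative_iff_has_vector_derivative)
    qed
    show "norm (F' (of_real r)) \<le> \<phi>' r" if r: "0 < r" "r < 1" for r
    proof -
      have "1 - r \<le> cmod (1 - of_real r * w)"
        using norm_triangle_ineq2[of 1 "of_real r * w"] r w by (simp add: norm_mult)
      moreover have "cmod (1 - w) \<le> cmod (1 - of_real r * w) + cmod ((of_real r - 1) * w)"
        using norm_triangle_ineq[of "1 - of_real r * w" "(of_real r - 1) * w"] by (simp add: algebra_simps)
      moreover have "cmod ((of_real r - 1) * w) = 1 - r"
      proof -
        have "of_real r - 1 = complex_of_real (r - 1)" by simp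
        then show ?thesis unfolding norm_mult norm_of_real using r w by (simp only: norm_of_real) simp
      qed
      \<comment> \<open>|1 - w| is at most |1 - r w| + (1 - r), and 1 - r is itself at most |1 - r
        w|.\<close>
      ultimately have *: "cmod (1 - w) / 2 \<le> cmod (1 - of_real r * w)" by simp
      have "norm (F' (of_real r)) = r ^ N / cmod (1 - of_real r * w)"
        using r w by (simp add: F'_def norm_mult norm_divide norm_power)
      also have "\<dots> \<le> r ^ N / (cmod (1 - w) / 2)"
        using * d0 r by (intro divide_left_mono mult_pos_pos) (simp, simp, linarith, simp)
      also have "\<dots> = \<phi>' r"
        by (simp add: \<phi>'_def del: of_nat_Suc)
      finally show ?thesis .
    qed
  qed (use vder in auto)
  then show ?thesis
    by (simp add: F_def \<phi>_def log_partial_def power_0_left)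
qed

section \<open>Squares of the logarithm series and their coefficients\<close>

definition log_square_coeff :: "nat \<Rightarrow> nat \<Rightarrow> real" where
  "log_square_coeff N h = (\<Sum>(i, j) | (i, j) \<in> {1..N} \<times> {1..N} \<and> i + j = h. 1 / (real i * real j))"

lemma log_partial_square:
  "(log_partial N w)\<^sup>2 = (\<Sum>h = 1..2 * N. of_real (log_square_coeff N h) * w ^ h)"
proof -
  have "(log_partial N w)\<^sup>2 = (\<Sum>(i, j)\<in>{1..N} \<times> {1..N}. w ^ (i + j) / (of_nat i * of_nat j))"
    by (simp add: log_partial_def power2_eq_square sum_product sum.cartesian_product power_add)
  also have "\<dots> = (\<Sum>h = 1..2 * N. \<Sum>p | p \<in> {1..N} \<times> {1..N} \<and> fst p + snd p = h.
      (case p of (i, j) \<Rightarrow> w ^ (i + j) / (of_nat i * of_nat j)))"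
    by (rule sum.group[symmetric]) auto
  also have "\<dots> = (\<Sum>h = 1..2 * N. of_real (log_square_coeff N h) * w ^ h)"
    unfolding log_square_coeff_def of_real_sum sum_distrib_right
    by (intro sum.cong refl) (auto simp: split_beta)
  finally show ?thesis .
qed

text \<open>For i + j = h one has 1 / (i j) = (1 / i + 1 / j) / h; each of the two resulting sums
  runs over distinct indices up to \<open>h\<close>.\<close>

lemma log_square_coeff_bounds:
  assumes "h \<ge> 1"
  shows "0 \<le> log_square_coeff N h" "log_square_coeff N h \<le> 2 * harm h / h"
proof -
  define S where "S = {(i, j). (i, j) \<in> {1..N} \<times> {1..N} \<and> i + j = h}"
  show "0 \<le> log_square_coeff N h"
    unfolding log_square_coeff_def by (rule sum_nonneg) auto
  have "log_square_coeff N h = (\<Sum>p\<in>S. (1 / fst p + 1 / snd p) / h)"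
    unfolding log_square_coeff_def S_def
  proof (intro sum.cong refl)
    fix p assume "p \<in> {(i, j). (i, j) \<in> {1..N} \<times> {1..N} \<and> i + j = h}"
    then obtain i j where p: "p = (i, j)" "i \<in> {1..N}" "j \<in> {1..N}" "h = i + j" by auto
    then have "1 / real i + 1 / real j = real h / (real i * real j)" "real h > 0"
      by (auto simp: field_simps)
    then show "(case p of (i, j) \<Rightarrow> 1 / (real i * real j)) = (1 / fst p + 1 / snd p) / h"
      by (simp add: p(1))
  qed
  also have "\<dots> = ((\<Sum>p\<in>S. 1 / fst p) + (\<Sum>p\<in>S. 1 / snd p)) / h"
    by (simp only: sum.distrib flip: sum_divide_distrib)
  also have "\<dots> \<le> (harm h + harm h) / h"
  proof (intro divide_right_mono add_mono)
    have "(\<Sum>p\<in>S. 1 / real (fst p)) = (\<Sum>i\<in>fst ` S. 1 / real i)"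
      by (subst sum.reindex) (auto simp: inj_on_def S_def)
    also have "\<dots> \<le> (\<Sum>i = 1..h. 1 / real i)"
      by (rule sum_mono2) (auto simp: S_def)
    finally show "(\<Sum>p\<in>S. 1 / real (fst p)) \<le> harm h"
      by (simp add: harm_def divide_inverse)
    have "(\<Sum>p\<in>S. 1 / real (snd p)) = (\<Sum>i\<in>snd ` S. 1 / real i)"
      by (subst sum.reindex) (auto simp: inj_on_def S_def)
    also have "\<dots> \<le> (\<Sum>i = 1..h. 1 / real i)"
      by (rule sum_mono2) (auto simp: S_def)
    finally show "(\<Sum>p\<in>S. 1 / real (snd p)) \<le> harm h"
      by (simp add: harm_def divide_inverse)
  qed simp
  finally show "log_square_coeff N h \<le> 2 * harm h / h" by simp
qed

text \<open>For \<open>L = 2 * N\<close> the sum is the mean over the circle of the fourth power of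
  \<open>cmod (log_partial N w)\<close>, so the bound has to be uniform in \<open>N\<close>. The
  coefficients are of order ln h / h, and \<open>ln h \<le> 4 * h powr (1 / 4)\<close> leaves a
  summable h^(-3/2).\<close>

lemma sum_log_square_coeff_squared: "\<exists>K. \<forall>N L. (\<Sum>h = 1..L. (log_square_coeff N h)\<^sup>2) \<le> K"
proof -
  define f where "f h = 100 * real h powr (- 3 / 2)" for h
  have "summable f"
    unfolding f_def by (intro summable_mult) (simp add: summable_real_powr_iff)
  have le: "(log_square_coeff N h)\<^sup>2 \<le> f h" if h: "h \<ge> 1" for N h
  proof -
    have "ln (real h) \<le> real h powr (1 / 4) / (1 / 4)"
      using h by (intro ln_powr_bound) auto
    moreover have "1 \<le> real h powr (1 / 4)" using h by (simp add: ge_one_powr_ge_zero)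
    ultimately have "harm h \<le> 5 * real h powr (1 / 4)"
      using harm_le_ln[OF h] by simp
    then have "2 * harm h / h \<le> 10 * real h powr (1 / 4) / h"
      using h by (intro divide_right_mono) auto
    then have "(log_square_coeff N h)\<^sup>2 \<le> (10 * real h powr (1 / 4) / h)\<^sup>2"
      using log_square_coeff_bounds[OF h, of N] by (intro power_mono) auto
    also have "(real h powr (1 / 4))\<^sup>2 = real h powr (1 / 2)"
      using h by (simp add: powr_powr flip: powr_numeral)
    then have "(10 * real h powr (1 / 4) / h)\<^sup>2 = 100 * (real h powr (1 / 2) / real h powr 2)"
      using h by (simp add: power_divide power_mult_distrib)
    also have "\<dots> = f h"
      by (subst powr_diff[symmetric]) (simp add: f_def)
    finally show ?thesis .
  qed
  have "(\<Sum>h = 1..L. (log_square_coeff N h)\<^sup>2) \<le> suminf f" for N L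
  proof -
    have "(\<Sum>h = 1..L. (log_square_coeff N h)\<^sup>2) \<le> (\<Sum>h = 1..L. f h)"
      using le by (intro sum_mono) auto
    also have "\<dots> \<le> suminf f"
      by (intro sum_le_suminf \<open>summable f\<close>) (auto simp: f_def)
    finally show ?thesis .
  qed
  then show ?thesis by blast
qed

text \<open>A rate is required because the difference gets multiplied by \<open>M\<close>; a cutoff
  \<open>N \<ge> M\<close> then leaves a bounded error. The partial sums increase, and with 1 / N
  added they decrease.\<close>

lemma inverse_squares_partial: "\<bar>(\<Sum>k = 1..N. 1 / (real k)\<^sup>2) - pi\<^sup>2 / 6\<bar> \<le> 1 / N" if "N \<ge> 1"
proof -
  define s where "s n = (\<Sum>k = 1..n. 1 / (real k)\<^sup>2)" for n
  have "(\<lambda>n. \<Sum>k<n. 1 / (real k + 1)\<^sup>2) \<longlonglongrightarrow> pi\<^sup>2 / 6"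
    using inverse_squares_sums by (simp add: sums_def add.commute)
  moreover have "(\<Sum>k<n. 1 / (real k + 1)\<^sup>2) = s n" for n
    by (simp add: s_def sum.atLeast1_atMost_eq add.commute)
  ultimately have lim: "s \<longlonglongrightarrow> pi\<^sup>2 / 6" by simp
  have bd: "s N \<le> s (N + n) \<and> s (N + n) + 1 / real (N + n) \<le> s N + 1 / N" for n
  proof (induction n)
    case (Suc n)
    define a where "a = real (N + n)"
    have a: "a > 0" "real (N + Suc n) = a + 1" using that by (simp_all add: a_def)
    have "s (N + Suc n) = s (N + n) + 1 / (a + 1)\<^sup>2"
      using a by (simp add: s_def a_def)
    moreover have "1 / (a + 1)\<^sup>2 + 1 / (a + 1) \<le> 1 / a"
    proof -
      have "1 / (a + 1)\<^sup>2 \<le> 1 / (a * (a + 1))"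
        using a by (intro divide_left_mono) (auto simp: power2_eq_square)
      also have "\<dots> = 1 / a - 1 / (a + 1)" using a by (simp add: field_simps)
      finally show ?thesis by simp
    qed
    ultimately show ?case
      using Suc.IH a by (simp add: a_def[symmetric] del: of_nat_add of_nat_Suc)
        (smt (verit) divide_nonneg_nonneg zero_le_power2)
  qed simp
  have lim': "(\<lambda>n. s (N + n)) \<longlonglongrightarrow> pi\<^sup>2 / 6"
    using LIMSEQ_ignore_initial_segment[OF lim, of N] by (simp add: add.commute)
  have "s N \<le> pi\<^sup>2 / 6"
    using bd by (intro LIMSEQ_le_const[OF lim']) auto
  moreover have "s (N + n) \<le> s N + 1 / N" for n
    using bd[of n] by (smt (verit) divide_nonneg_nonneg of_nat_0_le_iff)
  then have "pi\<^sup>2 / 6 \<le> s N + 1 / N"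
    by (intro LIMSEQ_le_const2[OF lim']) auto
  ultimately show ?thesis by (simp add: s_def abs_le_iff)
qed

context diophantine
begin

lemma weighted_exp_sum_nonneg: "0 \<le> weighted_exp_sum x M N"
  unfolding weighted_exp_sum_def by (intro sum_nonneg) auto

lemma weighted_exp_sum_mono: "N \<le> N' \<Longrightarrow> weighted_exp_sum x M N \<le> weighted_exp_sum x M N'"
  unfolding weighted_exp_sum_def by (intro sum_mono2) auto

text \<open>It matters that the frequencies start at \<open>k = 1\<close>: a constant term would
  contribute a multiple of \<open>M\<close>.\<close>

lemma norm_sum_trig_poly_le:
  fixes d :: "nat \<Rightarrow> complex"
  assumes a: "\<And>k. k \<in> {1..N} \<Longrightarrow> cmod (d k) \<le> a / k"
  shows "cmod (\<Sum>m = 1..M. \<Sum>k = 1..N. d k * (x ^ m) ^ k) \<le> a * weighted_exp_sum x M N"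
proof -
  have "(\<Sum>m = 1..M. \<Sum>k = 1..N. d k * (x ^ m) ^ k) = (\<Sum>k = 1..N. d k * exp_sum x k M)"
    unfolding exp_sum_def sum_distrib_left
    by (subst sum.swap) (simp add: mult.commute flip: power_mult)
  also have "cmod \<dots> \<le> (\<Sum>k = 1..N. a * (cmod (exp_sum x k M) / k))"
  proof (rule sum_norm_le)
    fix k assume "k \<in> {1..N}"
    then have "cmod (d k) * cmod (exp_sum x k M) \<le> a / k * cmod (exp_sum x k M)"
      by (intro mult_right_mono a) auto
    then show "cmod (d k * exp_sum x k M) \<le> a * (cmod (exp_sum x k M) / k)"
      by (simp add: norm_mult)
  qed
  also have "\<dots> = a * weighted_exp_sum x M N"
    by (simp add: weighted_exp_sum_def sum_distrib_left)
  finally show ?thesis .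
qed

text \<open>Orthogonality up to exponential sums. A pair k < l has frequency l - k and coefficient
  at most a^2 / (k l) \<le> a^2 / (k (l - k)), so the off-diagonal part factors into
  \<open>harm N\<close> and the weighted sum. The factor 2 accounts for the pairs with k >
  l.\<close>

lemma trig_poly_mean_square:
  fixes d :: "nat \<Rightarrow> complex"
  assumes a: "\<And>k. k \<in> {1..N} \<Longrightarrow> cmod (d k) \<le> a / k" and "a \<ge> 0"
  shows "\<bar>(\<Sum>m = 1..M. (cmod (\<Sum>k = 1..N. d k * (x ^ m) ^ k))\<^sup>2) - M * (\<Sum>k = 1..N. (cmod (d k))\<^sup>2)\<bar>
    \<le> 2 * a\<^sup>2 * harm N * weighted_exp_sum x M N"
proof -
  define b where "b k l = (\<Sum>m = 1..M. (x ^ m) ^ k * cnj ((x ^ m) ^ l))" for k l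
  define W where "W = weighted_exp_sum x M N"
  define v where "v k l = (if k < l then a\<^sup>2 / real k * (cmod (exp_sum x (l - k) M) / real (l - k)) else 0)"
    for k l :: nat
  have unit: "y * cnj y = 1" if "cmod y = 1" for y
    using that by (metis complex_norm_square of_real_1 power_one)
  have bkk: "b k k = of_nat M" for k
    unfolding b_def by (subst unit) (auto simp: norm_power)
  have b_sym: "cmod (b l k) = cmod (b k l)" for k l
  proof -
    have "b l k = cnj (b k l)" by (simp add: b_def mult.commute)
    then show ?thesis by simp
  qed
  have b_less: "cmod (b k l) = cmod (exp_sum x (l - k) M)" if "k < l" for k l
  proof -
    have "(x ^ m) ^ l * cnj ((x ^ m) ^ k) = x ^ ((l - k) * m)" for m
    proof -
      have "(x ^ m) ^ l = (x ^ m) ^ (l - k) * (x ^ m) ^ k" using that by (simp flip: power_add)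
      then show ?thesis
        using unit[of "(x ^ m) ^ k"] by (simp add: norm_power mult.assoc mult.commute[of _ m] power_mult)
    qed
    then have "b l k = exp_sum x (l - k) M" by (simp add: b_def exp_sum_def)
    then show ?thesis using b_sym[of k l] by simp
  qed
  have "of_real (\<Sum>m = 1..M. (cmod (\<Sum>k = 1..N. d k * (x ^ m) ^ k))\<^sup>2) =
      (\<Sum>m = 1..M. \<Sum>k = 1..N. \<Sum>l = 1..N. d k * cnj (d l) * ((x ^ m) ^ k * cnj ((x ^ m) ^ l)))"
    unfolding of_real_sum complex_norm_square cnj_sum sum_product
    by (intro sum.cong refl) (simp add: mult_ac)
  also have "\<dots> = (\<Sum>k = 1..N. \<Sum>m = 1..M. \<Sum>l = 1..N. d k * cnj (d l) * ((x ^ m) ^ k * cnj ((x ^ m) ^ l)))"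
    by (rule sum.swap)
  also have "\<dots> = (\<Sum>k = 1..N. \<Sum>l = 1..N. \<Sum>m = 1..M. d k * cnj (d l) * ((x ^ m) ^ k * cnj ((x ^ m) ^ l)))"
    by (intro sum.cong refl sum.swap)
  also have "\<dots> = (\<Sum>k = 1..N. \<Sum>l = 1..N. d k * cnj (d l) * b k l)"
    by (simp add: b_def sum_distrib_left)
  finally have sq: "of_real (\<Sum>m = 1..M. (cmod (\<Sum>k = 1..N. d k * (x ^ m) ^ k))\<^sup>2) =
      (\<Sum>k = 1..N. \<Sum>l = 1..N. d k * cnj (d l) * b k l)" .
  have "of_real (M * (\<Sum>k = 1..N. (cmod (d k))\<^sup>2)) = (\<Sum>k = 1..N. d k * cnj (d k) * b k k)"
    unfolding bkk of_real_mult of_real_sum complex_norm_square by (simp add: sum_distrib_left mult_ac)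
  also have "\<dots> = (\<Sum>k = 1..N. \<Sum>l = 1..N. if k = l then d k * cnj (d l) * b k l else 0)"
    by (intro sum.cong refl) simp
  finally have "complex_of_real ((\<Sum>m = 1..M. (cmod (\<Sum>k = 1..N. d k * (x ^ m) ^ k))\<^sup>2) -
        M * (\<Sum>k = 1..N. (cmod (d k))\<^sup>2)) =
      (\<Sum>k = 1..N. \<Sum>l = 1..N. d k * cnj (d l) * b k l) -
      (\<Sum>k = 1..N. \<Sum>l = 1..N. if k = l then d k * cnj (d l) * b k l else 0)"
    unfolding of_real_diff sq by simp
  also have "\<dots> = (\<Sum>k = 1..N. \<Sum>l = 1..N. if k = l then 0 else d k * cnj (d l) * b k l)"
    unfolding sum_subtractf[symmetric] by (intro sum.cong refl) simp
  finally have "cmod (complex_of_real ((\<Sum>m = 1..M. (cmod (\<Sum>k = 1..N. d k * (x ^ m) ^ k))\<^sup>2) -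
        M * (\<Sum>k = 1..N. (cmod (d k))\<^sup>2))) =
      cmod (\<Sum>k = 1..N. \<Sum>l = 1..N. if k = l then 0 else d k * cnj (d l) * b k l)"
    by (rule arg_cong)
  also have "\<dots> \<le> (\<Sum>k = 1..N. \<Sum>l = 1..N. v k l + v l k)"
  proof (intro sum_norm_le)
    fix k l assume k: "k \<in> {1..N}" and l: "l \<in> {1..N}"
    have dd: "cmod (d k) * cmod (d l) \<le> a / k * (a / l)"
      using k l a[OF k] a[OF l] \<open>a \<ge> 0\<close> by (intro mult_mono) auto
    have *: "cmod (d k) * cmod (d l) * cmod (b i j) \<le> v i j"
      if "i < j" "(i = k \<and> j = l) \<or> (i = l \<and> j = k)" for i j
    proof -
      have ij: "i \<ge> 1" "real (j - i) \<le> real j" "real (j - i) > 0" using that k l by auto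
      have "cmod (d k) * cmod (d l) * cmod (b i j) \<le> a / i * (a / j) * cmod (b i j)"
        using dd that by (intro mult_right_mono) (auto simp: mult.commute)
      also have "\<dots> \<le> a / i * (a / real (j - i)) * cmod (b i j)"
        using ij \<open>a \<ge> 0\<close> by (intro mult_right_mono mult_left_mono divide_left_mono) auto
      also have "\<dots> = v i j"
        using that by (simp add: v_def b_less power2_eq_square)
      finally show ?thesis .
    qed
    have v0: "v i j \<ge> 0" for i j by (simp add: v_def)
    show "cmod (if k = l then 0 else d k * cnj (d l) * b k l) \<le> v k l + v l k"
    proof (cases k l rule: linorder_cases)
      case less
      then show ?thesis using *[of k l] v0[of l k] by (simp add: norm_mult)
    next
      case equal
      then show ?thesis using v0 by simp
    next
      case greater
      then show ?thesis using *[of l k] v0[of k l] b_sym[of k l] by (simp add: norm_mult)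
    qed
  qed
  also have "\<dots> = 2 * (\<Sum>k = 1..N. \<Sum>l = 1..N. v k l)"
    using sum.swap[of "\<lambda>k l. v l k" "{1..N}" "{1..N}"] by (simp add: sum.distrib)
  also have "\<dots> \<le> 2 * (\<Sum>k = 1..N. a\<^sup>2 / k * W)"
  proof (intro mult_left_mono sum_mono)
    fix k assume k: "k \<in> {1..N}"
    have "(\<Sum>l = 1..N. v k l) = (\<Sum>l = k + 1..N. v k l)"
      by (rule sum.mono_neutral_right) (use k in \<open>auto simp: v_def\<close>)
    also have "\<dots> = (\<Sum>h = 1..N - k. a\<^sup>2 / k * (cmod (exp_sum x h M) / h))"
      by (rule sum.reindex_bij_witness[where i = "\<lambda>h. h + k" and j = "\<lambda>l. l - k"]) (auto simp: v_def)
    also have "\<dots> \<le> (\<Sum>h = 1..N. a\<^sup>2 / k * (cmod (exp_sum x h M) / h))"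
      by (rule sum_mono2) auto
    also have "\<dots> = a\<^sup>2 / k * W"
      by (simp add: W_def weighted_exp_sum_def sum_distrib_left)
    finally show "(\<Sum>l = 1..N. v k l) \<le> a\<^sup>2 / k * W" .
  qed simp
  also have "\<dots> = 2 * a\<^sup>2 * harm N * W"
    by (simp add: harm_def sum_distrib_left sum_distrib_right divide_inverse mult_ac)
  finally show ?thesis unfolding W_def norm_of_real .
qed

end

section \<open>Logarithmic averages\<close>

text \<open>Summation by parts, from 1 / m = 1 / (n + 1) + Sum 1 / (j (j + 1)) over m \<le> j \<le>
  n.\<close>

lemma abel_sum:
  fixes b :: "nat \<Rightarrow> 'a::real_normed_vector"
  shows "(\<Sum>m = 1..n. b m /\<^sub>R m) = (\<Sum>m = 1..n. b m) /\<^sub>R Suc n +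
    (\<Sum>m = 1..n. (\<Sum>i = 1..m. b i) /\<^sub>R (real m * real (Suc m)))"
proof (induction n)
  case (Suc n)
  define S where "S = (\<Sum>m = 1..n. b m)"
  define y where "y = b (Suc n)"
  define u where "u = real (Suc n)"
  have u: "u > 0" "real (Suc (Suc n)) = u + 1" by (simp_all add: u_def)
  have c: "inverse u = inverse (u + 1) + inverse (u * (u + 1))"
    unfolding inverse_mult_distrib using inverse_diff_inverse[of u "u + 1"] u(1) by simp
  have "S /\<^sub>R u + y /\<^sub>R u = (S + y) /\<^sub>R (u + 1) + (S + y) /\<^sub>R (u * (u + 1))"
    unfolding c by (simp add: scaleR_add_left scaleR_add_right)
  then show ?case
    using Suc.IH by (simp add: S_def y_def[symmetric] u_def[symmetric] u(2) del: of_nat_Suc)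
qed simp

text \<open>A power saving in the partial sums makes the series in \<open>abel_sum\<close>
  absolutely convergent. The averages are then bounded, hence negligible against the
  \<open>ln n\<close> of the normalisation.\<close>

lemma bounded_log_average:
  fixes b :: "nat \<Rightarrow> 'a::real_normed_vector"
  assumes "\<eta> > 0" and S: "\<And>M. M \<ge> 1 \<Longrightarrow> norm (\<Sum>m = 1..M. b m) \<le> C * real M powr (1 - \<eta>)"
  shows "\<exists>C'. \<forall>n. norm (\<Sum>m = 1..n. b m /\<^sub>R m) \<le> C'"
proof -
  define f where "f m = C * real m powr (- 1 - \<eta>)" for m
  have "summable f"
    unfolding f_def using assms(1) by (intro summable_mult) (simp add: summable_real_powr_iff)
  have "norm (b 1) \<le> C" using S[of 1] by simp
  then have C: "C \<ge> 0" using norm_ge_zero[of "b 1"] by linarith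
  have pw: "real M powr (1 - \<eta>) = real M * real M powr (- \<eta>)" if "M \<ge> 1" for M
    using that by (simp add: powr_diff powr_minus divide_inverse)
  have le1: "norm ((\<Sum>m = 1..n. b m) /\<^sub>R Suc n) \<le> C" for n
  proof (cases "n = 0")
    case False
    have "real n powr (- \<eta>) \<le> real n powr 0" using False assms(1) by (intro powr_mono) auto
    then have "real n * real n powr (- \<eta>) \<le> real (Suc n)" using False by simp
        (smt (verit) mult_left_le of_nat_0_le_iff)
    then have "C * real n powr (1 - \<eta>) \<le> C * real (Suc n)"
      using False C by (subst pw) (auto intro!: mult_left_mono)
    then have "norm (\<Sum>m = 1..n. b m) \<le> C * real (Suc n)"
      using S[of n] False by simp
    then show ?thesis by (simp add: field_simps)
  qed (use C in simp)
  have le2: "norm ((\<Sum>i = 1..m. b i) /\<^sub>R (real m * real (Suc m))) \<le> f m" if "m \<ge> 1" for m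
  proof -
    have "norm ((\<Sum>i = 1..m. b i) /\<^sub>R (real m * real (Suc m))) = norm (\<Sum>i = 1..m. b i) / (real m * real (Suc m))"
      by (simp add: divide_inverse)
    also have "\<dots> \<le> C * real m powr (1 - \<eta>) / (real m * real m)"
      using S[OF that] that C by (intro frac_le mult_left_mono) auto
    also have "\<dots> = f m"
      using that by (simp add: f_def pw powr_diff powr_minus field_simps)
    finally show ?thesis .
  qed
  have "norm (\<Sum>m = 1..n. b m /\<^sub>R m) \<le> C + suminf f" for n
  proof -
    have "norm (\<Sum>m = 1..n. b m /\<^sub>R m) \<le> C + (\<Sum>m = 1..n. f m)"
      unfolding abel_sum by (intro order_trans[OF norm_triangle_ineq] add_mono le1 sum_norm_le le2) auto
    also have "(\<Sum>m = 1..n. f m) \<le> suminf f"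
      using C by (intro sum_le_suminf \<open>summable f\<close>) (auto simp: f_def)
    finally show ?thesis by simp
  qed
  then show ?thesis by blast
qed

text \<open>For the fourth powers, which have no cancellation: linear growth of the partial sums
  costs a factor \<open>ln n\<close>.\<close>

lemma log_average_le:
  fixes b :: "nat \<Rightarrow> real"
  assumes S: "\<And>M. M \<ge> 1 \<Longrightarrow> (\<Sum>m = 1..M. b m) \<le> C * M" and "C \<ge> 0" and n: "n \<ge> 1"
  shows "(\<Sum>m = 1..n. b m / m) \<le> C * (2 + ln (real n))"
proof -
  have "(\<Sum>m = 1..n. b m / m) = (\<Sum>m = 1..n. b m) / Suc n + (\<Sum>m = 1..n. (\<Sum>i = 1..m. b i) / (real m * real (Suc m)))"
    using abel_sum[of b n] by (simp add: divide_inverse mult.commute)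
  also have "\<dots> \<le> C + (\<Sum>m = 1..n. C * inverse (real m))"
  proof (intro add_mono sum_mono)
    have "C * real n \<le> C * real (Suc n)" using \<open>C \<ge> 0\<close> by (intro mult_left_mono) auto
    then show "(\<Sum>m = 1..n. b m) / Suc n \<le> C"
      using S[OF n] by (simp add: field_simps)
    fix m assume m: "m \<in> {1..n}"
    have "(\<Sum>i = 1..m. b i) / (real m * real (Suc m)) \<le> C * real m / (real m * real (Suc m))"
      using S[of m] m by (intro divide_right_mono) auto
    also have "\<dots> = C / real (Suc m)" using m by simp
    also have "\<dots> \<le> C / real m" using m \<open>C \<ge> 0\<close> by (intro divide_left_mono) auto
    finally show "(\<Sum>i = 1..m. b i) / (real m * real (Suc m)) \<le> C * inverse (real m)"
      by (simp add: divide_inverse)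
  qed
  also have "\<dots> = C * (1 + harm n)"
    by (simp add: harm_def sum_distrib_left distrib_left)
  also have "\<dots> \<le> C * (2 + ln (real n))"
    using harm_le_ln[OF n] \<open>C \<ge> 0\<close> by (intro mult_left_mono) auto
  finally show ?thesis .
qed

section \<open>Averages of the logarithms along the powers of \<open>x\<close>\<close>

context diophantine
begin

definition zlog :: "nat \<Rightarrow> complex" where "zlog m = Ln (1 - x ^ m)"

text \<open>For \<open>m \<le> M\<close> the remainder of the series after \<open>N\<close> terms is
  at most \<open>2 * M ^ g / (c * N)\<close>. This length makes it at most \<open>1 / M ^ 2\<close>,
  so even the sum over \<open>m\<close> is bounded, while the logarithm of the length is only of
  order ln M.\<close>

definition cutoff :: "nat \<Rightarrow> nat" where "cutoff M = Suc (nat \<lceil>2 / c\<rceil>) * M ^ (g + 2)"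

lemma cutoff_ge: "M \<ge> 1 \<Longrightarrow> M \<le> cutoff M"
proof -
  assume "M \<ge> 1"
  then have "M ^ 1 \<le> M ^ (g + 2)" by (intro power_increasing) auto
  then have "1 * M \<le> Suc (nat \<lceil>2 / c\<rceil>) * M ^ (g + 2)" by (intro mult_le_mono) auto
  then show ?thesis by (simp only: cutoff_def)
qed

lemma zlog_approx:
  assumes "m \<in> {1..M}"
  shows "cmod (zlog m + log_partial (cutoff M) (x ^ m)) \<le> 1 / (real M)\<^sup>2"
proof -
  have m: "m \<ge> 1" "real m \<le> real M" "real M > 0" using assms by auto
  define N where "N = cutoff M"
  have "2 / c \<le> real (Suc (nat \<lceil>2 / c\<rceil>))" by linarith
  then have "2 / c * real M ^ (g + 2) \<le> real (Suc (nat \<lceil>2 / c\<rceil>)) * real M ^ (g + 2)"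
    by (intro mult_right_mono) auto
  then have "2 / c * real M ^ (g + 2) \<le> real N"
    by (simp only: N_def cutoff_def of_nat_mult of_nat_power)
  then have N: "2 / c * real M ^ (g + 2) \<le> real (Suc N)" by simp
  have "cmod (zlog m + log_partial N (x ^ m)) \<le> 2 / (real (Suc N) * cmod (1 - x ^ m))"
    unfolding zlog_def using power_neq_1[OF m(1)] by (intro Ln_one_minus_approx) (auto simp: norm_power)
  also have "\<dots> \<le> 2 / (2 / c * real M ^ (g + 2) * (c / real M ^ g))"
  proof -
    have "c / real M ^ g \<le> c / real m ^ g"
      using m c_pos by (intro divide_left_mono power_mono mult_pos_pos) auto
    also have "\<dots> \<le> cmod (1 - x ^ m)" by (rule lower[OF m(1)])
    finally have "2 / c * real M ^ (g + 2) * (c / real M ^ g) \<le> real (Suc N) * cmod (1 - x ^ m)"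
      using N c_pos by (intro mult_mono) auto
    moreover have "2 / c * real M ^ (g + 2) * (c / real M ^ g) > 0" using c_pos m by simp
    ultimately show ?thesis by (intro frac_le) auto
  qed
  also have "2 / c * real M ^ (g + 2) * (c / real M ^ g) = 2 * (real M)\<^sup>2"
    using c_pos m by (simp add: power_add power2_eq_square)
  finally show ?thesis by (simp add: N_def)
qed

text \<open>The exponent is \<open>\<delta> / 8\<close> because \<open>zlog_sums\<close> meets the
  fourth power of this quantity and spends half of the saving \<open>\<delta>\<close> on it.\<close>

lemma cutoff_log_bound: "\<exists>C\<ge>1. \<forall>M\<ge>1. 1 + ln (real (2 * cutoff M)) \<le> C * real M powr (\<delta> / 8)"
proof -
  define D where "D = real (Suc (nat \<lceil>2 / c\<rceil>))"
  have D: "D \<ge> 1" by (simp add: D_def)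
  define C where "C = 1 + ln (2 * D) + real (g + 2) * (8 / \<delta>)"
  have "1 + ln (real (2 * cutoff M)) \<le> C * real M powr (\<delta> / 8)" if M: "M \<ge> 1" for M
  proof -
    have pw: "1 \<le> real M powr (\<delta> / 8)" using M \<delta>_bounds by (simp add: ge_one_powr_ge_zero)
    have "ln (real M) \<le> real M powr (\<delta> / 8) / (\<delta> / 8)"
      using M \<delta>_bounds by (intro ln_powr_bound) auto
    then have l: "real (g + 2) * ln (real M) \<le> real (g + 2) * (8 / \<delta> * real M powr (\<delta> / 8))"
      by (intro mult_left_mono) (auto simp: field_simps)
    have "real (2 * cutoff M) = (2 * D) * real M ^ (g + 2)"
      by (simp only: cutoff_def D_def of_nat_mult of_nat_power of_nat_numeral mult.assoc)
    then have "1 + ln (real (2 * cutoff M)) = (1 + ln (2 * D)) + real (g + 2) * ln (real M)"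
      using D M by (simp add: ln_mult ln_realpow del: power_Suc)
    also have "(1 + ln (2 * D)) * 1 \<le> (1 + ln (2 * D)) * real M powr (\<delta> / 8)"
      using pw D by (intro mult_left_mono) auto
    then have "(1 + ln (2 * D)) + real (g + 2) * ln (real M) \<le> C * real M powr (\<delta> / 8)"
      using l unfolding C_def by (simp add: algebra_simps)
    finally show ?thesis .
  qed
  moreover have "C \<ge> 1" using D \<delta>_bounds by (simp add: C_def)
  ultimately show ?thesis by blast
qed

text \<open>\<open>zlog m\<close> is replaced by \<open>- P m\<close>. As polynomials in
  \<open>x ^ m\<close>, \<open>P m\<close> and its square have no constant term, so their sums are
  small; the mean squares of \<open>P m\<close> and of its square give the two absolute moments. The
  range \<open>2 * cutoff M\<close> in \<open>W\<close> is the degree of the square.\<close>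

lemma zlog_sums_at:
  assumes M: "M \<ge> 1" and K: "\<And>N L. (\<Sum>h = 1..L. (log_square_coeff N h)\<^sup>2) \<le> K"
  defines "lam \<equiv> 1 + ln (real (2 * cutoff M))"
  defines "W \<equiv> weighted_exp_sum x M (2 * cutoff M)"
  defines "E \<equiv> 4 * lam + 8 * lam ^ 3 * W"
  shows "cmod (\<Sum>m = 1..M. zlog m) \<le> E"
    and "cmod (\<Sum>m = 1..M. (zlog m)\<^sup>2) \<le> E"
    and "\<bar>\<Sum>m = 1..M. (cmod (zlog m))\<^sup>2 - pi\<^sup>2 / 6\<bar> \<le> E"
    and "(\<Sum>m = 1..M. (cmod (zlog m)) ^ 4) \<le> 8 * ((1 + K) * M + E)"
proof -
  define N where "N = cutoff M"
  define P where "P m = log_partial N (x ^ m)" for m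
  have N: "N \<ge> M" "N \<ge> 1" "2 * N \<ge> 1" using cutoff_ge[OF M] M by (auto simp: N_def)
  have lam: "lam \<ge> 1" using N by (simp add: lam_def N_def[symmetric])
  have W: "W \<ge> 0" unfolding W_def by (rule weighted_exp_sum_nonneg)
  have WN: "weighted_exp_sum x M N \<le> W"
    unfolding W_def N_def by (rule weighted_exp_sum_mono) simp
  have h2N: "harm (2 * N) \<le> lam" unfolding lam_def N_def[symmetric] by (rule harm_le_ln[OF N(3)])
  have harm_le: "harm h \<le> lam" if "h \<le> 2 * N" for h
    using harm_mono[OF that] h2N order_trans by blast
  have lam_pow: "lam \<le> lam ^ 3" "lam ^ 2 \<le> lam ^ 3" "1 \<le> lam ^ 3"
    using lam power_increasing[of 1 3 lam] power_increasing[of 2 3 lam] by simp_all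
  have lamW: "lam * W \<le> lam ^ 3 * W" "W \<le> lam ^ 3 * W"
    using mult_right_mono[OF lam_pow(1) W] mult_right_mono[OF lam_pow(3) W] by simp_all
  have P: "cmod (P m) \<le> lam" for m
    unfolding P_def using norm_log_partial_le[of "x ^ m" N] harm_le[of N] by (simp add: norm_power)
  have M2: "0 < (real M)\<^sup>2" "1 / (real M)\<^sup>2 \<le> 1" using M by (auto simp: one_le_power)
  have s: "cmod (zlog m + P m) \<le> 1 / (real M)\<^sup>2" if "m \<in> {1..M}" for m
    unfolding P_def N_def by (rule zlog_approx[OF that])
  have zP: "cmod (zlog m) \<le> cmod (P m) + 1" if "m \<in> {1..M}" for m
  proof -
    have "cmod (zlog m + P m - P m) \<le> cmod (zlog m + P m) + cmod (P m)"
      by (rule norm_triangle_ineq4)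
    then show ?thesis using s[OF that] M2(2) unfolding add_diff_cancel_right' by linarith
  qed
  have small: "real M * (1 / (real M)\<^sup>2 * t) \<le> t" if "t \<ge> 0" for t
  proof -
    have "real M * (1 / (real M)\<^sup>2 * t) = t / real M" using M by (simp add: power2_eq_square)
    also have "\<dots> \<le> t / 1" using M that by (intro divide_left_mono) auto
    finally show ?thesis by simp
  qed
  \<comment> \<open>In the factorisation of the difference of squares, the sum is tiny and the
    difference is at most of order \<open>lam\<close>.\<close>
  have quad: "cmod ((zlog m)\<^sup>2 - (P m)\<^sup>2) \<le> 1 / (real M)\<^sup>2 * (3 * lam)" if m: "m \<in> {1..M}" for m
  proof -
    have "(zlog m)\<^sup>2 - (P m)\<^sup>2 = (zlog m + P m) * (zlog m - P m)"
      by (simp add: power2_eq_square algebra_simps)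
    moreover have "cmod (zlog m - P m) \<le> 3 * lam"
      using norm_triangle_ineq4[of "zlog m" "P m"] zP[OF m] P[of m] lam by simp
    ultimately show ?thesis
      using mult_mono[OF s[OF m] \<open>cmod (zlog m - P m) \<le> 3 * lam\<close>] by (simp only: norm_mult) simp
  qed
  have P_poly: "P m = (\<Sum>k = 1..N. (1 / of_nat k) * (x ^ m) ^ k)" for m
    by (simp add: P_def log_partial_def)
  have P2_poly: "(P m)\<^sup>2 = (\<Sum>h = 1..2 * N. of_real (log_square_coeff N h) * (x ^ m) ^ h)" for m
    unfolding P_def by (rule log_partial_square)
  have c2: "cmod (of_real (log_square_coeff N h)) \<le> 2 * lam / real h" if h: "h \<in> {1..2 * N}" for h
  proof -
    have "2 * harm h / real h \<le> 2 * lam / real h"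
      using harm_le[of h] h by (intro divide_right_mono) auto
    then show ?thesis
      using log_square_coeff_bounds[of h N] h by simp
  qed
  show "cmod (\<Sum>m = 1..M. zlog m) \<le> E"
  proof -
    have "cmod (\<Sum>m = 1..M. P m) \<le> 1 * weighted_exp_sum x M N"
      unfolding P_poly by (rule norm_sum_trig_poly_le) (simp add: norm_divide)
    moreover have "cmod (\<Sum>m = 1..M. zlog m + P m) \<le> (\<Sum>m = 1..M. 1 / (real M)\<^sup>2)"
      using s by (rule sum_norm_le)
    moreover have "(\<Sum>m = 1..M. 1 / (real M)\<^sup>2) \<le> 1"
      using small[of 1] by simp
    moreover have "(\<Sum>m = 1..M. zlog m) = (\<Sum>m = 1..M. zlog m + P m) - (\<Sum>m = 1..M. P m)"
      by (simp add: sum.distrib)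
    ultimately have "cmod (\<Sum>m = 1..M. zlog m) \<le> 1 + W"
      using WN norm_triangle_ineq4[of "\<Sum>m = 1..M. zlog m + P m" "\<Sum>m = 1..M. P m"] by simp
    also have "\<dots> \<le> E" using lam lamW W by (simp add: E_def)
    finally show ?thesis .
  qed
  show "cmod (\<Sum>m = 1..M. (zlog m)\<^sup>2) \<le> E"
  proof -
    have "cmod (\<Sum>m = 1..M. (P m)\<^sup>2) \<le> 2 * lam * W"
      unfolding P2_poly W_def N_def[symmetric] by (rule norm_sum_trig_poly_le[OF c2])
    moreover have "cmod (\<Sum>m = 1..M. (zlog m)\<^sup>2 - (P m)\<^sup>2) \<le> (\<Sum>m = 1..M. 1 / (real M)\<^sup>2 * (3 * lam))"
      using quad by (rule sum_norm_le)
    moreover have "(\<Sum>m = 1..M. 1 / (real M)\<^sup>2 * (3 * lam)) \<le> 3 * lam"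
      using small[of "3 * lam"] lam by simp
    moreover have "(\<Sum>m = 1..M. (zlog m)\<^sup>2) = (\<Sum>m = 1..M. (zlog m)\<^sup>2 - (P m)\<^sup>2) + (\<Sum>m = 1..M. (P m)\<^sup>2)"
      by (simp add: sum_subtractf)
    ultimately have "cmod (\<Sum>m = 1..M. (zlog m)\<^sup>2) \<le> 3 * lam + 2 * lam * W"
      using norm_triangle_ineq[of "\<Sum>m = 1..M. (zlog m)\<^sup>2 - (P m)\<^sup>2" "\<Sum>m = 1..M. (P m)\<^sup>2"] by simp
    also have "\<dots> \<le> E" using lam lamW W by (simp add: E_def)
    finally show ?thesis .
  qed
  show "\<bar>\<Sum>m = 1..M. (cmod (zlog m))\<^sup>2 - pi\<^sup>2 / 6\<bar> \<le> E"
  proof -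
    define T where "T = (\<Sum>k = 1..N. 1 / (real k)\<^sup>2)"
    have "\<bar>(\<Sum>m = 1..M. (cmod (P m))\<^sup>2) - M * (\<Sum>k = 1..N. (cmod (1 / of_nat k))\<^sup>2)\<bar>
        \<le> 2 * 1\<^sup>2 * harm N * weighted_exp_sum x M N"
      unfolding P_poly by (rule trig_poly_mean_square) (auto simp: norm_divide)
    also have "\<dots> \<le> 2 * 1\<^sup>2 * lam * W"
      using harm_le[of N] WN lam weighted_exp_sum_nonneg[of M N] by (intro mult_mono) (auto simp: harm_nonneg)
    finally have 1: "\<bar>(\<Sum>m = 1..M. (cmod (P m))\<^sup>2) - M * T\<bar> \<le> 2 * lam * W"
      by (simp add: T_def norm_divide power_divide)
    have "\<bar>T - pi\<^sup>2 / 6\<bar> \<le> 1 / N" unfolding T_def by (rule inverse_squares_partial[OF N(2)])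
    also have "\<dots> \<le> 1 / M" using N M by (intro divide_left_mono) auto
    finally have "\<bar>real M * (T - pi\<^sup>2 / 6)\<bar> \<le> 1"
      unfolding abs_mult using M by (simp add: field_simps)
    then have 2: "\<bar>M * T - M * (pi\<^sup>2 / 6)\<bar> \<le> 1"
      by (simp add: right_diff_distrib)
    have "\<bar>\<Sum>m = 1..M. (cmod (zlog m))\<^sup>2 - (cmod (P m))\<^sup>2\<bar> \<le> (\<Sum>m = 1..M. 1 / (real M)\<^sup>2 * (3 * lam))"
    proof (rule order_trans[OF sum_abs sum_mono])
      fix m assume m: "m \<in> {1..M}"
      have "\<bar>(cmod (zlog m))\<^sup>2 - (cmod (P m))\<^sup>2\<bar> \<le> cmod ((zlog m)\<^sup>2 - (P m)\<^sup>2)"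
        using norm_triangle_ineq3[of "(zlog m)\<^sup>2" "(P m)\<^sup>2"] by (simp add: norm_power)
      then show "\<bar>(cmod (zlog m))\<^sup>2 - (cmod (P m))\<^sup>2\<bar> \<le> 1 / (real M)\<^sup>2 * (3 * lam)"
        using quad[OF m] by linarith
    qed
    moreover have "(\<Sum>m = 1..M. 1 / (real M)\<^sup>2 * (3 * lam)) \<le> 3 * lam"
      using small[of "3 * lam"] lam by simp
    ultimately have 3: "\<bar>(\<Sum>m = 1..M. (cmod (zlog m))\<^sup>2) - (\<Sum>m = 1..M. (cmod (P m))\<^sup>2)\<bar> \<le> 3 * lam"
      by (simp add: sum_subtractf)
    have "(\<Sum>m = 1..M. (cmod (zlog m))\<^sup>2 - pi\<^sup>2 / 6) = (\<Sum>m = 1..M. (cmod (zlog m))\<^sup>2) - M * (pi\<^sup>2 / 6)"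
      by (simp add: sum_subtractf)
    then have "\<bar>\<Sum>m = 1..M. (cmod (zlog m))\<^sup>2 - pi\<^sup>2 / 6\<bar> \<le> 3 * lam + 2 * lam * W + 1"
      using 1 2 3 by linarith
    also have "\<dots> \<le> E" using lam lamW W by (simp add: E_def)
    finally show ?thesis .
  qed
  show "(\<Sum>m = 1..M. (cmod (zlog m)) ^ 4) \<le> 8 * ((1 + K) * M + E)"
  proof -
    have "\<bar>(\<Sum>m = 1..M. (cmod ((P m)\<^sup>2))\<^sup>2) - M * (\<Sum>h = 1..2 * N. (cmod (of_real (log_square_coeff N h)))\<^sup>2)\<bar>
        \<le> 2 * (2 * lam)\<^sup>2 * harm (2 * N) * weighted_exp_sum x M (2 * N)"
      unfolding P2_poly by (rule trig_poly_mean_square[OF c2]) (use lam in auto)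
    also have "\<dots> \<le> 2 * (2 * lam)\<^sup>2 * lam * W"
      unfolding W_def N_def[symmetric] using h2N weighted_exp_sum_nonneg[of M "2 * N"]
      by (intro mult_right_mono mult_left_mono) auto
    also have "\<dots> = 8 * lam ^ 3 * W" by (simp add: power2_eq_square power3_eq_cube)
    finally have "(\<Sum>m = 1..M. (cmod ((P m)\<^sup>2))\<^sup>2) \<le> M * (\<Sum>h = 1..2 * N. (log_square_coeff N h)\<^sup>2) + 8 * lam ^ 3 * W"
      by simp
    also have "M * (\<Sum>h = 1..2 * N. (log_square_coeff N h)\<^sup>2) \<le> M * K"
      by (intro mult_left_mono K) auto
    finally have P4: "(\<Sum>m = 1..M. (cmod (P m)) ^ 4) \<le> M * K + 8 * lam ^ 3 * W"
      by (simp add: norm_power flip: power_mult)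
    have "(\<Sum>m = 1..M. (cmod (zlog m)) ^ 4) \<le> (\<Sum>m = 1..M. 8 * ((cmod (P m)) ^ 4 + 1))"
    proof (rule sum_mono)
      fix m assume m: "m \<in> {1..M}"
      define p where "p = cmod (P m)"
      \<comment> \<open>The constant 8 comes from (u + 1)^2 \<le> 2 (u^2 + 1), applied to u = p and,
        after squaring, to u = p^2.\<close>
      have "(p + 1)\<^sup>2 \<le> 2 * (p\<^sup>2 + 1)"
        using sum_squares_ge_zero[of "p - 1" 0] by (simp add: power2_eq_square algebra_simps)
      then have "((p + 1)\<^sup>2)\<^sup>2 \<le> (2 * (p\<^sup>2 + 1))\<^sup>2" by (intro power_mono) auto
      also have "\<dots> \<le> 8 * ((p\<^sup>2)\<^sup>2 + 1)"
      proof -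
        have "(p\<^sup>2 + 1)\<^sup>2 \<le> 2 * ((p\<^sup>2)\<^sup>2 + 1)"
        using sum_squares_ge_zero[of "p\<^sup>2 - 1" 0] by (simp add: power2_eq_square algebra_simps)
      then have "4 * (p\<^sup>2 + 1)\<^sup>2 \<le> 8 * ((p\<^sup>2)\<^sup>2 + 1)" by linarith
      moreover have "(2 * (p\<^sup>2 + 1))\<^sup>2 = 4 * (p\<^sup>2 + 1)\<^sup>2" by (subst power_mult_distrib) simp
      ultimately show ?thesis by linarith
      qed
      finally have "(p + 1) ^ 4 \<le> 8 * (p ^ 4 + 1)" by (simp flip: power_mult)
      moreover have "cmod (zlog m) ^ 4 \<le> (p + 1) ^ 4"
        using zP[OF m] by (intro power_mono) (auto simp: p_def)
      ultimately show "cmod (zlog m) ^ 4 \<le> 8 * ((cmod (P m)) ^ 4 + 1)" unfolding p_def by linarith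
    qed
    also have "\<dots> = 8 * ((\<Sum>m = 1..M. (cmod (P m)) ^ 4) + M)"
      by (simp add: sum.distrib flip: sum_distrib_left)
    also have "\<dots> \<le> 8 * ((1 + K) * M + E)"
      using P4 lam by (simp add: E_def algebra_simps)
    finally show ?thesis .
  qed
qed

theorem zlog_sums:
  obtains \<eta> C where "\<eta> > 0" "C \<ge> 0"
    "\<And>M. M \<ge> 1 \<Longrightarrow> cmod (\<Sum>m = 1..M. zlog m) \<le> C * real M powr (1 - \<eta>)"
    "\<And>M. M \<ge> 1 \<Longrightarrow> cmod (\<Sum>m = 1..M. (zlog m)\<^sup>2) \<le> C * real M powr (1 - \<eta>)"
    "\<And>M. M \<ge> 1 \<Longrightarrow> \<bar>\<Sum>m = 1..M. (cmod (zlog m))\<^sup>2 - pi\<^sup>2 / 6\<bar> \<le> C * real M powr (1 - \<eta>)"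
    "\<And>M. M \<ge> 1 \<Longrightarrow> (\<Sum>m = 1..M. (cmod (zlog m)) ^ 4) \<le> C * M"
proof -
  obtain K where K: "\<And>N L. (\<Sum>h = 1..L. (log_square_coeff N h)\<^sup>2) \<le> K"
    using sum_log_square_coeff_squared by blast
  have K0: "K \<ge> 0" using K[of 0 0] by simp
  obtain C1 where C1: "C1 > 0"
    "\<And>M N. M \<ge> 1 \<Longrightarrow> N \<ge> 1 \<Longrightarrow> weighted_exp_sum x M N \<le> C1 * real M powr (1 - \<delta>) * (1 + ln (real N))"
    using weighted_exp_sum_bound by blast
  obtain C2 where C2: "C2 \<ge> 1" "\<And>M. M \<ge> 1 \<Longrightarrow> 1 + ln (real (2 * cutoff M)) \<le> C2 * real M powr (\<delta> / 8)"
    using cutoff_log_bound by blast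
  define C3 where "C3 = (4 + 8 * C1) * C2 ^ 4"
  have C3: "C3 \<ge> 0" using C1 C2 by (simp add: C3_def)
  define E where "E M = 4 * (1 + ln (real (2 * cutoff M))) +
    8 * (1 + ln (real (2 * cutoff M))) ^ 3 * weighted_exp_sum x M (2 * cutoff M)" for M
  have E: "E M \<le> C3 * real M powr (1 - \<delta> / 2)" if M: "M \<ge> 1" for M
  proof -
    define lam where "lam = 1 + ln (real (2 * cutoff M))"
    define R where "R = real M powr (1 - \<delta>)"
    define q where "q = real M powr (\<delta> / 8)"
    have N: "2 * cutoff M \<ge> 1" using cutoff_ge[OF M] M by simp
    have lam: "1 \<le> lam" "lam \<le> C2 * q" using N C2(2)[OF M] by (auto simp: lam_def q_def)
    have R: "R \<ge> 1" using M \<delta>_bounds by (simp add: R_def ge_one_powr_ge_zero)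
    have "lam * 1 \<le> lam ^ 4 * R"
      using lam R power_increasing[of 1 4 lam] by (intro mult_mono) auto
    moreover have "lam ^ 3 * weighted_exp_sum x M (2 * cutoff M) \<le> lam ^ 3 * (C1 * R * lam)"
      unfolding R_def lam_def using lam by (intro mult_left_mono C1(2) M N) (auto simp: lam_def)
    moreover have "lam ^ 3 * (C1 * R * lam) = C1 * (lam ^ 4 * R)"
      by (simp add: power_numeral_reduce)
    ultimately have "E M \<le> 4 * (lam ^ 4 * R) + 8 * (C1 * (lam ^ 4 * R))"
      unfolding E_def lam_def[symmetric] by linarith
    also have "\<dots> = (4 + 8 * C1) * (lam ^ 4 * R)" by (simp add: algebra_simps)
    also have "\<dots> \<le> (4 + 8 * C1) * ((C2 * q) ^ 4 * R)"
      using lam R C1 by (intro mult_left_mono mult_right_mono power_mono) auto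
    also have "\<dots> = C3 * (q ^ 4 * R)" by (simp add: C3_def power_mult_distrib)
    also have "q ^ 4 * R = real M powr (1 - \<delta> / 2)"
      using M by (simp add: q_def R_def powr_powr flip: powr_numeral powr_add)
    finally show ?thesis .
  qed
  define C where "C = 8 * (1 + K + C3)"
  have CC3: "C3 * t \<le> C * t" if "t \<ge> 0" for t
    using K0 C3 that by (intro mult_right_mono) (auto simp: C_def)
  note at = zlog_sums_at[OF _ K, folded E_def]
  show thesis
  proof (rule that[of "\<delta> / 2" C])
    show "\<delta> / 2 > 0" using \<delta>_bounds by simp
    show "C \<ge> 0" using K0 C3 by (simp add: C_def)
    fix M :: nat assume M: "M \<ge> 1"
    have EC: "E M \<le> C * real M powr (1 - \<delta> / 2)"
      using E[OF M] CC3[of "real M powr (1 - \<delta> / 2)"] by simp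
    show "cmod (\<Sum>m = 1..M. zlog m) \<le> C * real M powr (1 - \<delta> / 2)"
      "cmod (\<Sum>m = 1..M. (zlog m)\<^sup>2) \<le> C * real M powr (1 - \<delta> / 2)"
      "\<bar>\<Sum>m = 1..M. (cmod (zlog m))\<^sup>2 - pi\<^sup>2 / 6\<bar> \<le> C * real M powr (1 - \<delta> / 2)"
      using at(1-3)[OF M] EC by linarith+
    have "real M powr (1 - \<delta> / 2) \<le> real M powr 1"
      using M \<delta>_bounds by (intro powr_mono) auto
    then have "C3 * real M powr (1 - \<delta> / 2) \<le> C3 * M"
      using C3 M by (intro mult_left_mono) auto
    then have "8 * ((1 + K) * M + E M) \<le> C * M"
      using E[OF M] by (simp add: C_def algebra_simps)
    then show "(\<Sum>m = 1..M. (cmod (zlog m)) ^ 4) \<le> C * M"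
      using at(4)[OF M] by linarith
  qed
qed

end

subsection \<open>The limit theorem\<close>

text \<open>Up to pi / 3 the derivative cos u - 1 / 2 of the difference is nonnegative; beyond,
  already sin y \<ge> sqrt 3 / 2 \<ge> pi / 4.\<close>

lemma sin_ge_half:
  assumes "0 \<le> y" "y \<le> pi / 2"
  shows "y / 2 \<le> sin (y :: real)"
proof (cases "y \<le> pi / 3")
  case True
  have "(\<lambda>u. sin u - u / 2) 0 \<le> (\<lambda>u. sin u - u / 2) y"
  proof (rule DERIV_nonneg_imp_nondecreasing[OF assms(1)])
    fix u assume u: "0 \<le> u" "u \<le> y"
    have "cos (pi / 3) \<le> cos u"
      using u True by (intro cos_monotone_0_pi_le) auto
    then have "0 \<le> cos u - 1 / 2" by (simp add: cos_60)
    moreover have "((\<lambda>u. sin u - u / 2) has_real_derivative (cos u - 1 / 2)) (at u)"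
      by (auto intro!: derivative_eq_intros)
    ultimately show "\<exists>d. ((\<lambda>u. sin u - u / 2) has_real_derivative d) (at u) \<and> 0 \<le> d" by blast
  qed
  then show ?thesis by simp
next
  case False
  have "sqrt 3 / 2 = sin (pi / 3)" by (simp add: sin_60)
  also have "\<dots> \<le> sin y"
    using False assms by (intro sin_monotone_2pi_le) auto
  finally have "sqrt 3 / 2 \<le> sin y" .
  moreover have "pi / 2 \<le> sqrt 3"
  proof (rule real_le_rsqrt)
    have "(pi / 2)\<^sup>2 \<le> (16 / 10)\<^sup>2" using pi_approx by (intro power_mono) auto
    then show "(pi / 2)\<^sup>2 \<le> 3" by (simp add: power2_eq_square)
  qed
  ultimately show ?thesis using assms(2) by simp
qed

lemma norm_one_minus_cis: "cmod (1 - cis y) = 2 * \<bar>sin (y / 2)\<bar>"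
  using dist_exp_i_1[of y] by (simp add: cis_conv_exp norm_minus_commute)

text \<open>The chord over the angle 2 pi f has length 2 |sin (pi f)|, which only depends on the
  distance of f to the nearest integer; the crude bound on the sine leaves pi times that
  distance.\<close>

lemma torus_norm_le:
  assumes "0 \<le> f" "f < 1"
  shows "torus_norm f \<le> cmod (1 - cis (2 * pi * f))"
proof -
  define u where "u = torus_norm f"
  have u: "0 \<le> u" "u \<le> 1 / 2" using assms by (auto simp: u_def torus_norm_def min_def)
  have "sin (pi * f) = sin (pi * u)"
  proof (cases "f \<le> 1 - f")
    case False
    then have "pi * u = pi - pi * f" by (simp add: u_def torus_norm_def min_def algebra_simps)
    then show ?thesis by simp
  qed (simp add: u_def torus_norm_def min_def)
  then have eq: "cmod (1 - cis (2 * pi * f)) = 2 * \<bar>sin (pi * u)\<bar>"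
    by (simp add: norm_one_minus_cis)
  have "u * 1 \<le> u * pi" using u pi_gt3 by (intro mult_left_mono) auto
  moreover have "pi * u / 2 \<le> sin (pi * u)" using u by (intro sin_ge_half) auto
  ultimately show ?thesis unfolding eq u_def[symmetric] by (simp add: mult.commute)
qed

lemma finite_type_imp_diophantine:
  assumes "cmod x = 1" "finite_type x"
  shows "\<exists>c g. diophantine x c g"
proof -
  obtain t K \<gamma> where t: "x = exp (2 * of_real pi * \<i> * of_real t)" and K: "K > 0" "\<gamma> > 0"
    and ft: "\<And>m::int. m \<noteq> 0 \<Longrightarrow> torus_norm (frac (of_int m * t)) > K / \<bar>of_int m\<bar> powr \<gamma>"
    using assms(2) unfolding finite_type_def by blast
  \<comment> \<open>Rounding the exponent up only weakens the lower bound, as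
    \<open>k \<ge> 1\<close>; the successor makes \<open>g\<close> positive.\<close>
  define g where "g = Suc (nat \<lceil>\<gamma>\<rceil>)"
  have g: "\<gamma> \<le> real g" unfolding g_def by linarith
  have "diophantine x K g"
  proof
    fix k :: nat assume k: "k \<ge> 1"
    define f where "f = frac (real k * t)"
    have "real k powr \<gamma> \<le> real k powr real g" using k g by (intro powr_mono) auto
    also have "\<dots> = real k ^ g" using k by (simp add: powr_realpow)
    finally have "K / real k ^ g \<le> K / real k powr \<gamma>"
      using K k by (intro divide_left_mono) auto
    also have "\<dots> \<le> torus_norm f" using ft[of "int k"] k by (simp add: f_def)
    also have "\<dots> \<le> cmod (1 - cis (2 * pi * f))"
      by (rule torus_norm_le) (auto simp: f_def frac_lt_1)
    also have "cis (2 * pi * f) = x ^ k"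
    proof -
      have "x ^ k = cis (2 * pi * (real k * t))"
        unfolding t by (simp add: cis_conv_exp mult_ac flip: exp_of_nat_mult)
      also have "real k * t = f + of_int \<lfloor>real k * t\<rfloor>" by (simp add: f_def frac_def)
      also have "cis (2 * pi * (f + of_int \<lfloor>real k * t\<rfloor>)) = cis (2 * pi * f)"
        by (simp add: distrib_left cis_mult[symmetric])
      finally show ?thesis by simp
    qed
    finally show "cmod (1 - x ^ k) \<ge> K / real k ^ g" .
  qed (use assms K in \<open>auto simp: g_def\<close>)
  then show ?thesis by blast
qed

section \<open>The characteristic function of the normalised logarithm\<close>

lemma norm_cis_minus_one_le: "cmod (cis u - 1) \<le> \<bar>u\<bar>"
  using norm_one_minus_cis[of u] abs_sin_x_le_abs_x[of "u / 2"] by (simp add: norm_minus_commute)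

lemma cis_taylor: "cmod (cis u - 1 - \<i> * u + u\<^sup>2 / 2) \<le> \<bar>u\<bar> ^ 3"
proof -
  have "cmod (cis u - (\<Sum>k\<le>2. (\<i> * u) ^ k / fact k)) \<le> \<bar>u\<bar> ^ Suc 2 / fact (Suc 2)"
    unfolding cis_conv_exp by (rule iexp_approx1)
  also have "\<dots> \<le> \<bar>u\<bar> ^ 3 / 1" by (intro frac_le) (auto simp: eval_nat_numeral)
  also have "(\<Sum>k\<le>2. (\<i> * u) ^ k / fact k) = 1 + \<i> * u - u\<^sup>2 / 2"
    by (simp add: numeral_2_eq_2 power2_eq_square algebra_simps)
  finally show ?thesis by (simp add: algebra_simps)
qed

text \<open>Taylor expansion of \<open>cis\<close> turns the Poisson exponent into \<i> \<tau> A -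
  \<tau>^2 B / 2, up to an error of order \<tau>^3 ln n. \<open>A\<close> is bounded, so its term
  vanishes in the limit; \<open>B\<close> is |w|^2 (pi^2 / 12) ln n up to a bounded error, which
  \<tau>^2 normalises to |w|^2; and \<tau>^3 ln n is of order 1 / sqrt (ln n).\<close>

lemma (in diophantine) cycle_weight_char_tendsto:
  fixes s t :: real
  defines "a \<equiv> \<lambda>m. s * Re (zlog m) + t * Im (zlog m)"
  defines "\<tau> \<equiv> \<lambda>n. 1 / sqrt (pi\<^sup>2 / 12 * ln (real n))"
  shows "(\<lambda>n. cycle_weight (\<lambda>m. cis (\<tau> n * a m)) n) \<longlonglongrightarrow> of_real (exp (- (s\<^sup>2 + t\<^sup>2) / 2))"
proof -
  define w where "w = Complex s t"
  have a: "a m = Re (cnj w * zlog m)" for m by (simp add: a_def w_def)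
  \<comment> \<open>(Re u)^2 = (|u|^2 + Re (u^2)) / 2 for \<open>u = cnj w * zlog m\<close>: the
    first part carries the variance, the second averages out.\<close>
  have a_sq: "(a m)\<^sup>2 = ((cmod w)\<^sup>2 * (cmod (zlog m))\<^sup>2 + Re ((cnj w)\<^sup>2 * (zlog m)\<^sup>2)) / 2" for m
    unfolding a_def w_def cmod_power2 by (simp add: power2_eq_square algebra_simps)
  have a_le: "\<bar>a m\<bar> \<le> cmod w * cmod (zlog m)" for m
    using abs_Re_le_cmod[of "cnj w * zlog m"] by (simp add: a norm_mult)
  have w2: "(cmod w)\<^sup>2 = s\<^sup>2 + t\<^sup>2" by (simp add: w_def cmod_power2)
  obtain \<eta> C where \<eta>: "\<eta> > 0" and C: "C \<ge> 0"
    and S1: "\<And>M. M \<ge> 1 \<Longrightarrow> cmod (\<Sum>m = 1..M. zlog m) \<le> C * real M powr (1 - \<eta>)"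
    and S2: "\<And>M. M \<ge> 1 \<Longrightarrow> cmod (\<Sum>m = 1..M. (zlog m)\<^sup>2) \<le> C * real M powr (1 - \<eta>)"
    and S3: "\<And>M. M \<ge> 1 \<Longrightarrow> \<bar>\<Sum>m = 1..M. (cmod (zlog m))\<^sup>2 - pi\<^sup>2 / 6\<bar> \<le> C * real M powr (1 - \<eta>)"
    and S4: "\<And>M. M \<ge> 1 \<Longrightarrow> (\<Sum>m = 1..M. (cmod (zlog m)) ^ 4) \<le> C * M"
    using zlog_sums by blast
  obtain C1 where C1: "\<And>n. cmod (\<Sum>m = 1..n. zlog m /\<^sub>R m) \<le> C1"
    using bounded_log_average[OF \<eta> S1] by blast
  obtain C2 where C2: "\<And>n. cmod (\<Sum>m = 1..n. (zlog m)\<^sup>2 /\<^sub>R m) \<le> C2"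
    using bounded_log_average[OF \<eta> S2] by blast
  obtain C3 where C3: "\<And>n. norm (\<Sum>m = 1..n. ((cmod (zlog m))\<^sup>2 - pi\<^sup>2 / 6) /\<^sub>R m) \<le> C3"
    using bounded_log_average[OF \<eta>, of "\<lambda>m. (cmod (zlog m))\<^sup>2 - pi\<^sup>2 / 6" C] S3 by auto
  have S4': "(\<Sum>m = 1..n. (cmod (zlog m)) ^ 4 / m) \<le> C * (2 + ln (real n))" if "n \<ge> 1" for n
    by (rule log_average_le[OF S4 C that])
  \<comment> \<open>With \<open>k = 1\<close> and \<open>k = 3\<close>, the fourth moment controls
    the first and the third.\<close>
  have le4: "cmod z ^ k \<le> 1 + cmod z ^ 4" if "k \<le> 4" for z :: complex and k
  proof (cases "cmod z \<le> 1")
    case True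
    then have "cmod z ^ k \<le> 1" by (intro power_le_one) auto
    then show ?thesis by (simp add: add_increasing2)
  next
    case False
    then have "cmod z ^ k \<le> cmod z ^ 4" using that by (intro power_increasing) auto
    then show ?thesis by simp
  qed
  define A where "A n = (\<Sum>m = 1..n. a m / m)" for n
  define B where "B n = (\<Sum>m = 1..n. (a m)\<^sup>2 / m)" for n
  have A: "\<bar>A n\<bar> \<le> cmod w * C1" for n
  proof -
    have "A n = Re (cnj w * (\<Sum>m = 1..n. zlog m /\<^sub>R m))"
      by (simp add: A_def a sum_distrib_left divide_inverse mult.commute)
    also have "\<bar>\<dots>\<bar> \<le> cmod w * cmod (\<Sum>m = 1..n. zlog m /\<^sub>R m)"
      using abs_Re_le_cmod[of "cnj w * (\<Sum>m = 1..n. zlog m /\<^sub>R m)"] by (simp only: norm_mult complex_mod_cnj)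
    also have "\<dots> \<le> cmod w * C1" by (intro mult_left_mono C1) auto
    finally show ?thesis .
  qed
  define D where "D = (cmod w)\<^sup>2 * (C3 + pi\<^sup>2 / 6) + (cmod w)\<^sup>2 * C2"
  have B: "\<bar>B n - (cmod w)\<^sup>2 * (pi\<^sup>2 / 12) * ln n\<bar> \<le> D" if n: "n \<ge> 1" for n
  proof -
    define p where "p = (\<Sum>m = 1..n. ((cmod (zlog m))\<^sup>2 - pi\<^sup>2 / 6) /\<^sub>R m)"
    define q where "q = Re ((cnj w)\<^sup>2 * (\<Sum>m = 1..n. (zlog m)\<^sup>2 /\<^sub>R m))"
    have "B n = (\<Sum>m = 1..n. (cmod w)\<^sup>2 / 2 * (((cmod (zlog m))\<^sup>2 - pi\<^sup>2 / 6) /\<^sub>R m) +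
        (cmod w)\<^sup>2 / 2 * (pi\<^sup>2 / 6) * inverse (real m) + Re ((cnj w)\<^sup>2 * ((zlog m)\<^sup>2 /\<^sub>R m)) / 2)"
      unfolding B_def
    proof (intro sum.cong refl)
      fix m
      \<comment> \<open>The mean \<open>P\<close> is split off from \<open>U\<close>: what remains
        has bounded logarithmic averages, and \<open>P\<close> itself produces the harmonic
        number.\<close>
      have alg: "(W * U + R) / 2 * i = W / 2 * (i * (U - P)) + W / 2 * P * i + i * R / 2"
        for W U R P i :: real by (simp add: field_simps)
      show "(a m)\<^sup>2 / m = (cmod w)\<^sup>2 / 2 * (((cmod (zlog m))\<^sup>2 - pi\<^sup>2 / 6) /\<^sub>R m) +
          (cmod w)\<^sup>2 / 2 * (pi\<^sup>2 / 6) * inverse (real m) + Re ((cnj w)\<^sup>2 * ((zlog m)\<^sup>2 /\<^sub>R m)) / 2"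
        unfolding a_sq divide_inverse[of _ "real m"] alg[where P = "pi\<^sup>2 / 6"] mult_scaleR_right scaleR_complex.sel real_scaleR_def ..
    qed
    also have "\<dots> = (cmod w)\<^sup>2 / 2 * p + (cmod w)\<^sup>2 / 2 * (pi\<^sup>2 / 6) * harm n + q / 2"
      unfolding p_def q_def harm_def
      by (simp only: sum.distrib sum_distrib_left Re_sum sum_divide_distrib)
    finally have eq: "B n = (cmod w)\<^sup>2 / 2 * p + (cmod w)\<^sup>2 / 2 * (pi\<^sup>2 / 6) * harm n + q / 2" .
    have h: "\<bar>harm n - ln (real n)\<bar> \<le> 1"
    proof -
      have "ln (real n) \<le> ln (real n + 1)" using n by simp
      then show ?thesis using harm_le_ln[OF n] ln_le_harm[of n] by (simp add: abs_le_iff)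
    qed
    have q: "\<bar>q\<bar> \<le> (cmod w)\<^sup>2 * C2"
    proof -
      have "\<bar>q\<bar> \<le> (cmod w)\<^sup>2 * cmod (\<Sum>m = 1..n. (zlog m)\<^sup>2 /\<^sub>R m)"
        unfolding q_def using abs_Re_le_cmod[of "(cnj w)\<^sup>2 * (\<Sum>m = 1..n. (zlog m)\<^sup>2 /\<^sub>R m)"]
        by (simp only: norm_mult norm_power complex_mod_cnj)
      also have "\<dots> \<le> (cmod w)\<^sup>2 * C2" by (intro mult_left_mono C2) auto
      finally show ?thesis .
    qed
    have p: "\<bar>(cmod w)\<^sup>2 * p\<bar> \<le> (cmod w)\<^sup>2 * C3"
      unfolding abs_mult p_def using C3[of n] by (intro mult_mono) auto
    have r: "\<bar>(cmod w)\<^sup>2 * (pi\<^sup>2 / 6) * (harm n - ln (real n))\<bar> \<le> (cmod w)\<^sup>2 * (pi\<^sup>2 / 6) * 1"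
      unfolding abs_mult using h by (intro mult_mono) auto
    have "B n - (cmod w)\<^sup>2 * (pi\<^sup>2 / 12) * ln n =
        (cmod w)\<^sup>2 * p / 2 + (cmod w)\<^sup>2 * (pi\<^sup>2 / 6) * (harm n - ln (real n)) / 2 + q / 2"
      unfolding eq by (simp add: field_simps)
    then show ?thesis using p q r unfolding D_def by (simp add: distrib_left abs_le_iff)
  qed
  have \<tau>0: "\<tau> n \<ge> 0" for n
    by (cases "n = 0") (simp_all add: \<tau>_def)
  \<comment> \<open>At \<open>n = 1\<close> the logarithm vanishes and \<tau> is 1 / 0 = 0, so the
    normalisation holds from 2 on.\<close>
  have \<tau>2: "(\<tau> n)\<^sup>2 * ln (real n) = 12 / pi\<^sup>2" if "n \<ge> 2" for n
  proof -
    have "ln (real n) > 0" using that by simp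
    then show ?thesis by (simp add: \<tau>_def power_divide)
  qed
  have \<tau>_lim: "\<tau> \<longlonglongrightarrow> 0" unfolding \<tau>_def by real_asymp
  have \<tau>3_lim: "(\<lambda>n. (\<tau> n) ^ 3 * (2 + ln (real n))) \<longlonglongrightarrow> 0" unfolding \<tau>_def by real_asymp
  define \<theta> where "\<theta> n m = cis (\<tau> n * a m)" for n m
  define E where "E n = (\<Sum>m = 1..n. (\<theta> n m - 1) / of_nat m)" for n
  have approx: "cmod (cycle_weight (\<theta> n) n - exp (E n)) \<le> 2 * cmod w * (1 + C) * \<tau> n" if n: "n \<ge> 1" for n
  proof -
    have "cmod (cycle_weight (\<theta> n) n - exp (E n)) \<le> 2 * (\<Sum>m = 1..n. cmod (\<theta> n m - 1)) / n"
      unfolding E_def using n by (intro cycle_weight_approx) (auto simp: \<theta>_def)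
    also have "(\<Sum>m = 1..n. cmod (\<theta> n m - 1)) \<le> (\<Sum>m = 1..n. \<tau> n * cmod w * (1 + cmod (zlog m) ^ 4))"
    proof (rule sum_mono)
      fix m
      have "cmod (\<theta> n m - 1) \<le> \<tau> n * \<bar>a m\<bar>"
        unfolding \<theta>_def using norm_cis_minus_one_le[of "\<tau> n * a m"] \<tau>0[of n] by (simp add: abs_mult)
      also have "\<dots> \<le> \<tau> n * (cmod w * cmod (zlog m))"
        by (intro mult_left_mono a_le \<tau>0)
      also have "\<dots> \<le> \<tau> n * (cmod w * (1 + cmod (zlog m) ^ 4))"
        using le4[of 1] by (intro mult_left_mono \<tau>0) auto
      finally show "cmod (\<theta> n m - 1) \<le> \<tau> n * cmod w * (1 + cmod (zlog m) ^ 4)" by (simp add: mult.assoc)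
    qed
    also have "\<dots> = \<tau> n * cmod w * (n + (\<Sum>m = 1..n. cmod (zlog m) ^ 4))"
      by (simp add: sum.distrib flip: sum_distrib_left)
    also have "\<dots> \<le> \<tau> n * cmod w * (n + C * n)"
      by (intro mult_left_mono add_left_mono S4 n mult_nonneg_nonneg \<tau>0) auto
    finally have "cmod (cycle_weight (\<theta> n) n - exp (E n)) \<le> 2 * (\<tau> n * cmod w * (n + C * n)) / n"
      by (simp add: divide_right_mono)
    also have "\<dots> = 2 * cmod w * (1 + C) * \<tau> n" using n by (simp add: field_simps)
    finally show ?thesis .
  qed
  have Etaylor: "cmod (E n - (\<i> * (\<tau> n * A n) - (\<tau> n)\<^sup>2 * B n / 2)) \<le> cmod w ^ 3 * (1 + C) * ((\<tau> n) ^ 3 * (2 + ln (real n)))"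
    if n: "n \<ge> 1" for n
  proof -
    have "E n - (\<i> * (\<tau> n * A n) - (\<tau> n)\<^sup>2 * B n / 2) =
        (\<Sum>m = 1..n. (cis (\<tau> n * a m) - 1 - \<i> * of_real (\<tau> n * a m) + of_real ((\<tau> n * a m)\<^sup>2) / 2) / of_nat m)"
      unfolding E_def \<theta>_def A_def B_def of_real_sum
      by (simp add: sum_distrib_left sum_divide_distrib sum_subtractf sum.distrib algebra_simps
          add_divide_distrib diff_divide_distrib power_mult_distrib)
    also have "cmod \<dots> \<le> (\<Sum>m = 1..n. (\<tau> n) ^ 3 * cmod w ^ 3 * ((1 + cmod (zlog m) ^ 4) / m))"
    proof (rule sum_norm_le)
      fix m assume m: "m \<in> {1..n}"
      have "cmod (cis (\<tau> n * a m) - 1 - \<i> * of_real (\<tau> n * a m) + of_real ((\<tau> n * a m)\<^sup>2) / 2) \<le> \<bar>\<tau> n * a m\<bar> ^ 3"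
        using cis_taylor[of "\<tau> n * a m"] by simp
      also have "\<dots> = (\<tau> n) ^ 3 * \<bar>a m\<bar> ^ 3"
        using \<tau>0[of n] by (simp add: abs_mult power_mult_distrib)
      also have "\<dots> \<le> (\<tau> n) ^ 3 * (cmod w * cmod (zlog m)) ^ 3"
        by (intro mult_left_mono power_mono a_le zero_le_power \<tau>0) auto
      also have "\<dots> \<le> (\<tau> n) ^ 3 * (cmod w ^ 3 * (1 + cmod (zlog m) ^ 4))"
        unfolding power_mult_distrib by (intro mult_left_mono le4 zero_le_power \<tau>0) auto
      finally have "cmod (cis (\<tau> n * a m) - 1 - \<i> * of_real (\<tau> n * a m) + of_real ((\<tau> n * a m)\<^sup>2) / 2) / m
          \<le> (\<tau> n) ^ 3 * (cmod w ^ 3 * (1 + cmod (zlog m) ^ 4)) / m"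
        by (rule divide_right_mono) simp
      then show "cmod ((cis (\<tau> n * a m) - 1 - \<i> * of_real (\<tau> n * a m) + of_real ((\<tau> n * a m)\<^sup>2) / 2) / of_nat m)
          \<le> (\<tau> n) ^ 3 * cmod w ^ 3 * ((1 + cmod (zlog m) ^ 4) / m)"
        by (simp only: norm_divide norm_of_nat mult.assoc times_divide_eq_right)
    qed
    also have "\<dots> = (\<tau> n) ^ 3 * cmod w ^ 3 * (harm n + (\<Sum>m = 1..n. cmod (zlog m) ^ 4 / m))"
      by (simp add: harm_def add_divide_distrib sum.distrib inverse_eq_divide flip: sum_distrib_left)
    also have "\<dots> \<le> (\<tau> n) ^ 3 * cmod w ^ 3 * ((2 + ln (real n)) + C * (2 + ln (real n)))"
      using harm_le_ln[OF n] by (intro mult_left_mono add_mono S4' n mult_nonneg_nonneg zero_le_power \<tau>0) auto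
    also have "\<dots> = cmod w ^ 3 * (1 + C) * ((\<tau> n) ^ 3 * (2 + ln (real n)))"
      by (simp add: algebra_simps)
    finally show ?thesis .
  qed
  have "(\<lambda>n. \<tau> n * A n) \<longlonglongrightarrow> 0"
  proof (rule Lim_null_comparison)
    show "eventually (\<lambda>n. norm (\<tau> n * A n) \<le> \<tau> n * (cmod w * C1)) sequentially"
      using A \<tau>0 by (intro always_eventually allI) (auto simp: abs_mult intro!: mult_left_mono)
    show "(\<lambda>n. \<tau> n * (cmod w * C1)) \<longlonglongrightarrow> 0"
      using tendsto_mult_right[OF \<tau>_lim, of "cmod w * C1"] by simp
  qed
  moreover have "(\<lambda>n. (\<tau> n)\<^sup>2 * B n) \<longlonglongrightarrow> (cmod w)\<^sup>2"
  proof (rule LIM_zero_cancel, rule Lim_null_comparison)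
    show "eventually (\<lambda>n. norm ((\<tau> n)\<^sup>2 * B n - (cmod w)\<^sup>2) \<le> (\<tau> n)\<^sup>2 * D) sequentially"
      using eventually_ge_at_top[of 2]
    proof eventually_elim
      case (elim n)
      have "(\<tau> n)\<^sup>2 * ((cmod w)\<^sup>2 * (pi\<^sup>2 / 12) * ln n) = (cmod w)\<^sup>2 * (pi\<^sup>2 / 12) * ((\<tau> n)\<^sup>2 * ln n)"
        by simp
      also have "\<dots> = (cmod w)\<^sup>2" unfolding \<tau>2[OF elim] by simp
      finally have "(\<tau> n)\<^sup>2 * B n - (cmod w)\<^sup>2 = (\<tau> n)\<^sup>2 * (B n - (cmod w)\<^sup>2 * (pi\<^sup>2 / 12) * ln n)"
        by (simp add: right_diff_distrib)
      then show ?case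
        using B[of n] elim by (auto simp: abs_mult intro!: mult_left_mono)
    qed
    show "(\<lambda>n. (\<tau> n)\<^sup>2 * D) \<longlonglongrightarrow> 0"
      using tendsto_mult_right[OF tendsto_power[OF \<tau>_lim, of 2], of D] by simp
  qed
  ultimately have "(\<lambda>n. \<i> * of_real (\<tau> n * A n) - of_real ((\<tau> n)\<^sup>2 * B n) / 2) \<longlonglongrightarrow>
      \<i> * of_real 0 - of_real ((cmod w)\<^sup>2) / 2"
    by (intro tendsto_intros) auto
  moreover have "(\<lambda>n. E n - (\<i> * of_real (\<tau> n * A n) - of_real ((\<tau> n)\<^sup>2 * B n) / 2)) \<longlonglongrightarrow> 0"
  proof (rule Lim_null_comparison)
    show "eventually (\<lambda>n. norm (E n - (\<i> * of_real (\<tau> n * A n) - of_real ((\<tau> n)\<^sup>2 * B n) / 2)) \<le>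
        cmod w ^ 3 * (1 + C) * ((\<tau> n) ^ 3 * (2 + ln (real n)))) sequentially"
      using eventually_ge_at_top[of 1]
      by eventually_elim (use Etaylor in simp)
    show "(\<lambda>n. cmod w ^ 3 * (1 + C) * ((\<tau> n) ^ 3 * (2 + ln (real n)))) \<longlonglongrightarrow> 0"
      using tendsto_mult_left[OF \<tau>3_lim, of "cmod w ^ 3 * (1 + C)"] by simp
  qed
  ultimately have "E \<longlonglongrightarrow> - of_real ((cmod w)\<^sup>2) / 2"
    using tendsto_add[of "\<lambda>n. E n - (\<i> * of_real (\<tau> n * A n) - of_real ((\<tau> n)\<^sup>2 * B n) / 2)" 0 sequentially
        "\<lambda>n. \<i> * of_real (\<tau> n * A n) - of_real ((\<tau> n)\<^sup>2 * B n) / 2" "- of_real ((cmod w)\<^sup>2) / 2"]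
    by simp
  then have "(\<lambda>n. exp (E n)) \<longlonglongrightarrow> exp (- of_real ((cmod w)\<^sup>2) / 2)"
    by (rule tendsto_exp)
  moreover have "(\<lambda>n. cycle_weight (\<theta> n) n - exp (E n)) \<longlonglongrightarrow> 0"
  proof (rule Lim_null_comparison)
    show "eventually (\<lambda>n. cmod (cycle_weight (\<theta> n) n - exp (E n)) \<le> 2 * cmod w * (1 + C) * \<tau> n) sequentially"
      using eventually_ge_at_top[of 1] by eventually_elim (rule approx)
    show "(\<lambda>n. 2 * cmod w * (1 + C) * \<tau> n) \<longlonglongrightarrow> 0"
      using tendsto_mult_left[OF \<tau>_lim, of "2 * cmod w * (1 + C)"] by simp
  qed
  ultimately have "(\<lambda>n. cycle_weight (\<theta> n) n) \<longlonglongrightarrow> exp (- of_real ((cmod w)\<^sup>2) / 2)"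
    by (rule Lim_transform)
  moreover have "exp (- complex_of_real ((cmod w)\<^sup>2) / 2) = of_real (exp (- (s\<^sup>2 + t\<^sup>2) / 2))"
    unfolding w2 by (simp flip: exp_of_real)
  moreover have "\<theta> n = (\<lambda>m. cis (\<tau> n * a m))" for n
    by (simp add: \<theta>_def fun_eq_iff)
  ultimately show ?thesis by simp
qed

section \<open>From cycle counts to cycle weights\<close>

lemma prod_cycle_count:
  assumes \<sigma>: "\<sigma> permutes {..<n}"
  shows "(\<Prod>m = 1..n. \<theta> m ^ cycle_count n m \<sigma>) = orbit_weight \<theta> {..<n} \<sigma>"
proof -
  have "orbit_weight \<theta> {..<n} \<sigma> = (\<Prod>m = 1..n. \<Prod>c\<in>{c \<in> orbit \<sigma> ` {..<n}. card c = m}. \<theta> (card c))"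
    unfolding orbit_weight_def
  proof (rule prod.group[symmetric])
    show "card ` (orbit \<sigma> ` {..<n}) \<subseteq> {1..n}"
    proof (clarify)
      fix i assume "i < n"
      then have "orbit \<sigma> i \<subseteq> {..<n}"
        using permutes_orbit_subset[OF \<sigma>] by simp
      then have "card (orbit \<sigma> i) \<le> n" "finite (orbit \<sigma> i)"
        using card_mono[of "{..<n}"] by (auto intro: finite_subset)
      then show "card (orbit \<sigma> i) \<in> {1..n}"
        using orbit_nonempty[of \<sigma> i] by (simp add: Suc_le_eq card_gt_0_iff)
    qed
  qed auto
  also have "\<dots> = (\<Prod>m = 1..n. \<theta> m ^ cycle_count n m \<sigma>)"
    by (intro prod.cong refl) (simp add: cycle_count_def)
  finally show ?thesis ..
qed

text \<open>\<open>cis\<close> turns a linear combination of the counts into a product of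
  \<open>cis (b m)\<close> over the cycles, and \<open>sum_orbit_weight\<close> evaluates the sum of
  such products.\<close>

lemma expectation_cis_cycle_counts:
  "(\<integral>\<sigma>. cis (\<Sum>m = 1..n. real (cycle_count n m \<sigma>) * b m)
      \<partial>measure_pmf (pmf_of_set {\<sigma>. \<sigma> permutes {..<n}})) = cycle_weight (\<lambda>m. cis (b m)) n"
proof -
  define S where "S = {\<sigma>. \<sigma> permutes {..<n}}"
  have S: "finite S" "S \<noteq> {}" "card S = fact n"
    by (auto simp: S_def finite_permutations card_permutations intro!: exI[of _ id] permutes_id)
  have "(\<Sum>\<sigma>\<in>S. cis (\<Sum>m = 1..n. real (cycle_count n m \<sigma>) * b m)) = (\<Sum>\<sigma>\<in>S. orbit_weight (\<lambda>m. cis (b m)) {..<n} \<sigma>)"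
  proof (rule sum.cong[OF refl])
    fix \<sigma> assume "\<sigma> \<in> S"
    have "cis (\<Sum>m = 1..n. real (cycle_count n m \<sigma>) * b m) = (\<Prod>m = 1..n. cis (b m) ^ cycle_count n m \<sigma>)"
      by (simp add: cis_conv_exp sum_distrib_left exp_sum mult_ac flip: exp_of_nat_mult)
    also have "\<dots> = orbit_weight (\<lambda>m. cis (b m)) {..<n} \<sigma>"
      using \<open>\<sigma> \<in> S\<close> by (intro prod_cycle_count) (simp add: S_def)
    finally show "cis (\<Sum>m = 1..n. real (cycle_count n m \<sigma>) * b m) = orbit_weight (\<lambda>m. cis (b m)) {..<n} \<sigma>" .
  qed
  also have "\<dots> = fact n * cycle_weight (\<lambda>m. cis (b m)) n"
    unfolding S_def using sum_orbit_weight[of "{..<n}" "\<lambda>m. cis (b m)"] by simp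
  finally have sum: "(\<Sum>\<sigma>\<in>S. cis (\<Sum>m = 1..n. real (cycle_count n m \<sigma>) * b m)) =
      fact n * cycle_weight (\<lambda>m. cis (b m)) n" .
  show ?thesis
    unfolding S_def[symmetric] using S
    by (subst integral_measure_pmf[of S]) (simp_all add: sum flip: scaleR_sum_right del: One_nat_def, simp add: scaleR_conv_of_real)
qed

lemma integral_cis_indep_std_normal:
  assumes "prob_space N"
    and da: "distributed N lborel U std_normal_density"
    and db: "distributed N lborel V std_normal_density"
    and ind: "prob_space.indep_var N borel U borel V"
  shows "(\<integral>\<omega>. cis (s * U \<omega> + t * V \<omega>) \<partial>N) = of_real (exp (- (s\<^sup>2 + t\<^sup>2) / 2))"
proof -
  interpret prob_space N by fact
  have one: "(\<integral>\<omega>. cis (r * Z \<omega>) \<partial>N) = of_real (exp (- r\<^sup>2 / 2))"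
    if Z: "distributed N lborel Z std_normal_density" for Z and r
  proof -
    have [measurable]: "Z \<in> borel_measurable N" using distributed_measurable[OF Z] by simp
    have "(\<integral>\<omega>. cis (r * Z \<omega>) \<partial>N) = (\<integral>y. iexp (r * y) \<partial>distr N lborel Z)"
      by (subst integral_distr) (auto simp: cis_conv_exp)
    also have "\<dots> = char std_normal_distribution r"
      unfolding distributed_distr_eq_density[OF Z] char_def by simp
    finally show ?thesis by (simp add: char_std_normal_distribution)
  qed
  have m: "(\<lambda>y. cis (r * y)) \<in> borel_measurable borel" for r
    by (intro borel_measurable_continuous_onI continuous_intros)
  have meas: "U \<in> borel_measurable N" "V \<in> borel_measurable N"
    using distributed_measurable[OF da] distributed_measurable[OF db] by auto
  have "indep_var borel ((\<lambda>y. cis (s * y)) \<circ> U) borel ((\<lambda>y. cis (t * y)) \<circ> V)"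
    by (rule indep_var_compose[OF ind m m])
  then have "(\<integral>\<omega>. cis (s * U \<omega>) * cis (t * V \<omega>) \<partial>N) = (\<integral>\<omega>. cis (s * U \<omega>) \<partial>N) * (\<integral>\<omega>. cis (t * V \<omega>) \<partial>N)"
    using measurable_compose[OF meas(1) m] measurable_compose[OF meas(2) m]
    by (intro indep_var_lebesgue_integral) (auto simp: comp_def intro!: integrable_const_bound[of _ 1])
  then show ?thesis
    by (simp add: one[OF da] one[OF db] cis_mult add_divide_distrib diff_divide_distrib flip: of_real_mult exp_add)
qed

theorem corollary2p7p1:
  fixes x :: complex
    and N :: "'b measure" and N\<^sub>a N\<^sub>b :: "'b \<Rightarrow> real"
  assumes "cmod x = 1"
    and "\<forall>k::nat. k \<ge> 1 \<longrightarrow> x ^ k \<noteq> 1"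
    and "finite_type x"
    and "prob_space N"
    and "distributed N lborel N\<^sub>a std_normal_density"
    and "distributed N lborel N\<^sub>b std_normal_density"
    and "prob_space.indep_var N borel N\<^sub>a borel N\<^sub>b"
  shows "converges_in_distribution
    (\<lambda>n. measure_pmf (pmf_of_set {\<sigma>. \<sigma> permutes {..<n}}))
    (\<lambda>n \<sigma>. (Re (Log_perm_charpoly n x \<sigma> / of_real (sqrt (pi\<^sup>2 / 12 * ln (real n)))),
            Im (Log_perm_charpoly n x \<sigma> / of_real (sqrt (pi\<^sup>2 / 12 * ln (real n))))))
    N (\<lambda>\<omega>. (N\<^sub>a \<omega>, N\<^sub>b \<omega>))"
proof (rule converges_in_distribution_char_pair)
  obtain c g where "diophantine x c g"
    using finite_type_imp_diophantine assms(1,3) by blast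
  then interpret diophantine x c g .
  define r where "r n = sqrt (pi\<^sup>2 / 12 * ln (real n))" for n
  show "prob_space (measure_pmf (pmf_of_set {\<sigma>. \<sigma> permutes {..<n}}))" for n
    by (rule measure_pmf.prob_space_axioms)
  show "prob_space N" by fact
  have "N\<^sub>a \<in> borel_measurable N" "N\<^sub>b \<in> borel_measurable N"
    using distributed_measurable[OF assms(5)] distributed_measurable[OF assms(6)] by auto
  then show "(\<lambda>\<omega>. (N\<^sub>a \<omega>, N\<^sub>b \<omega>)) \<in> borel_measurable N"
    by simp
  fix s t :: real
  \<comment> \<open>The logarithm is linear in the cycle counts, so its component in any direction
    is a statistic to which \<open>expectation_cis_cycle_counts\<close> applies.\<close>
  have lin: "s * Re (Log_perm_charpoly n x \<sigma> / of_real (r n)) + t * Im (Log_perm_charpoly n x \<sigma> / of_real (r n)) =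
      (\<Sum>m = 1..n. real (cycle_count n m \<sigma>) * (1 / r n * (s * Re (zlog m) + t * Im (zlog m))))" for n \<sigma>
    by (simp add: Log_perm_charpoly_def zlog_def sum_distrib_left sum_divide_distrib sum.distrib
        add_divide_distrib algebra_simps)
  show "(\<lambda>n. \<integral>\<sigma>. cis (s * fst (Re (Log_perm_charpoly n x \<sigma> / of_real (sqrt (pi\<^sup>2 / 12 * ln (real n)))),
            Im (Log_perm_charpoly n x \<sigma> / of_real (sqrt (pi\<^sup>2 / 12 * ln (real n))))) +
          t * snd (Re (Log_perm_charpoly n x \<sigma> / of_real (sqrt (pi\<^sup>2 / 12 * ln (real n)))),
            Im (Log_perm_charpoly n x \<sigma> / of_real (sqrt (pi\<^sup>2 / 12 * ln (real n))))))
        \<partial>measure_pmf (pmf_of_set {\<sigma>. \<sigma> permutes {..<n}}))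
      \<longlonglongrightarrow> (\<integral>\<omega>. cis (s * fst (N\<^sub>a \<omega>, N\<^sub>b \<omega>) + t * snd (N\<^sub>a \<omega>, N\<^sub>b \<omega>)) \<partial>N)"
    unfolding fst_conv snd_conv r_def[symmetric] lin expectation_cis_cycle_counts
      integral_cis_indep_std_normal[OF assms(4-7)]
    using cycle_weight_char_tendsto[of s t] by (simp add: r_def)
qed simp

end
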